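(* Let $G=(V,E)$ be a simple connected undirected graph that is locally finite and transient (for the simple random walk), let a local mechanism $\tau_x$ be fixed at every vertex $x\in V$, and let $a\in V$. Suppose that every tree (connected component of the underlying unoriented graph) in the wired spanning forest oriented toward infinity $\mathsf{WSF}$ of $G$ has a single end almost surely. Then, for almost every $\rho$ sampled from $\mathsf{WSF}$, $$\lim_{n\to\infty}\frac{I(\rho,n)}{n}=\alpha_G,$$ where $I(\rho,n)$ is the number of particles, out of $n$ particles started at $a$ and performing rotor walk successively with initial rotor configuration $\rho$, that do not return to $a$, and $\alpha_G$ is the probability that the simple random walk on $G$ started at $a$ never returns to $a$.
   Context: Local mechanisms and rotor configurations. Each vertex $x\in V$ carries a local mechanism $\tau_x$, a bijection of the neighbor set $N(x)$ having a single orbit, i.e. $\{\tau_x^i(y): i\ge 0\}=N(x)$ for every $y\in N(x)$. A rotor configuration is a function $\rho:V\to V$ with $\rho(x)\in N(x)$ for all $x$. Rotor walk. A walker located at $X_t$ with current rotor configuration $\rho_t$ first updates the rotor at $X_t$ to $\tau_{X_t}(\rho_t(X_t))$ (all other rotors are unchanged), giving $\rho_{t+1}$, and then moves to $X_{t+1}=\tau_{X_t}(\rho_t(X_t))$. Escape counts. Start with rotor configuration $\rho$ and $n$ particles at $a$. Each particle in turn performs rotor walk from $a$ until it either returns to $a$ (at a time $t\ge1$) or escapes to infinity (never returns to $a$), each particle using the rotor configuration left by the previous ones (if a particle escapes, the rotor configuration left is the pointwise limit of $\rho_t$ as $t\to\infty$; it exists since a particle never returning to $a$ visits each vertex finitely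 often). $I(\rho,n)$ is the number of the $n$ particles that do not return to $a$. Wired spanning forest. For $Z\subseteq V$, a $Z$-oriented spanning forest of $G$ is an oriented subgraph $F$ of $G$ in which every vertex of $Z$ has outdegree $0$, every vertex of $V\setminus Z$ has outdegree $1$, and there are no oriented cycles (including cycles of length 2). If $V\setminus Z$ is finite, $\mathsf{USF}(Z)$ is the uniform probability measure on the (finitely many) $Z$-oriented spanning forests. For $G$ transient, $\mathsf{WSF}$ is the unique probability measure on oriented subgraphs of $G$ such that for every finite set $B$ of oriented edges, $\mathsf{WSF}[B\subseteq F]=\lim_{R\to\infty}\mathsf{USF}(Z_R)[B\subseteq F_R]$, where $F\sim\mathsf{WSF}$, $F_R\sim\mathsf{USF}(Z_R)$, and $Z_0\supseteq Z_1\supseteq\cdots$ are subsets of $V$ with each $V\setminus Z_R$ finite and $\bigcap_R Z_R=\varnothing$; the limit exists and does not depend on the choice of $(Z_R)$. A forest $F$ in which each vertex has outdegree $1$ is identified with the rotor configuration sending $x$ to its out-neighbor in $F$. Ends. An end of a tree is an equivalence class of infinite (simple) paths, two paths being equivalent if they differ by only finitely many vertices. *)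

theory Defs
  imports "HOL-Probability.Probability"
begin

text \<open>
  A graph on the vertex set \<^term>\<open>UNIV :: 'v set\<close> is a relation \<^term>\<open>E :: ('v \<times> 'v) set\<close>. For an
  undirected simple graph \<^term>\<open>E\<close> is symmetric and irreflexive, so it is at the same time the set
  of all oriented edges, and the neighbor set of \<^term>\<open>x\<close> is \<^term>\<open>E `` {x}\<close>.
\<close>

definition simple_graph :: "('v \<times> 'v) set \<Rightarrow> bool" where
  "simple_graph E \<longleftrightarrow> sym E \<and> irrefl E"

definition connected_graph :: "('v \<times> 'v) set \<Rightarrow> bool" where
  "connected_graph E \<longleftrightarrow> (\<forall>x y. (x, y) \<in> E\<^sup>*)"

definition locally_finite_graph :: "('v \<times> 'v) set \<Rightarrow> bool" where
  "locally_finite_graph E \<longleftrightarrow> (\<forall>x. finite (E `` {x}))"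


section \<open>Simple random walk\<close>

text \<open>Law of the position at time \<^term>\<open>i\<close>, given the positions \<^term>\<open>X\<close> at earlier times.\<close>

definition srw_kernel :: "('v \<times> 'v) set \<Rightarrow> 'v \<Rightarrow> nat \<Rightarrow> (nat \<Rightarrow> 'v) \<Rightarrow> 'v pmf" where
  "srw_kernel E a i X = (case i of 0 \<Rightarrow> return_pmf a | Suc j \<Rightarrow> pmf_of_set (E `` {X j}))"

lemma Ionescu_Tulcea_srw:
  "Ionescu_Tulcea (\<lambda>i X. measure_pmf (srw_kernel E a i X)) (\<lambda>_. count_space UNIV)"
proof
  fix i
  show "(\<lambda>X. measure_pmf (srw_kernel E a i X))
    \<in> measurable (PiM {0..<i} (\<lambda>_. count_space UNIV)) (subprob_algebra (count_space UNIV))"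
  proof (cases i)
    case 0
    then show ?thesis
      by (simp add: srw_kernel_def space_subprob_algebra measure_pmf.subprob_space_axioms)
  next
    case (Suc j)
    have "(\<lambda>X. X j) \<in> measurable (PiM {0..<i} (\<lambda>_. count_space UNIV)) (count_space (UNIV :: 'a set))"
      by (rule measurable_component_singleton) (simp add: Suc)
    moreover have "(\<lambda>y. measure_pmf (pmf_of_set (E `` {y})))
        \<in> measurable (count_space UNIV) (subprob_algebra (count_space UNIV))"
      by (simp add: space_subprob_algebra measure_pmf.subprob_space_axioms)
    ultimately show ?thesis
      by (auto simp: Suc srw_kernel_def dest: measurable_compose)
  qed
qed

text \<open>
  The law, on trajectories \<^typ>\<open>nat \<Rightarrow> 'v\<close>, of the simple random walk started at \<^term>\<open>a\<close>: the measure
  that the Ionescu-Tulcea theorem associates with the kernels above.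
\<close>

definition srw :: "('v \<times> 'v) set \<Rightarrow> 'v \<Rightarrow> (nat \<Rightarrow> 'v) measure" where
  "srw E a = projective_family.lim UNIV
     (Ionescu_Tulcea.CI (\<lambda>i X. measure_pmf (srw_kernel E a i X)) (\<lambda>_. count_space UNIV))
     (\<lambda>_. count_space UNIV)"

lemma sets_srw: "sets (srw E a) = sets (PiM UNIV (\<lambda>_. count_space UNIV))"
  and space_srw: "space (srw E a) = UNIV"
  and prob_space_srw: "prob_space (srw E a)"
  and srw_cylinder: "measure (srw E a) {X. \<forall>i<n. X i = x i} = (\<Prod>i<n. pmf (srw_kernel E a i x) (x i))"
proof -
  interpret IT: Ionescu_Tulcea "\<lambda>i X. measure_pmf (srw_kernel E a i X)" "\<lambda>_. count_space UNIV"
    by (rule Ionescu_Tulcea_srw)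
  show sets: "sets (srw E a) = sets (PiM UNIV (\<lambda>_. count_space UNIV))"
    unfolding srw_def by (rule IT.PF.sets_lim)
  show "space (srw E a) = UNIV"
    using sets_eq_imp_space_eq[OF sets] by (simp add: space_PiM)
  let ?N = "\<lambda>_::nat. count_space (UNIV :: 'a set)"
  let ?A = "\<lambda>n. {restrict x {0..<n}}"
  have A: "?A n \<in> sets (PiM {0..<n} ?N)" for n
  proof -
    have "?A n = PiE {0..<n} (\<lambda>i. {x i})"
      by (auto simp: PiE_iff extensional_def restrict_def fun_eq_iff)
    also have "\<dots> \<in> sets (PiM {0..<n} ?N)"
      by (rule sets_PiM_I_finite) auto
    finally show ?thesis .
  qed
  have C: "emeasure (IT.C 0 n (\<lambda>_. undefined)) (?A n) = (\<Prod>i<n. ennreal (pmf (srw_kernel E a i x) (x i)))" for n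
  proof (induction n)
    case 0
    have "restrict x {0..<0} = (\<lambda>_. undefined)" by auto
    then show ?case using A[of 0] by (simp add: emeasure_return)
  next
    case (Suc n)
    have u: "(\<lambda>_. undefined) \<in> space (PiM {0..<0} ?N)" by (simp add: space_PiM)
    have eP: "emeasure (IT.eP n X) (?A (Suc n)) =
        ennreal (pmf (srw_kernel E a n x) (x n)) * indicator (?A n) X"
      if X: "X \<in> space (PiM {0..<n} ?N)" for X
    proof -
      have ext: "X \<in> extensional {0..<n}" using X by (auto simp: space_PiM PiE_def)
      have "(\<lambda>y. X(n := y)) -` ?A (Suc n) = (if X \<in> ?A n then {x n} else {})"
      proof (cases "X \<in> ?A n")
        case True
        then have "X(n := y) = restrict x {0..<Suc n} \<longleftrightarrow> y = x n" for y
          by (auto simp: fun_eq_iff less_Suc_eq)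
        with True show ?thesis by auto
      next
        case False
        then obtain i where "X i \<noteq> restrict x {0..<n} i" by (auto simp: fun_eq_iff)
        moreover from this ext have "i < n" by (auto simp: extensional_def restrict_def split: if_splits)
        ultimately have "(X(n := y)) i \<noteq> restrict x {0..<Suc n} i" for y by auto
        then have "X(n := y) \<noteq> restrict x {0..<Suc n}" for y by metis
        with False show ?thesis by auto
      qed
      moreover have "srw_kernel E a n X = srw_kernel E a n x" if "X \<in> ?A n"
        using that by (auto simp: srw_kernel_def split: nat.split)
      ultimately show ?thesis
        using IT.emeasure_eP[OF X A] by (auto simp: emeasure_pmf_single)
    qed
    have "emeasure (IT.C 0 (Suc n) (\<lambda>_. undefined)) (?A (Suc n)) =
        (\<integral>\<^sup>+X. emeasure (IT.eP n X) (?A (Suc n)) \<partial>IT.C 0 n (\<lambda>_. undefined))"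
      using IT.prob_space_C[OF u, of n] A[of "Suc n"] IT.measurable_eP[of n]
      by (simp del: restrict_apply, subst emeasure_bind[where N="PiM {0..<Suc n} ?N"])
         (auto simp: prob_space.not_empty IT.sets_C[OF u] measurable_cong_sets[OF IT.sets_C[OF u] refl])
    also have "\<dots> = (\<integral>\<^sup>+X. ennreal (pmf (srw_kernel E a n x) (x n)) * indicator (?A n) X \<partial>IT.C 0 n (\<lambda>_. undefined))"
      by (intro nn_integral_cong eP) (simp add: IT.space_C[OF u])
    also have "\<dots> = ennreal (pmf (srw_kernel E a n x) (x n)) * emeasure (IT.C 0 n (\<lambda>_. undefined)) (?A n)"
      using A[of n] by (subst nn_integral_cmult_indicator) (auto simp: IT.sets_C[OF u])
    finally show ?case
      unfolding Suc.IH by (simp add: mult.commute del: restrict_apply)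
  qed
  have cyl: "emeasure (srw E a) {X. \<forall>i<n. X i = x i} = (\<Prod>i<n. ennreal (pmf (srw_kernel E a i x) (x i)))" for n
  proof -
    have emb: "IT.PF.emb UNIV {0..<n} (?A n) = {X. \<forall>i<n. X i = x i}"
      by (auto simp: prod_emb_def space_PiM restrict_def fun_eq_iff) metis
    have id: "IT.PF.emb {0..<n} {0..<n} (?A n) = ?A n"
      using A[of n] by (simp add: prod_emb_id space_PiM)
    show ?thesis
      using IT.lim[of "{0..<n}" "?A n"] IT.emeasure_CI[of "{0..<n}" n "?A n"] A[of n]
      by (simp add: emb id C srw_def)
  qed
  show ps: "prob_space (srw E a)"
    by (rule prob_spaceI) (use cyl[of 0] sets_eq_imp_space_eq[OF sets] in \<open>simp add: space_PiM\<close>)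
  show "measure (srw E a) {X. \<forall>i<n. X i = x i} = (\<Prod>i<n. pmf (srw_kernel E a i x) (x i))"
    using cyl[of n] by (simp add: measure_def prod_ennreal prod_nonneg)
qed

definition escape_prob :: "('v \<times> 'v) set \<Rightarrow> 'v \<Rightarrow> real" where
  "escape_prob E a = measure (srw E a) {X \<in> space (srw E a). \<forall>t\<ge>1. X t \<noteq> a}"

definition transient_graph :: "('v \<times> 'v) set \<Rightarrow> bool" where
  "transient_graph E \<longleftrightarrow> (\<forall>x. escape_prob E x > 0)"


section \<open>Rotor walk\<close>

definition local_mechanism :: "('v \<times> 'v) set \<Rightarrow> ('v \<Rightarrow> 'v \<Rightarrow> 'v) \<Rightarrow> bool" where
  "local_mechanism E \<tau> \<longleftrightarrow> (\<forall>x. bij_betw (\<tau> x) (E `` {x}) (E `` {x}) \<and>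
     (\<forall>y\<in>E `` {x}. range (\<lambda>i. (\<tau> x ^^ i) y) = E `` {x}))"

text \<open>A state is a pair of the walker's position and the rotor configuration.\<close>

definition rotor_step :: "('v \<Rightarrow> 'v \<Rightarrow> 'v) \<Rightarrow> 'v \<times> ('v \<Rightarrow> 'v) \<Rightarrow> 'v \<times> ('v \<Rightarrow> 'v)" where
  "rotor_step \<tau> s = (case s of (x, \<rho>) \<Rightarrow> (\<tau> x (\<rho> x), \<rho>(x := \<tau> x (\<rho> x))))"

definition walker_at :: "('v \<Rightarrow> 'v \<Rightarrow> 'v) \<Rightarrow> 'v \<Rightarrow> ('v \<Rightarrow> 'v) \<Rightarrow> nat \<Rightarrow> 'v" where
  "walker_at \<tau> a \<rho> t = fst ((rotor_step \<tau> ^^ t) (a, \<rho>))"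

definition rotors_at :: "('v \<Rightarrow> 'v \<Rightarrow> 'v) \<Rightarrow> 'v \<Rightarrow> ('v \<Rightarrow> 'v) \<Rightarrow> nat \<Rightarrow> ('v \<Rightarrow> 'v)" where
  "rotors_at \<tau> a \<rho> t = snd ((rotor_step \<tau> ^^ t) (a, \<rho>))"

definition returns :: "('v \<Rightarrow> 'v \<Rightarrow> 'v) \<Rightarrow> 'v \<Rightarrow> ('v \<Rightarrow> 'v) \<Rightarrow> bool" where
  "returns \<tau> a \<rho> \<longleftrightarrow> (\<exists>t\<ge>1. walker_at \<tau> a \<rho> t = a)"

text \<open>
  The rotors left behind by one particle: those at its first return to \<^term>\<open>a\<close>, or else the
  pointwise limit, vertices being discrete, of the rotors as time tends to infinity.
\<close>

definition leftover :: "('v \<Rightarrow> 'v \<Rightarrow> 'v) \<Rightarrow> 'v \<Rightarrow> ('v \<Rightarrow> 'v) \<Rightarrow> ('v \<Rightarrow> 'v)" where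
  "leftover \<tau> a \<rho> =
    (if returns \<tau> a \<rho> then rotors_at \<tau> a \<rho> (LEAST t. t \<ge> 1 \<and> walker_at \<tau> a \<rho> t = a)
     else (\<lambda>x. THE y. eventually (\<lambda>t. rotors_at \<tau> a \<rho> t x = y) sequentially))"

definition escape_count :: "('v \<Rightarrow> 'v \<Rightarrow> 'v) \<Rightarrow> 'v \<Rightarrow> ('v \<Rightarrow> 'v) \<Rightarrow> nat \<Rightarrow> nat" where
  "escape_count \<tau> a \<rho> n = card {k. k < n \<and> \<not> returns \<tau> a ((leftover \<tau> a ^^ k) \<rho>)}"


section \<open>Wired spanning forest\<close>

definition oriented_spanning_forest :: "('v \<times> 'v) set \<Rightarrow> 'v set \<Rightarrow> ('v \<times> 'v) set \<Rightarrow> bool" where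
  "oriented_spanning_forest E Z F \<longleftrightarrow> F \<subseteq> E \<and> (\<forall>x\<in>Z. card (F `` {x}) = 0) \<and>
     (\<forall>x\<in>- Z. card (F `` {x}) = 1) \<and> acyclic F"

definition USF :: "('v \<times> 'v) set \<Rightarrow> 'v set \<Rightarrow> ('v \<times> 'v) set pmf" where
  "USF E Z = pmf_of_set {F. oriented_spanning_forest E Z F}"

definition subgraph_space :: "('v \<times> 'v) set \<Rightarrow> ('v \<times> 'v) set measure" where
  "subgraph_space E = sigma (Pow E) ((\<lambda>e. {F \<in> Pow E. e \<in> F}) ` E)"

text \<open>
  On a transient graph exactly one measure satisfies the following predicate. Its sigma-algebra is
  generated by the events that a given oriented edge of the graph lies in the random subgraph.
\<close>

definition is_WSF :: "('v \<times> 'v) set \<Rightarrow> ('v \<times> 'v) set measure \<Rightarrow> bool" where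
  "is_WSF E W \<longleftrightarrow> prob_space W \<and> sets W = sets (subgraph_space E) \<and>
     (\<forall>Z :: nat \<Rightarrow> 'v set. decseq Z \<and> (\<forall>R. finite (- Z R)) \<and> (\<Inter>R. Z R) = {} \<longrightarrow>
       (\<forall>B. finite B \<and> B \<subseteq> E \<longrightarrow>
         (\<lambda>R. measure_pmf.prob (USF E (Z R)) {F. B \<subseteq> F}) \<longlonglongrightarrow> measure W {F \<in> space W. B \<subseteq> F}))"

definition rotor_config_of :: "('v \<times> 'v) set \<Rightarrow> 'v \<Rightarrow> 'v" where
  "rotor_config_of F x = (THE y. (x, y) \<in> F)"


section \<open>Ends\<close>

text \<open>
  In the following \<^term>\<open>H\<close> is a symmetric relation (an unoriented graph), and \<^term>\<open>x\<close> selects its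
  connected component.
\<close>

definition rays_of_component :: "('v \<times> 'v) set \<Rightarrow> 'v \<Rightarrow> (nat \<Rightarrow> 'v) set" where
  "rays_of_component H x = {p. inj p \<and> (\<forall>n. (p n, p (Suc n)) \<in> H) \<and> range p \<subseteq> H\<^sup>* `` {x}}"

definition ends_of_component :: "('v \<times> 'v) set \<Rightarrow> 'v \<Rightarrow> (nat \<Rightarrow> 'v) set set" where
  "ends_of_component H x = rays_of_component H x //
     {(p, q). p \<in> rays_of_component H x \<and> q \<in> rays_of_component H x \<and>
        finite (range p - range q) \<and> finite (range q - range p)}"

text \<open>The underlying unoriented graph of the oriented graph \<^term>\<open>F\<close> is \<^term>\<open>F \<union> F\<inverse>\<close>.\<close>

definition all_trees_one_ended :: "('v \<times> 'v) set \<Rightarrow> bool" where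
  "all_trees_one_ended F \<longleftrightarrow> (\<forall>x. card (ends_of_component (F \<union> F\<inverse>) x) = 1)"

end

theory Submission
  imports Defs
begin

text \<open>
  On a finite vertex set with the rest of the graph as a sink, rotor walk restarted at its source
  whenever it hits the sink permutes the states (position, rotors) in which the rotors away from the
  position form a forest having the source in the tree of the position. Hence running a particle
  into the sink permutes the spanning forests, and the visits to \<^term>\<open>x\<close> during all these runs
  inject into the states at \<^term>\<open>x\<close>. All previously visited vertices lie in the tree of the
  position, so visits to \<^term>\<open>x\<close> after a far excursion correspond to states with a large tree at
  \<^term>\<open>x\<close>; by local surgery these are rare as soon as all pasts in the wired spanning forest are
  finite, which is what one-endedness gives. In the limit, the map sending a configuration to the
  one left after a full rotor walk preserves the wired spanning forest, and the walk visits
  \<^term>\<open>a\<close> at most \<open>1 / \<alpha>\<close> times on average, where \<open>\<alpha>\<close> is the escape probability.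

  Schramm's deterministic bound says that the escape rate never exceeds \<open>\<alpha>\<close>, so the average
  number of visits per escaping particle is asymptotically at least \<open>1 / \<alpha>\<close>. The maximal ergodic
  theorem turns these two facts into almost sure convergence.
\<close>

section \<open>Hitting probabilities and the Green function\<close>

text \<open>The full rotor walk, never stopped at \<open>a\<close>, is the concatenation of finitely
  many returning particles and one escaping particle. So one application of
  \<open>final_rotors\<close> uses up a block of \<open>visits\<close> particles with a single
  escape, and I(\<rho>,n)/n is governed by the averages of \<open>visits\<close> along orbits of a
  measure-preserving map. Ergodicity of this map is not established: orbit averages that are
  asymptotically at least \<open>green a a\<close> = 1/\<alpha> and a mean of at most the same
  number replace it.

  The obstacle is that the map preserves the measure. In each finite box this is exact, but late
  returns from near the boundary of the box could still turn the rotor at \<open>x\<close>, which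
  must be excluded uniformly in the box. The state at such a return need not be a forest. States
  whose tree at \<open>x\<close> contains a fixed vertex \<open>v\<close> of small Green value are
  few, by the count that also bounds the visits; the others become forests by changing rotors along
  a path from \<open>x\<close> to \<open>v\<close>, at a cost that depends on the path but not on
  the box.\<close>

definition nbr_avg :: "('v \<times> 'v) set \<Rightarrow> ('v \<Rightarrow> real) \<Rightarrow> 'v \<Rightarrow> real" where
  "nbr_avg E f v = (\<Sum>y\<in>E `` {v}. f y) / real (card (E `` {v}))"

text \<open>The probability that simple random walk from \<open>v\<close> visits \<open>x\<close>
  within \<open>n\<close> steps, by first-step recursion. Only \<open>walk_avoid_cylinder\<close>
  and \<open>escape_prob_eq\<close> link it to the trajectory measure; the rest is potential
  theory.\<close>

primrec hit :: "('v \<times> 'v) set \<Rightarrow> 'v \<Rightarrow> nat \<Rightarrow> 'v \<Rightarrow> real" where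
  "hit E x 0 = (\<lambda>v. if v = x then 1 else 0)"
| "hit E x (Suc n) = (\<lambda>v. if v = x then 1 else nbr_avg E (hit E x n) v)"

definition hit_prob :: "('v \<times> 'v) set \<Rightarrow> 'v \<Rightarrow> 'v \<Rightarrow> real" where
  "hit_prob E x v = lim (\<lambda>n. hit E x n v)"

text \<open>Time 0 does not count here, so this differs from \<open>hit\<close> only at
  \<open>x\<close>, where it is the probability of a return within \<open>n\<close> steps.\<close>

primrec return_within :: "('v \<times> 'v) set \<Rightarrow> 'v \<Rightarrow> nat \<Rightarrow> 'v \<Rightarrow> real" where
  "return_within E x 0 = (\<lambda>v. 0)"
| "return_within E x (Suc n) = nbr_avg E (hit E x n)"

lemma hit_self [simp]: "hit E x n x = 1"
  by (cases n) auto

lemma hit_neq: "v \<noteq> x \<Longrightarrow> hit E x n v = return_within E x n v"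
  by (cases n) auto

locale walk_graph =
  fixes E :: "('v \<times> 'v) set"
  assumes simple: "simple_graph E" and connected: "connected_graph E"
    and locally_finite: "locally_finite_graph E" and transient: "transient_graph E"
begin

lemma finite_nbrs [simp, intro]: "finite (E `` {x})"
  using locally_finite by (simp add: locally_finite_graph_def)

lemma sym_E: "(x, y) \<in> E \<Longrightarrow> (y, x) \<in> E"
  using simple by (auto simp: simple_graph_def sym_def)

lemma irrefl_E: "(x, x) \<notin> E"
  using simple by (auto simp: simple_graph_def irrefl_def)

lemma connect: "(x, y) \<in> E\<^sup>*"
  using connected by (auto simp: connected_graph_def)

lemma escape_pos: "escape_prob E x > 0"
  using transient by (auto simp: transient_graph_def)

text \<open>By connectedness an isolated vertex would be the only one, so no trajectory could avoid
  it, against transience.\<close>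

lemma nbrs_nonempty [simp]: "E `` {x} \<noteq> {}"
proof
  assume e: "E `` {x} = {}"
  have "y = x" for y
    using connect[of x y] e by (auto elim: converse_rtranclE)
  then have "\<not> (\<forall>t\<ge>1. X t \<noteq> x)" for X :: "nat \<Rightarrow> 'v"
    by blast
  then have "{X \<in> space (srw E x). \<forall>t\<ge>1. X t \<noteq> x} = {}"
    by simp
  then show False
    using escape_pos[of x] unfolding escape_prob_def by (simp only: measure_empty)
qed

lemma card_nbrs_pos [simp]: "card (E `` {x}) > 0"
  by (simp add: card_gt_0_iff)

lemma countable_vertices: "countable (UNIV :: 'v set)"
proof -
  obtain x :: 'v where True by simp
  have "countable ((E ^^ n) `` {x})" for n
  proof (induction n)
    case (Suc n)
    have "(E ^^ Suc n) `` {x} = (\<Union>y\<in>(E ^^ n) `` {x}. E `` {y})"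
      by auto
    also have "countable \<dots>"
      using Suc by (intro countable_UN) (auto intro: countable_finite)
    finally show ?case .
  qed simp
  then have "countable (\<Union>n. (E ^^ n) `` {x})"
    by auto
  also have "(\<Union>n. (E ^^ n) `` {x}) = UNIV"
    using connect[of x] by (auto simp: rtrancl_power)
  finally show ?thesis .
qed

section \<open>Finite-horizon hitting probabilities and their limit\<close>

lemma nbr_avg_mono: "(\<And>y. y \<in> E `` {v} \<Longrightarrow> f y \<le> g y) \<Longrightarrow> nbr_avg E f v \<le> nbr_avg E g v"
  unfolding nbr_avg_def by (intro divide_right_mono sum_mono) auto

lemma nbr_avg_affine: "nbr_avg E (\<lambda>y. c * f y + d) v = c * nbr_avg E f v + d"
  using card_nbrs_pos[of v]
  by (simp add: nbr_avg_def sum.distrib add_divide_distrib flip: sum_distrib_left)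

lemma nbr_avg_const: "nbr_avg E (\<lambda>y. d) v = d"
  using nbr_avg_affine[of 0 _ d] by simp

lemma hit_nonneg: "0 \<le> hit E x n v"
proof (induction n arbitrary: v)
  case (Suc n)
  then show ?case by (auto simp: nbr_avg_def sum_nonneg)
qed auto

lemma hit_le_1: "hit E x n v \<le> 1"
proof (induction n arbitrary: v)
  case (Suc n)
  have "nbr_avg E (hit E x n) v \<le> nbr_avg E (\<lambda>_. 1) v"
    by (rule nbr_avg_mono) (rule Suc)
  then show ?case by (simp add: nbr_avg_const)
qed auto

lemma hit_mono_Suc: "hit E x n v \<le> hit E x (Suc n) v"
proof (induction n arbitrary: v)
  case 0
  have "0 \<le> nbr_avg E (hit E x 0) v"
    unfolding nbr_avg_def using hit_nonneg[of x 0] by (intro divide_nonneg_nonneg sum_nonneg) auto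
  then show ?case by simp
next
  case (Suc n)
  have "nbr_avg E (hit E x n) v \<le> nbr_avg E (hit E x (Suc n)) v"
    by (rule nbr_avg_mono) (rule Suc)
  then show ?case by (cases "v = x") simp_all
qed

lemma hit_tendsto: "(\<lambda>n. hit E x n v) \<longlonglongrightarrow> hit_prob E x v"
proof -
  have "incseq (\<lambda>n. hit E x n v)"
    by (intro incseq_SucI hit_mono_Suc)
  then obtain L where "(\<lambda>n. hit E x n v) \<longlonglongrightarrow> L"
    by (rule incseq_convergent[of _ 1]) (auto intro: hit_le_1)
  then show ?thesis
    unfolding hit_prob_def by (simp add: limI)
qed

lemma hit_prob_self [simp]: "hit_prob E x x = 1"
  using hit_tendsto[of x x] by (simp add: LIMSEQ_const_iff)

lemma hit_le_hit_prob: "hit E x n v \<le> hit_prob E x v"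
  using hit_tendsto[of x v] hit_mono_Suc[of x _ v] by (meson incseq_SucI incseq_le)

lemma hit_prob_nonneg: "0 \<le> hit_prob E x v"
  using hit_le_hit_prob[of x 0 v] hit_nonneg[of x 0 v] by linarith

lemma nbr_avg_hit_tendsto: "(\<lambda>n. nbr_avg E (hit E x n) v) \<longlonglongrightarrow> nbr_avg E (hit_prob E x) v"
  unfolding nbr_avg_def by (intro tendsto_divide tendsto_sum hit_tendsto tendsto_const) auto

lemma hit_prob_harmonic: "v \<noteq> x \<Longrightarrow> nbr_avg E (hit_prob E x) v = hit_prob E x v"
  using nbr_avg_hit_tendsto[of x v] LIMSEQ_Suc[OF hit_tendsto[of x v]]
  by (auto intro: LIMSEQ_unique)

text \<open>Induction on the horizon bounds every \<open>hit E x n\<close> by \<open>u\<close>.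
  Applied to a rescaled copy of \<open>hit_prob\<close> itself, this shows that hitting
  probabilities are not bounded away from 0.\<close>

lemma hit_prob_minimal:
  assumes "1 \<le> u x" and "\<And>v. 0 \<le> u v" and "\<And>v. v \<noteq> x \<Longrightarrow> nbr_avg E u v \<le> u v"
  shows "hit_prob E x v \<le> u v"
proof -
  have "hit E x n v \<le> u v" for n
  proof (induction n arbitrary: v)
    case 0
    then show ?case using assms by auto
  next
    case (Suc n)
    then show ?case
      using assms(1) assms(3)[of v] nbr_avg_mono[of v "hit E x n" u] by (cases "v = x") auto
  qed
  then show ?thesis
    using hit_tendsto[of x v] by (intro LIMSEQ_le_const2[where x="hit_prob E x v"]) auto
qed

lemma hit_prob_pos: "0 < hit_prob E x v"
proof -
  have "(v, x) \<in> E\<^sup>*" by (rule connect)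
  then show ?thesis
  proof (induction rule: converse_rtrancl_induct)
    case (step v w)
    show ?case
    proof (cases "v = x")
      case False
      have "0 < (\<Sum>y\<in>E `` {v}. hit_prob E x y)"
        using step by (intro sum_pos2[of _ w]) (auto simp: hit_prob_nonneg)
      then have "0 < nbr_avg E (hit_prob E x) v"
        using card_nbrs_pos[of v] by (simp add: nbr_avg_def)
      then show ?thesis
        using hit_prob_harmonic[OF False] by simp
    qed simp
  qed simp
qed

text \<open>The Markov property in elementary form: condition on a finite history and split by the
  next position. The history is arbitrary because the induction on \<open>m\<close> appends a vertex
  to it.\<close>

lemma walk_avoid_cylinder:
  assumes "xs \<noteq> []"
  shows "measure (srw E a) {X. (\<forall>i<length xs. X i = xs ! i) \<and> (\<forall>t\<in>{length xs..<length xs + m}. X t \<noteq> x)}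
    = measure (srw E a) {X. \<forall>i<length xs. X i = xs ! i} * (1 - return_within E x m (last xs))"
  using assms
proof (induction m arbitrary: xs)
  case 0
  then show ?case by simp
next
  case (Suc m)
  interpret prob_space "srw E a" by (rule prob_space_srw)
  let ?P = "measure (srw E a)"
  define C where "C xs = {X. \<forall>i<length xs. X i = xs ! i}" for xs :: "'v list"
  define Q where "Q xs m = {X. (\<forall>i<length xs. X i = xs ! i) \<and> (\<forall>t\<in>{length xs..<length xs + m}. X t \<noteq> x)}"
    for xs and m :: nat
  define v where "v = last xs"
  define N where "N = E `` {v}"
  have [simp]: "finite N" "card N > 0" "N \<noteq> {}" by (simp_all add: N_def)
  have coord: "{X. X t = y} \<in> sets (srw E a)" "{X. X t \<noteq> y} \<in> sets (srw E a)" for t y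
  proof -
    have m: "(\<lambda>X. X t) \<in> measurable (srw E a) (count_space UNIV)"
      by (subst measurable_cong_sets[OF sets_srw refl]) measurable
    show "{X. X t = y} \<in> sets (srw E a)" "{X. X t \<noteq> y} \<in> sets (srw E a)"
      using measurable_sets[OF m, of "{y}"] measurable_sets[OF m, of "- {y}"]
      by (auto simp: space_srw vimage_def)
  qed
  have fin: "{X. \<forall>i\<in>I. P i X} \<in> sets (srw E a)"
    if "finite I" "\<And>i. i \<in> I \<Longrightarrow> {X. P i X} \<in> sets (srw E a)" for I :: "nat set" and P
  proof (cases "I = {}")
    case True
    then show ?thesis using sets.top[of "srw E a"] by (simp add: space_srw)
  next
    case False
    have "{X. \<forall>i\<in>I. P i X} = (\<Inter>i\<in>I. {X. P i X})" by auto
    then show ?thesis using that False by (auto intro!: sets.finite_INT)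
  qed
  have C: "C xs \<in> sets (srw E a)" for xs
    using fin[of "{..<length xs}" "\<lambda>i X. X i = xs ! i"] coord
    by (simp add: C_def Ball_def)
  have Q: "Q xs m \<in> sets (srw E a)" for xs m
  proof -
    have "Q xs m = C xs \<inter> {X. \<forall>t\<in>{length xs..<length xs + m}. X t \<noteq> x}" by (auto simp: Q_def C_def)
    also have "\<dots> \<in> sets (srw E a)"
      using C coord by (intro sets.Int fin) auto
    finally show ?thesis .
  qed
  have len: "length (xs @ [y]) = Suc (length xs)" for y :: 'v by simp
  have ext: "(\<forall>i<length (xs @ [y]). X i = (xs @ [y]) ! i) \<longleftrightarrow> (\<forall>i<length xs. X i = xs ! i) \<and> X (length xs) = y"
    for X :: "nat \<Rightarrow> 'v" and y
    by (auto simp: nth_append less_Suc_eq)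
  have cyl: "?P (C xs) = (\<Prod>i<length xs. pmf (srw_kernel E a i ((!) xs)) (xs ! i))" for xs
    unfolding C_def using srw_cylinder[where n="length xs" and x="(!) xs"] by simp
  have Cy: "?P (C (xs @ [y])) = ?P (C xs) * (if y \<in> N then 1 / card N else 0)" for y
  proof -
    obtain n where n: "length xs = Suc n" using Suc.prems by (cases xs) auto
    have "?P (C (xs @ [y])) = (\<Prod>i<length xs. pmf (srw_kernel E a i ((!) (xs @ [y]))) ((xs @ [y]) ! i))
        * pmf (srw_kernel E a (length xs) ((!) (xs @ [y]))) y"
      by (subst cyl) simp
    also have "(\<Prod>i<length xs. pmf (srw_kernel E a i ((!) (xs @ [y]))) ((xs @ [y]) ! i)) = ?P (C xs)"
      unfolding cyl by (intro prod.cong) (auto simp: nth_append srw_kernel_def split: nat.split)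
    also have "srw_kernel E a (length xs) ((!) (xs @ [y])) = pmf_of_set N"
      using Suc.prems n by (auto simp: srw_kernel_def nth_append last_conv_nth N_def v_def)
    also have "pmf (pmf_of_set N) y = (if y \<in> N then 1 / card N else 0)"
      by (subst pmf_of_set) (auto simp: indicator_def N_def)
    finally show ?thesis .
  qed
  \<comment> \<open>Trajectories that continue \<open>xs\<close> along a non-edge: a null set, since
    the cylinders of the neighbors already carry all the mass of \<open>C xs\<close>.\<close>
  define D where "D = C xs - (\<Union>y\<in>N. C (xs @ [y]))"
  have U: "(\<Union>y\<in>N. C (xs @ [y])) \<in> sets (srw E a)"
    by (intro sets.finite_UN C) simp
  have sub: "(\<Union>y\<in>N. C (xs @ [y])) \<subseteq> C xs"
    unfolding C_def ext by auto
  have disj: "disjoint_family_on (\<lambda>y. C (xs @ [y])) N"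
    unfolding disjoint_family_on_def C_def ext by auto
  have "?P (\<Union>y\<in>N. C (xs @ [y])) = (\<Sum>y\<in>N. ?P (C (xs @ [y])))"
    using C disj by (intro finite_measure_finite_Union) auto
  also have "\<dots> = ?P (C xs)"
    using \<open>card N > 0\<close> by (auto simp: Cy)
  finally have "?P D = 0"
    unfolding D_def using U C sub by (subst finite_measure_Diff) auto
  have Dsets: "D \<in> events" unfolding D_def using C U by auto
  have D0: "?P (Q xs (Suc m) \<inter> D) = 0"
    using \<open>?P D = 0\<close> Dsets Q finite_measure_mono[of "Q xs (Suc m) \<inter> D" D]
    by (simp add: measure_le_0_iff)
  define B where "B = {y \<in> N. y \<noteq> x}"
  have [simp]: "finite B" by (simp add: B_def)
  have split: "Q xs (Suc m) = (\<Union>y\<in>B. Q (xs @ [y]) m) \<union> (Q xs (Suc m) \<inter> D)"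
  proof -
    have iv: "{length xs..<length xs + Suc m} = insert (length xs) {Suc (length xs)..<Suc (length xs) + m}"
      by auto
    have eq: "(\<forall>t\<in>{length xs..<length xs + Suc m}. X t \<noteq> x) \<longleftrightarrow>
        X (length xs) \<noteq> x \<and> (\<forall>t\<in>{Suc (length xs)..<Suc (length xs) + m}. X t \<noteq> x)" for X :: "nat \<Rightarrow> 'v"
      unfolding iv by blast
    have Qy: "X \<in> Q (xs @ [y]) m \<longleftrightarrow> X \<in> C xs \<and> X (length xs) = y \<and> (\<forall>t\<in>{Suc (length xs)..<Suc (length xs) + m}. X t \<noteq> x)" for X y
      unfolding Q_def C_def mem_Collect_eq len ext[unfolded len] by (rule conj_assoc)
    have QS: "X \<in> Q xs (Suc m) \<longleftrightarrow> X \<in> C xs \<and> X (length xs) \<noteq> x \<and> (\<forall>t\<in>{Suc (length xs)..<Suc (length xs) + m}. X t \<noteq> x)" for X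
      unfolding Q_def C_def mem_Collect_eq eq by blast
    have CS: "X \<in> C (xs @ [y]) \<longleftrightarrow> X \<in> C xs \<and> X (length xs) = y" for X y
      unfolding C_def mem_Collect_eq ext by blast
    show ?thesis
      unfolding set_eq_iff Un_iff UN_iff Int_iff D_def Diff_iff Qy QS CS B_def by blast
  qed
  have disjQ: "disjoint_family_on (\<lambda>y. Q (xs @ [y]) m) B"
    unfolding disjoint_family_on_def Q_def ext by auto
  have "?P (Q xs (Suc m)) = ?P (\<Union>y\<in>B. Q (xs @ [y]) m) + ?P (Q xs (Suc m) \<inter> D)"
  proof (subst split, rule finite_measure_Union)
    show "(\<Union>y\<in>B. Q (xs @ [y]) m) \<in> events" by (intro sets.finite_UN Q) simp
    show "Q xs (Suc m) \<inter> D \<in> events" using Q Dsets by auto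
    show "(\<Union>y\<in>B. Q (xs @ [y]) m) \<inter> (Q xs (Suc m) \<inter> D) = {}"
      unfolding D_def C_def Q_def B_def ext by auto
  qed
  also have "?P (\<Union>y\<in>B. Q (xs @ [y]) m) = (\<Sum>y\<in>B. ?P (Q (xs @ [y]) m))"
    using Q disjQ by (intro finite_measure_finite_Union) auto
  also have "\<dots> = (\<Sum>y\<in>B. ?P (C xs) / card N * (1 - return_within E x m y))"
  proof (intro sum.cong refl)
    fix y assume "y \<in> B"
    then show "?P (Q (xs @ [y]) m) = ?P (C xs) / card N * (1 - return_within E x m y)"
      using Suc.IH[of "xs @ [y]"] Cy[of y] by (simp add: B_def C_def Q_def)
  qed
  \<comment> \<open>The term \<open>y = x\<close> may be added because \<open>hit\<close> is 1
    there; at the other neighbors \<open>hit\<close> and \<open>return_within\<close> agree.\<close>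
  also have "\<dots> = (\<Sum>y\<in>N. ?P (C xs) / card N * (1 - hit E x m y))"
    by (rule sum.mono_neutral_cong_left) (auto simp: hit_neq B_def)
  also have "\<dots> = ?P (C xs) * (1 - return_within E x (Suc m) v)"
  proof -
    have "(\<Sum>y\<in>N. 1 - hit E x m y) / card N = 1 - (\<Sum>y\<in>N. hit E x m y) / card N"
      using \<open>card N > 0\<close> by (simp add: sum_subtractf diff_divide_distrib)
    then show ?thesis
      unfolding return_within.simps nbr_avg_def N_def[symmetric]
      by (subst sum_distrib_left[symmetric]) (metis times_divide_eq_left times_divide_eq_right)
  qed
  finally show ?case using D0 by (simp add: C_def Q_def v_def)
qed

text \<open>Escape is the decreasing limit of the events of avoiding \<open>x\<close> at the times 1
  to m, whose probabilities are \<open>1 - return_within E x m x\<close>.\<close>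

lemma escape_prob_eq: "escape_prob E x = 1 - nbr_avg E (hit_prob E x) x"
proof -
  interpret prob_space "srw E x" by (rule prob_space_srw)
  let ?P = "measure (srw E x)"
  let ?Q = "\<lambda>m. {X. (\<forall>t\<in>{1..<1 + m}. X t \<noteq> x)}"
  let ?R = "\<lambda>m. {X. X 0 = x \<and> (\<forall>t\<in>{1..<1 + m}. X t \<noteq> x)}"
  have m: "(\<lambda>X. X t) \<in> measurable (srw E x) (count_space UNIV)" for t :: nat
    by (subst measurable_cong_sets[OF sets_srw refl]) measurable
  have neq: "{X. X t \<noteq> x} \<in> sets (srw E x)" and eq0: "{X. X t = x} \<in> sets (srw E x)" for t
    using measurable_sets[OF m, of "-{x}" t] measurable_sets[OF m, of "{x}" t]
    by (auto simp: space_srw vimage_def)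
  have Q: "?Q m \<in> sets (srw E x)" for m
  proof -
    have "?Q m = (\<Inter>t\<in>{1..<1+m}. {X. X t \<noteq> x})" by auto
    then show ?thesis
      using neq sets.top[of "srw E x"] by (cases "m = 0") (auto intro!: sets.finite_INT simp: space_srw)
  qed
  have P0: "?P {X. X 0 = x} = 1"
    using srw_cylinder[where n=1 and x="\<lambda>_. x" and a=x and E=E] by (simp add: srw_kernel_def)
  have PR: "?P (?R m) = 1 - return_within E x m x" for m
    using walk_avoid_cylinder[of "[x]" x m x] by (simp add: P0)
  have PQ: "?P (?Q m) = ?P (?R m)" for m
  proof -
    have ae: "AE X in srw E x. X 0 = x"
      using AE_prob_1[OF P0] by simp
    have "?R m = {X. X 0 = x} \<inter> ?Q m" by auto
    then have "?R m \<in> sets (srw E x)" using Q eq0 by auto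
    with Q ae show ?thesis
      by (intro finite_measure_eq_AE) auto
  qed
  have "(\<lambda>m. ?P (?Q m)) \<longlonglongrightarrow> ?P (\<Inter>m. ?Q m)"
    using Q by (intro finite_Lim_measure_decseq) (auto simp: decseq_def)
  moreover have "(\<Inter>m. ?Q m) = {X \<in> space (srw E x). \<forall>t\<ge>1. X t \<noteq> x}"
  proof (intro set_eqI iffI)
    fix X :: "nat \<Rightarrow> 'v" assume *: "X \<in> (\<Inter>m. ?Q m)"
    have "X t \<noteq> x" if "t \<ge> 1" for t
    proof -
      have "X \<in> ?Q t" using * by blast
      then show ?thesis using that by auto
    qed
    then show "X \<in> {X \<in> space (srw E x). \<forall>t\<ge>1. X t \<noteq> x}" by (simp add: space_srw)
  qed auto
  moreover have "(\<lambda>m. ?P (?Q (Suc m))) \<longlonglongrightarrow> 1 - nbr_avg E (hit_prob E x) x"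
    unfolding PQ PR return_within.simps by (intro tendsto_diff tendsto_const nbr_avg_hit_tendsto)
  ultimately show ?thesis
    unfolding escape_prob_def using LIMSEQ_unique[OF LIMSEQ_Suc] by simp
qed

text \<open>If the hitting probability h were at least some \<delta> < 1 everywhere, then (h -
  \<delta>)/(1 - \<delta>) would be an admissible competitor in \<open>hit_prob_minimal\<close>.
  This forces h to be at least 1 everywhere, and the escape probability would vanish.\<close>

lemma hit_prob_arbitrarily_small:
  assumes "\<epsilon> > 0"
  shows "\<exists>v. hit_prob E x v < \<epsilon>"
proof (rule ccontr)
  assume "\<not> (\<exists>v. hit_prob E x v < \<epsilon>)"
  then have ge: "hit_prob E x v \<ge> min \<epsilon> (1/2)" for v by (auto simp: not_less min_le_iff_disj)
  define \<delta> where "\<delta> = min \<epsilon> (1/2)"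
  have \<delta>: "0 < \<delta>" "\<delta> < 1" using assms by (auto simp: \<delta>_def)
  define u where "u v = (hit_prob E x v - \<delta>) / (1 - \<delta>)" for v
  have u: "u = (\<lambda>v. 1 / (1 - \<delta>) * hit_prob E x v + - \<delta> / (1 - \<delta>))"
    by (auto simp: u_def fun_eq_iff diff_divide_distrib)
  have "hit_prob E x v \<le> u v" for v
  proof (rule hit_prob_minimal)
    show "1 \<le> u x" using \<delta> by (simp add: u_def)
    show "0 \<le> u v" for v using ge[of v] \<delta> by (simp add: u_def \<delta>_def)
    show "nbr_avg E u v \<le> u v" if "v \<noteq> x" for v
      unfolding u nbr_avg_affine using hit_prob_harmonic[OF that] by simp
  qed
  then have "1 \<le> hit_prob E x v" for v
    using \<delta> by (auto simp: u_def field_simps)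
  then have "1 \<le> nbr_avg E (hit_prob E x) x"
    using nbr_avg_mono[of x "\<lambda>_. 1" "hit_prob E x"] by (simp add: nbr_avg_const)
  then show False using escape_pos[of x] by (simp add: escape_prob_eq)
qed

lemma infinite_vertices: "infinite (UNIV :: 'v set)"
proof
  assume fin: "finite (UNIV :: 'v set)"
  obtain x :: 'v where True by simp
  define \<epsilon> where "\<epsilon> = Min (range (hit_prob E x))"
  have "\<epsilon> \<in> range (hit_prob E x)" unfolding \<epsilon>_def using fin by (intro Min_in) auto
  then have "\<epsilon> > 0" using hit_prob_pos by auto
  then obtain v where "hit_prob E x v < \<epsilon>" using hit_prob_arbitrarily_small by blast
  moreover have "\<epsilon> \<le> hit_prob E x v" unfolding \<epsilon>_def using fin by (intro Min_le) auto
  ultimately show False by simp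
qed

text \<open>The expected number of visits to \<open>x\<close> by simple random walk from
  \<open>v\<close>: once \<open>x\<close> is hit, the visits are geometric with success probability
  \<open>escape_prob E x\<close>.\<close>

definition green :: "'v \<Rightarrow> 'v \<Rightarrow> real" where
  "green x v = hit_prob E x v / escape_prob E x"

lemma green_nonneg: "0 \<le> green x v"
  using hit_prob_nonneg escape_pos[of x] by (simp add: green_def)

lemma green_self: "green x x = 1 / escape_prob E x"
  by (simp add: green_def)

text \<open>Harmonicity with a unit defect at the pole. Summed over all states, this defect becomes
  the number of states with the walker at \<open>x\<close>.\<close>

lemma nbr_avg_green: "nbr_avg E (green x) u = green x u - of_bool (u = x)"
proof -
  have "nbr_avg E (green x) u = nbr_avg E (hit_prob E x) u / escape_prob E x"
    using nbr_avg_affine[of "1 / escape_prob E x" "hit_prob E x" 0] by (simp add: green_def[abs_def])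
  moreover have "nbr_avg E (hit_prob E x) u = hit_prob E x u - of_bool (u = x) * escape_prob E x"
    using hit_prob_harmonic[of u x] escape_prob_eq[of x] by (cases "u = x") auto
  ultimately show ?thesis
    using escape_pos[of x] by (simp add: green_def diff_divide_distrib)
qed

lemma green_arbitrarily_small: "\<epsilon> > 0 \<Longrightarrow> \<exists>v. green x v < \<epsilon>"
  using hit_prob_arbitrarily_small[of "\<epsilon> * escape_prob E x" x] escape_pos[of x]
  by (auto simp: green_def field_simps)

end


section \<open>Rotor walk on a finite set of vertices\<close>

lemma walker_at_0 [simp]: "walker_at \<tau> a \<rho> 0 = a"
  by (simp add: walker_at_def)

lemma rotors_at_0 [simp]: "rotors_at \<tau> a \<rho> 0 = \<rho>"
  by (simp add: rotors_at_def)

lemma walker_at_Suc: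
  "walker_at \<tau> a \<rho> (Suc t) = \<tau> (walker_at \<tau> a \<rho> t) (rotors_at \<tau> a \<rho> t (walker_at \<tau> a \<rho> t))"
  by (simp add: walker_at_def rotors_at_def rotor_step_def split: prod.split)

lemma rotors_at_Suc:
  "rotors_at \<tau> a \<rho> (Suc t) = (rotors_at \<tau> a \<rho> t)(walker_at \<tau> a \<rho> t := walker_at \<tau> a \<rho> (Suc t))"
  by (simp add: walker_at_def rotors_at_def rotor_step_def split: prod.split)

lemma rotor_at_walker: "rotors_at \<tau> a \<rho> (Suc t) (walker_at \<tau> a \<rho> t) = walker_at \<tau> a \<rho> (Suc t)"
  by (simp add: rotors_at_Suc)

lemma rotor_step_at:
  "rotor_step \<tau> (walker_at \<tau> a \<rho> t, rotors_at \<tau> a \<rho> t) = (walker_at \<tau> a \<rho> (Suc t), rotors_at \<tau> a \<rho> (Suc t))"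
  by (simp add: walker_at_def rotors_at_def)

lemma rotors_at_unvisited:
  assumes "s \<le> t" and "\<And>r. s \<le> r \<Longrightarrow> r < t \<Longrightarrow> walker_at \<tau> a \<rho> r \<noteq> x"
  shows "rotors_at \<tau> a \<rho> t x = rotors_at \<tau> a \<rho> s x"
  using assms
proof (induction t rule: dec_induct)
  case (step n)
  have ne: "walker_at \<tau> a \<rho> n \<noteq> x" using step by simp
  have "rotors_at \<tau> a \<rho> n x = rotors_at \<tau> a \<rho> s x" using step by simp
  with ne show ?case by (simp add: rotors_at_Suc)
qed simp

definition leads :: "('v \<Rightarrow> 'v) \<Rightarrow> 'v \<Rightarrow> 'v \<Rightarrow> bool" where
  "leads \<sigma> u x \<longleftrightarrow> (\<exists>n. (\<sigma> ^^ n) u = x)"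

lemma leads_refl: "leads \<sigma> x x"
  unfolding leads_def by (intro exI[of _ 0]) simp

lemma leads_step: "leads \<sigma> u x \<Longrightarrow> leads \<sigma> u (\<sigma> x)"
  unfolding leads_def by (metis funpow.simps(2) comp_apply)

lemma funpow_agree:
  assumes "\<And>i. i < n \<Longrightarrow> \<sigma>' ((\<sigma> ^^ i) u) = \<sigma> ((\<sigma> ^^ i) u)" and "i \<le> n"
  shows "(\<sigma>' ^^ i) u = (\<sigma> ^^ i) u"
  using assms(2) by (induction i) (use assms(1) in auto)

text \<open>Until an orbit enters \<open>S\<close>, it reads only values outside \<open>S\<close>.
  All later changes of rotors are controlled through this remark.\<close>

lemma first_hit_agree:
  assumes "\<exists>n. (\<sigma> ^^ n) u \<in> S" and "\<And>z. z \<notin> S \<Longrightarrow> \<sigma>' z = \<sigma> z"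
  shows "\<exists>n. (\<sigma>' ^^ n) u \<in> S \<and> (\<sigma>' ^^ n) u = (\<sigma> ^^ n) u"
proof -
  define n where "n = (LEAST n. (\<sigma> ^^ n) u \<in> S)"
  have n: "(\<sigma> ^^ n) u \<in> S" "\<And>i. i < n \<Longrightarrow> (\<sigma> ^^ i) u \<notin> S"
    using LeastI_ex[OF assms(1)] not_less_Least[of _ "\<lambda>n. (\<sigma> ^^ n) u \<in> S"] by (auto simp: n_def)
  have "(\<sigma>' ^^ n) u = (\<sigma> ^^ n) u"
    by (rule funpow_agree[where n=n]) (use n assms(2) in auto)
  with n(1) show ?thesis by (intro exI[of _ n]) simp
qed

lemma leads_fun_upd: "leads (\<sigma>(x := y)) u x \<longleftrightarrow> leads \<sigma> u x"
proof
  show "leads (\<sigma>(x := y)) u x" if "leads \<sigma> u x"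
    using first_hit_agree[of \<sigma> u "{x}" "\<sigma>(x := y)"] that by (auto simp: leads_def)
  show "leads \<sigma> u x" if "leads (\<sigma>(x := y)) u x"
    using first_hit_agree[of "\<sigma>(x := y)" u "{x}" \<sigma>] that by (auto simp: leads_def)
qed

text \<open>The rotor at a vertex left behind points along the last exit from it, so following
  rotors leads forward to the walker. In the induction, resetting the rotor at the current position
  does not affect which vertices lead there, and the new rotor points to the next position.\<close>

lemma visited_leads:
  "s \<le> t \<Longrightarrow> leads (rotors_at \<tau> a \<rho> t) (walker_at \<tau> a \<rho> s) (walker_at \<tau> a \<rho> t)"
proof (induction t)
  case (Suc t)
  show ?case
  proof (cases "s = Suc t")
    case False
    then have "leads (rotors_at \<tau> a \<rho> (Suc t)) (walker_at \<tau> a \<rho> s) (walker_at \<tau> a \<rho> t)"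
      using Suc by (simp add: rotors_at_Suc leads_fun_upd)
    from leads_step[OF this] show ?thesis by (simp add: rotor_at_walker)
  qed (simp add: leads_refl)
qed (simp add: leads_refl)

locale rotor_graph = walk_graph E for E :: "('v \<times> 'v) set" +
  fixes \<tau> :: "'v \<Rightarrow> 'v \<Rightarrow> 'v"
  assumes mechanism: "local_mechanism E \<tau>"
begin

section \<open>Legal rotors and vertices visited infinitely often\<close>

lemma tau_nbr: "y \<in> E `` {x} \<Longrightarrow> \<tau> x y \<in> E `` {x}"
  using mechanism unfolding local_mechanism_def bij_betw_def by blast

lemma tau_bij: "bij_betw (\<tau> x) (E `` {x}) (E `` {x})"
  using mechanism unfolding local_mechanism_def by blast

lemma tau_inj: "y \<in> E `` {x} \<Longrightarrow> z \<in> E `` {x} \<Longrightarrow> \<tau> x y = \<tau> x z \<Longrightarrow> y = z"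
  using tau_bij[of x] unfolding bij_betw_def inj_on_def by blast

lemma tau_orbit:
  assumes "y \<in> E `` {x}" and "z \<in> E `` {x}"
  shows "\<exists>i. (\<tau> x ^^ i) y = z"
proof -
  have "z \<in> range (\<lambda>i. (\<tau> x ^^ i) y)"
    using mechanism assms unfolding local_mechanism_def by blast
  then show ?thesis by auto
qed

lemma rotors_at_nbr: "\<rho> x \<in> E `` {x} \<Longrightarrow> rotors_at \<tau> a \<rho> t x \<in> E `` {x}"
proof (induction t)
  case (Suc t)
  then have *: "rotors_at \<tau> a \<rho> t x \<in> E `` {x}" by blast
  show ?case
  proof (cases "walker_at \<tau> a \<rho> t = x")
    case True
    then show ?thesis using tau_nbr[OF *] by (simp add: rotors_at_Suc walker_at_Suc)
  next
    case False
    then show ?thesis using * by (simp add: rotors_at_Suc)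
  qed
qed simp

lemma walker_at_nbr:
  "\<rho> (walker_at \<tau> a \<rho> t) \<in> E `` {walker_at \<tau> a \<rho> t} \<Longrightarrow> walker_at \<tau> a \<rho> (Suc t) \<in> E `` {walker_at \<tau> a \<rho> t}"
  unfolding walker_at_Suc by (intro tau_nbr rotors_at_nbr)

text \<open>The rotor at \<open>x\<close> rests between visits and advances by one at each of them;
  as \<open>\<tau> x\<close> has a single orbit, every neighbor is served again and again.\<close>

lemma infinitely_often_nbr:
  assumes io: "\<exists>\<^sub>\<infinity>t. walker_at \<tau> a \<rho> t = x" and \<rho>: "\<rho> x \<in> E `` {x}" and y: "y \<in> E `` {x}"
  shows "\<exists>\<^sub>\<infinity>t. walker_at \<tau> a \<rho> t = y"
  unfolding INFM_nat_le
proof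
  fix t0
  let ?r = "rotors_at \<tau> a \<rho> t0 x"
  have next_visit: "\<exists>t'\<ge>t. walker_at \<tau> a \<rho> (Suc t') = \<tau> x (rotors_at \<tau> a \<rho> t x) \<and>
      rotors_at \<tau> a \<rho> (Suc t') x = \<tau> x (rotors_at \<tau> a \<rho> t x)" for t
  proof -
    define t' where "t' = (LEAST t'. t' \<ge> t \<and> walker_at \<tau> a \<rho> t' = x)"
    have ex: "\<exists>t'. t' \<ge> t \<and> walker_at \<tau> a \<rho> t' = x" using io by (auto simp: INFM_nat_le)
    have t': "t' \<ge> t" "walker_at \<tau> a \<rho> t' = x"
      using LeastI_ex[OF ex] by (auto simp: t'_def)
    have "rotors_at \<tau> a \<rho> t' x = rotors_at \<tau> a \<rho> t x"
      using t' not_less_Least[of _ "\<lambda>t'. t' \<ge> t \<and> walker_at \<tau> a \<rho> t' = x"]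
      by (intro rotors_at_unvisited) (auto simp: t'_def)
    then show ?thesis using t' by (auto simp: walker_at_Suc rotors_at_Suc intro!: exI[of _ t'])
  qed
  have "\<exists>t\<ge>t0. walker_at \<tau> a \<rho> t = (\<tau> x ^^ Suc i) ?r \<and> rotors_at \<tau> a \<rho> t x = (\<tau> x ^^ Suc i) ?r" for i
  proof (induction i)
    case 0
    then show ?case using next_visit[of t0] by (auto intro: le_SucI)
  next
    case (Suc i)
    then obtain t where "t \<ge> t0" "rotors_at \<tau> a \<rho> t x = (\<tau> x ^^ Suc i) ?r" by blast
    moreover from next_visit[of t] obtain t' where "t' \<ge> t"
      "walker_at \<tau> a \<rho> (Suc t') = \<tau> x (rotors_at \<tau> a \<rho> t x)"
      "rotors_at \<tau> a \<rho> (Suc t') x = \<tau> x (rotors_at \<tau> a \<rho> t x)" by blast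
    ultimately show ?case by (intro exI[of _ "Suc t'"]) auto
  qed
  moreover obtain i where "(\<tau> x ^^ i) (\<tau> x ?r) = y"
    using tau_orbit[OF tau_nbr[OF rotors_at_nbr[of \<rho> x a t0, OF \<rho>]] y] by blast
  ultimately show "\<exists>t\<ge>t0. walker_at \<tau> a \<rho> t = y"
    by (metis funpow_Suc_right comp_apply)
qed

text \<open>A walk confined to \<open>A\<close> would visit some vertex infinitely often, hence by
  connectedness every vertex, whereas the graph is infinite.\<close>

lemma leaves_finite_set:
  assumes "finite A" and \<rho>: "\<And>x. x \<in> A \<Longrightarrow> \<rho> x \<in> E `` {x}"
  shows "\<exists>t. walker_at \<tau> a \<rho> t \<notin> A"
proof (rule ccontr)
  assume "\<not> ?thesis"
  then have in_A: "walker_at \<tau> a \<rho> t \<in> A" for t by auto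
  have "\<exists>z\<in>A. \<exists>\<^sub>\<infinity>t. walker_at \<tau> a \<rho> t = z"
  proof (rule ccontr)
    assume "\<not> (\<exists>z\<in>A. \<exists>\<^sub>\<infinity>t. walker_at \<tau> a \<rho> t = z)"
    then have "finite (\<Union>z\<in>A. {t. walker_at \<tau> a \<rho> t = z})"
      using \<open>finite A\<close> by (auto simp: INFM_iff_infinite)
    moreover have "(\<Union>z\<in>A. {t. walker_at \<tau> a \<rho> t = z}) = UNIV" using in_A by auto
    ultimately show False by simp
  qed
  then obtain z where z: "\<exists>\<^sub>\<infinity>t. walker_at \<tau> a \<rho> t = z" by blast
  have visited_in_A: "y \<in> A" if "\<exists>\<^sub>\<infinity>t. walker_at \<tau> a \<rho> t = y" for y
    using INFM_EX[OF that] in_A by blast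
  have "\<exists>\<^sub>\<infinity>t. walker_at \<tau> a \<rho> t = w" for w
    using connect[of z w]
  proof (induction rule: rtrancl_induct)
    case (step y w)
    then have "y \<in> A" by (intro visited_in_A)
    then show ?case using step by (intro infinitely_often_nbr[OF step(3) \<rho>]) auto
  qed (rule z)
  then have "A = UNIV" using visited_in_A by blast
  then show False using infinite_vertices \<open>finite A\<close> by simp
qed

text \<open>The sink vertices point to themselves. This makes them absorbing under iteration and
  makes a configuration determined by its values on \<open>A\<close>, so that counting is
  possible.\<close>

definition cfgs :: "'v set \<Rightarrow> ('v \<Rightarrow> 'v) set" where
  "cfgs A = {\<sigma>. (\<forall>z. z \<notin> A \<longrightarrow> \<sigma> z = z) \<and> (\<forall>x\<in>A. \<sigma> x \<in> E `` {x})}"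

text \<open>On a finite box, absorption of every orbit by the sink is the same as absence of cycles;
  in this form it is easy to check after rerouting orbits.\<close>

definition forests :: "'v set \<Rightarrow> ('v \<Rightarrow> 'v) set" where
  "forests A = {\<sigma>\<in>cfgs A. \<forall>u. \<exists>n. (\<sigma> ^^ n) u \<notin> A}"

text \<open>A forest in which \<open>x\<close> is an additional root, together with an arbitrary
  rotor at that root.\<close>

definition rooted :: "'v set \<Rightarrow> 'v \<Rightarrow> ('v \<Rightarrow> 'v) set" where
  "rooted A x = {\<sigma>\<in>cfgs A. \<forall>u. \<exists>n. (\<sigma> ^^ n) u \<in> insert x (- A)}"

text \<open>That the source leads to the walker is what makes the restarted step reversible: it
  singles out where the walker came from.\<close>

definition states :: "'v set \<Rightarrow> 'v \<Rightarrow> ('v \<times> ('v \<Rightarrow> 'v)) set" where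
  "states A v = (SIGMA x:A. {\<sigma>\<in>rooted A x. leads \<sigma> v x})"

definition restart_step :: "'v set \<Rightarrow> 'v \<Rightarrow> 'v \<times> ('v \<Rightarrow> 'v) \<Rightarrow> 'v \<times> ('v \<Rightarrow> 'v)" where
  "restart_step A v s = (let s' = rotor_step \<tau> s in if fst s' \<in> A then s' else (v, snd s'))"

section \<open>States on a finite box and the restarted walk\<close>

lemma finite_cfgs:
  assumes "finite A"
  shows "finite (cfgs A)"
proof (rule finite_subset)
  show "cfgs A \<subseteq> (\<lambda>f x. if x \<in> A then f x else x) ` (PiE A (\<lambda>x. E `` {x}))"
  proof
    fix \<sigma> assume "\<sigma> \<in> cfgs A"
    then show "\<sigma> \<in> (\<lambda>f x. if x \<in> A then f x else x) ` (PiE A (\<lambda>x. E `` {x}))"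
      by (intro image_eqI[of _ _ "restrict \<sigma> A"]) (auto simp: cfgs_def fun_eq_iff)
  qed
  show "finite ((\<lambda>f x. if x \<in> A then f x else x) ` (PiE A (\<lambda>x. E `` {x})))"
    using assms by (intro finite_imageI finite_PiE) auto
qed

lemma finite_forests: "finite A \<Longrightarrow> finite (forests A)"
  by (rule finite_subset[OF _ finite_cfgs]) (auto simp: forests_def)

lemma finite_rooted: "finite A \<Longrightarrow> finite (rooted A x)"
  by (rule finite_subset[OF _ finite_cfgs]) (auto simp: rooted_def)

lemma finite_states: "finite A \<Longrightarrow> finite (states A v)"
  unfolding states_def by (intro finite_SigmaI) (auto simp: finite_rooted)

lemma forests_nbr: "\<sigma> \<in> forests A \<Longrightarrow> x \<in> A \<Longrightarrow> \<sigma> x \<in> E `` {x}"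
  by (auto simp: forests_def cfgs_def)

lemma cfgs_upd: "\<sigma> \<in> cfgs A \<Longrightarrow> x \<in> A \<Longrightarrow> y \<in> E `` {x} \<Longrightarrow> \<sigma>(x := y) \<in> cfgs A"
  by (auto simp: cfgs_def)

lemma cfgs_absorb: "\<sigma> \<in> cfgs A \<Longrightarrow> z \<notin> A \<Longrightarrow> (\<sigma> ^^ n) z = z"
  by (induction n) (auto simp: cfgs_def)

lemma forests_rooted: "\<sigma> \<in> forests A \<Longrightarrow> \<sigma> \<in> rooted A x"
  by (auto simp: forests_def rooted_def)

lemma rooted_upd:
  assumes "\<sigma> \<in> rooted A x" and "x \<in> A" and "y \<in> E `` {x}"
  shows "\<sigma>(x := y) \<in> rooted A x"
  unfolding rooted_def
proof (intro CollectI conjI allI)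
  show "\<sigma>(x := y) \<in> cfgs A" using assms by (intro cfgs_upd) (auto simp: rooted_def)
  fix u
  have "\<exists>n. (\<sigma> ^^ n) u \<in> insert x (- A)" using assms by (auto simp: rooted_def)
  from first_hit_agree[OF this, of "\<sigma>(x := y)"]
  show "\<exists>n. (\<sigma>(x := y) ^^ n) u \<in> insert x (- A)" by auto
qed

lemma rooted_move:
  assumes "\<sigma> \<in> rooted A x"
  shows "\<exists>n. (\<sigma> ^^ n) u \<in> insert (\<sigma> x) (- A)"
proof -
  obtain n where "(\<sigma> ^^ n) u \<in> insert x (- A)" using assms by (auto simp: rooted_def)
  then show ?thesis
    by (cases "(\<sigma> ^^ n) u = x") (auto intro: exI[of _ "Suc n"] exI[of _ n])
qed

text \<open>Once the rotor at \<open>x\<close> is turned to \<open>y\<close>, every orbit that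
  reached \<open>x\<close> continues to \<open>y\<close>: the root moves along with the walker, and
  disappears when \<open>y\<close> is in the sink.\<close>

lemma states_step:
  assumes "(x, \<sigma>) \<in> states A v"
  defines "y \<equiv> \<tau> x (\<sigma> x)"
  defines "\<sigma>' \<equiv> \<sigma>(x := y)"
  shows "x \<in> A" "y \<in> E `` {x}" "\<sigma>' \<in> rooted A x" "leads \<sigma>' v x"
    "y \<in> A \<Longrightarrow> (y, \<sigma>') \<in> states A v" "y \<notin> A \<Longrightarrow> \<sigma>' \<in> forests A"
proof -
  have x: "x \<in> A" "\<sigma> \<in> rooted A x" "leads \<sigma> v x" using assms by (auto simp: states_def)
  then show "x \<in> A" by simp
  show y: "y \<in> E `` {x}" unfolding y_def using x by (intro tau_nbr) (auto simp: rooted_def cfgs_def)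
  show r: "\<sigma>' \<in> rooted A x" unfolding \<sigma>'_def using x y by (intro rooted_upd)
  show l: "leads \<sigma>' v x" unfolding \<sigma>'_def using x by (simp add: leads_fun_upd)
  have [simp]: "\<sigma>' x = y" by (simp add: \<sigma>'_def)
  show "(y, \<sigma>') \<in> states A v" if "y \<in> A"
    using that r rooted_move[OF r] leads_step[OF l] by (auto simp: states_def rooted_def)
  show "\<sigma>' \<in> forests A" if "y \<notin> A"
  proof -
    have "insert (\<sigma>' x) (- A) = - A" using that by auto
    then show ?thesis using r rooted_move[OF r] by (simp add: forests_def rooted_def)
  qed
qed

lemma restart_step_in_states:
  assumes "v \<in> A" and "s \<in> states A v"
  shows "restart_step A v s \<in> states A v"
proof -
  obtain x \<sigma> where s: "s = (x, \<sigma>)" by (cases s)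
  show ?thesis
    using states_step(5,6)[of x \<sigma> A v] assms forests_rooted leads_refl
    by (auto simp: s restart_step_def rotor_step_def Let_def states_def)
qed

text \<open>After \<open>k * n\<close> steps a cycle is back at \<open>z\<close>, but by step
  \<open>n\<close> the orbit has been absorbed.\<close>

lemma forests_no_cycle:
  assumes "\<sigma> \<in> forests A" and "z \<in> A" and "(\<sigma> ^^ k) z = z" and "k > 0"
  shows False
proof -
  obtain n where n: "(\<sigma> ^^ n) z \<notin> A" using assms by (auto simp: forests_def)
  have "((\<sigma> ^^ k) ^^ n) z = z" using assms(3) by (induction n) auto
  then have "(\<sigma> ^^ (k * n)) z = z" by (simp add: funpow_mult)
  moreover have "(\<sigma> ^^ (k * n)) z = (\<sigma> ^^ (k * n - n)) ((\<sigma> ^^ n) z)"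
    using \<open>k > 0\<close> by (metis comp_apply funpow_add le_add_diff_inverse2 mult_le_mono1 Suc_leI One_nat_def nat_mult_1)
  moreover have "\<dots> = (\<sigma> ^^ n) z"
    using n assms by (intro cfgs_absorb[of _ A]) (auto simp: forests_def)
  ultimately show False using n assms by simp
qed

text \<open>If \<open>x1\<close> leads to \<open>x2\<close> and both point to \<open>y\<close>, then
  \<open>y\<close> is periodic. Its orbit cannot be absorbed, so it passes through the root
  \<open>x1\<close>, which then has the same period \<open>k\<close>, and \<open>x2\<close> is
  \<open>x1\<close>. If instead \<open>x1\<close> points into the sink, it leads to no other vertex
  of \<open>A\<close>.\<close>

lemma unique_predecessor_aux:
  assumes \<sigma>: "\<sigma> \<in> rooted A x1" and x: "x1 \<in> A" "x2 \<in> A"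
    and eq: "\<sigma> x1 = \<sigma> x2 \<or> \<sigma> x1 \<notin> A"
    and k: "(\<sigma> ^^ k) x1 = x2"
  shows "x1 = x2"
proof (cases k)
  case 0
  then show ?thesis using k by simp
next
  case (Suc m)
  have cf: "\<sigma> \<in> cfgs A" using \<sigma> by (simp add: rooted_def)
  have inA: "\<sigma> x1 \<in> A"
  proof (rule ccontr)
    assume "\<sigma> x1 \<notin> A"
    then have "(\<sigma> ^^ k) x1 = \<sigma> x1" using cfgs_absorb[OF cf, of "\<sigma> x1" m] Suc by (simp add: funpow_swap1)
    then show False using k x(2) \<open>\<sigma> x1 \<notin> A\<close> by simp
  qed
  define y where "y = \<sigma> x1"
  have "\<sigma> x2 = y" using eq inA by (simp add: y_def)
  then have per: "(\<sigma> ^^ k) y = y" using k by (metis y_def funpow_swap1)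
  obtain n where n: "(\<sigma> ^^ n) y \<in> insert x1 (- A)" using \<sigma> by (auto simp: rooted_def)
  have pern: "((\<sigma> ^^ k) ^^ n) y = y" for n using per by (induction n) auto
  have "(\<sigma> ^^ n) y = x1"
  proof (rule ccontr)
    assume "(\<sigma> ^^ n) y \<noteq> x1"
    then have out: "(\<sigma> ^^ n) y \<notin> A" using n by auto
    have "y = (\<sigma> ^^ (k * n)) y" using pern[of n] by (simp add: funpow_mult)
    also have "\<dots> = (\<sigma> ^^ (k * n - n)) ((\<sigma> ^^ n) y)"
      using Suc by (metis add_diff_cancel_left' comp_apply funpow_add mult_Suc add.commute)
    also have "\<dots> = (\<sigma> ^^ n) y" by (rule cfgs_absorb[OF cf out])
    finally show False using out inA by (simp add: y_def)
  qed
  then have "(\<sigma> ^^ k) x1 = x1" using per by (metis funpow_add comp_apply add.commute)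
  then show ?thesis using k by simp
qed

text \<open>Both vertices lie on the orbit of the source \<open>v\<close>, so one of them leads to
  the other.\<close>

lemma unique_predecessor:
  assumes "\<sigma> \<in> rooted A x1" "\<sigma> \<in> rooted A x2" and "x1 \<in> A" "x2 \<in> A"
    and "\<sigma> x1 = \<sigma> x2 \<or> (\<sigma> x1 \<notin> A \<and> \<sigma> x2 \<notin> A)"
    and "leads \<sigma> v x1" "leads \<sigma> v x2"
  shows "x1 = x2"
proof -
  obtain i j where ij: "(\<sigma> ^^ i) v = x1" "(\<sigma> ^^ j) v = x2" using assms by (auto simp: leads_def)
  show ?thesis
  proof (cases "i \<le> j")
    case True
    then have "(\<sigma> ^^ (j - i)) x1 = x2" using ij by (metis comp_apply funpow_add le_add_diff_inverse2)
    then show ?thesis using assms by (intro unique_predecessor_aux[of \<sigma> A x1 x2]) auto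
  next
    case False
    then have "(\<sigma> ^^ (i - j)) x2 = x1" using ij by (metis comp_apply funpow_add le_add_diff_inverse2 nat_le_linear)
    then show ?thesis using assms by (intro unique_predecessor_aux[of \<sigma> A x2 x1, symmetric]) auto
  qed
qed

text \<open>To reverse a step, the previous position is recovered as the only vertex on the orbit of
  \<open>v\<close> that points to the new position, or into the sink after a restart. The previous
  rotor there follows since the local mechanism is injective.\<close>

lemma inj_restart_step: "inj_on (restart_step A v) (states A v)"
proof (rule inj_onI)
  fix s1 s2 assume s: "s1 \<in> states A v" "s2 \<in> states A v" and eq: "restart_step A v s1 = restart_step A v s2"
  obtain x1 \<sigma>1 x2 \<sigma>2 where s12: "s1 = (x1, \<sigma>1)" "s2 = (x2, \<sigma>2)" by (cases s1, cases s2)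
  define y1 y2 where "y1 = \<tau> x1 (\<sigma>1 x1)" "y2 = \<tau> x2 (\<sigma>2 x2)"
  define r1 r2 where "r1 = \<sigma>1(x1 := y1)" "r2 = \<sigma>2(x2 := y2)"
  note d = y1_y2_def r1_r2_def
  note st1 = states_step[OF s(1)[unfolded s12], folded y1_y2_def, folded r1_r2_def]
  note st2 = states_step[OF s(2)[unfolded s12], folded y1_y2_def, folded r1_r2_def]
  have e1: "restart_step A v s1 = (if y1 \<in> A then (y1, r1) else (v, r1))"
    and e2: "restart_step A v s2 = (if y2 \<in> A then (y2, r2) else (v, r2))"
    by (auto simp: s12 restart_step_def rotor_step_def d)
  have rr: "r1 = r2" using eq by (simp add: e1 e2 split: if_splits)
  have r1x: "r1 x1 = y1" "r2 x2 = y2" by (auto simp: r1_r2_def)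
  \<comment> \<open>A restart cannot be confused with an ordinary arrival at \<open>v\<close>: the
    former leaves a forest, while the latter closes a cycle through \<open>v\<close>.\<close>
  have no_mixed: False if m: "y \<in> A" "y = v" "r \<in> forests A" "r x = y" "leads r v x" for x y r
  proof -
    obtain n where "(r ^^ n) v = x" using m(5) by (auto simp: leads_def)
    then have "(r ^^ Suc n) y = y" using m(2,4) by simp
    then show False using forests_no_cycle[OF m(3,1), of "Suc n"] by simp
  qed
  have cases: "y1 = y2 \<or> (y1 \<notin> A \<and> y2 \<notin> A)"
  proof (cases "y1 \<in> A")
    case True
    have "y2 \<in> A"
    proof (rule ccontr)
      assume "y2 \<notin> A"
      then have "y1 = v" "r1 \<in> forests A" using eq True st2(6) by (simp_all add: e1 e2)
      then show False using no_mixed[OF True _ _ r1x(1) st1(4)] by simp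
    qed
    with True show ?thesis using eq by (simp add: e1 e2)
  next
    case False
    have "y2 \<notin> A"
    proof
      assume "y2 \<in> A"
      then have "v = y2" "r2 \<in> forests A" using eq False st1(6) by (simp_all add: e1 e2)
      then show False using no_mixed[OF \<open>y2 \<in> A\<close> _ _ r1x(2) st2(4)] by simp
    qed
    with False show ?thesis by simp
  qed
  have x: "x1 = x2"
    by (rule unique_predecessor[of r1 A x1 x2 v])
      (use cases st1(1,3,4) st2(1,3,4) r1x rr in simp_all)
  have y: "y1 = y2" using r1x rr x by simp
  have nbr: "\<sigma>1 x1 \<in> E `` {x1}" "\<sigma>2 x1 \<in> E `` {x1}"
    using s x unfolding s12 states_def rooted_def cfgs_def by blast+
  have "\<tau> x1 (\<sigma>1 x1) = \<tau> x1 (\<sigma>2 x1)"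
    using y x unfolding y1_y2_def by simp
  from tau_inj[OF nbr this] have "\<sigma>1 x1 = \<sigma>2 x1" .
  moreover have "\<sigma>1 z = \<sigma>2 z" if "z \<noteq> x1" for z
    using fun_cong[OF rr, of z] that x by (simp add: r1_r2_def)
  ultimately have "\<sigma>1 z = \<sigma>2 z" for z by (cases "z = x1") simp_all
  then show "s1 = s2" using x by (simp add: s12 fun_eq_iff)
qed

text \<open>
  Rotor walk restarted at \<^term>\<open>v\<close> upon leaving \<^term>\<open>A\<close> permutes the states, and the rotor at the
  walker's position is unconstrained. So summing the increments of the Green function over all
  states counts the states with the walker at \<^term>\<open>x\<close>.
\<close>

lemma card_states_at_le:
  assumes A: "finite A" and v: "v \<in> A" and x: "x \<in> A"
  shows "real (card {\<sigma>\<in>rooted A x. leads \<sigma> v x}) \<le> real (card (forests A)) * green x v"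
proof -
  define X where "X = states A v"
  define S where "S u = {\<sigma>\<in>rooted A u. leads \<sigma> v u}" for u
  let ?g = "green x"
  let ?y = "\<lambda>s. fst (rotor_step \<tau> s)"
  define Ex where "Ex = {s\<in>X. ?y s \<notin> A}"
  have X: "X = (SIGMA u:A. S u)" by (simp add: X_def states_def S_def)
  have finX: "finite X" using A by (simp add: X_def finite_states)
  have fin_S: "finite (S u)" for u using A by (simp add: S_def finite_rooted)
  have bij: "bij_betw (restart_step A v) X X"
  proof -
    have "restart_step A v ` X \<subseteq> X" using restart_step_in_states[OF v] by (auto simp: X_def)
    then show ?thesis
      using endo_inj_surj[OF finX] inj_restart_step by (auto simp: bij_betw_def X_def)
  qed
  have "(\<Sum>s\<in>X. ?g (fst (restart_step A v s))) = (\<Sum>s\<in>X. ?g (fst s))"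
    by (rule sum.reindex_bij_betw[OF bij])
  also have "(\<Sum>s\<in>X. ?g (fst (restart_step A v s))) = (\<Sum>s\<in>X. ?g (?y s) + (if s \<in> Ex then ?g v - ?g (?y s) else 0))"
    by (intro sum.cong) (auto simp: restart_step_def Let_def Ex_def)
  also have "\<dots> = (\<Sum>s\<in>X. ?g (?y s)) + (\<Sum>s\<in>Ex. ?g v - ?g (?y s))"
    using finX by (simp add: sum.distrib sum.If_cases Ex_def Int_def)
  finally have 1: "(\<Sum>s\<in>X. ?g (fst s) - ?g (?y s)) = (\<Sum>s\<in>Ex. ?g v - ?g (?y s))"
    by (simp add: sum_subtractf)
  \<comment> \<open>The rotor at \<open>u\<close> is free, so all fibres over its values have the
    same size, and \<open>\<tau> u\<close> only permutes these values: one step from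
    \<open>u\<close> averages over the neighbors exactly.\<close>
  have S_sum: "(\<Sum>\<sigma>\<in>S u. ?g (\<tau> u (\<sigma> u))) = real (card (S u)) * nbr_avg E ?g u" if u: "u \<in> A" for u
  proof -
    define c where "c y = card {\<sigma>\<in>S u. \<sigma> u = y}" for y
    obtain y0 where y0: "y0 \<in> E `` {u}" using nbrs_nonempty[of u] by blast
    have c: "c y = c y0" if y: "y \<in> E `` {u}" for y
      unfolding c_def
    proof (rule bij_betw_same_card, rule bij_betw_byWitness[where f="\<lambda>\<sigma>. \<sigma>(u := y0)" and f'="\<lambda>\<sigma>. \<sigma>(u := y)"])
      show "(\<lambda>\<sigma>. \<sigma>(u := y0)) ` {\<sigma> \<in> S u. \<sigma> u = y} \<subseteq> {\<sigma> \<in> S u. \<sigma> u = y0}"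
        "(\<lambda>\<sigma>. \<sigma>(u := y)) ` {\<sigma> \<in> S u. \<sigma> u = y0} \<subseteq> {\<sigma> \<in> S u. \<sigma> u = y}"
        using u y y0 by (auto simp: S_def leads_fun_upd intro: rooted_upd)
    qed (auto simp: fun_eq_iff)
    have im: "(\<lambda>\<sigma>. \<sigma> u) ` S u \<subseteq> E `` {u}"
      using u by (auto simp: S_def rooted_def cfgs_def)
    have grp: "(\<Sum>\<sigma>\<in>S u. h (\<sigma> u)) = real (c y0) * (\<Sum>y\<in>E `` {u}. h y)" for h :: "'v \<Rightarrow> real"
    proof -
      have "(\<Sum>\<sigma>\<in>S u. h (\<sigma> u)) = (\<Sum>y\<in>E `` {u}. \<Sum>\<sigma>\<in>{\<sigma>\<in>S u. \<sigma> u = y}. h (\<sigma> u))"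
        using im fin_S by (intro sum.group[symmetric]) auto
      also have "\<dots> = (\<Sum>y\<in>E `` {u}. real (c y0) * h y)"
        using c by (intro sum.cong refl) (simp add: c_def)
      finally show ?thesis by (simp add: sum_distrib_left)
    qed
    have "real (card (S u)) = real (c y0) * real (card (E `` {u}))"
      using grp[of "\<lambda>_. 1"] by simp
    moreover have "(\<Sum>y\<in>E `` {u}. ?g (\<tau> u y)) = (\<Sum>y\<in>E `` {u}. ?g y)"
      by (rule sum.reindex_bij_betw[OF tau_bij])
    ultimately show ?thesis
      using grp[of "\<lambda>y. ?g (\<tau> u y)"] card_nbrs_pos[of u] by (simp add: nbr_avg_def)
  qed
  have "(\<Sum>s\<in>X. ?g (fst s) - ?g (?y s)) = (\<Sum>u\<in>A. \<Sum>\<sigma>\<in>S u. ?g u - ?g (\<tau> u (\<sigma> u)))"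
    unfolding X using A fin_S by (subst sum.Sigma) (auto simp: rotor_step_def intro!: sum.cong)
  \<comment> \<open>Away from the pole \<open>x\<close> the mean increment vanishes.\<close>
  also have "\<dots> = (\<Sum>u\<in>A. real (card (S u)) * of_bool (u = x))"
    by (intro sum.cong refl) (simp add: sum_subtractf S_sum nbr_avg_green algebra_simps)
  also have "\<dots> = real (card (S x))"
    using A x by (simp add: of_bool_def if_distrib cong: if_cong)
  finally have "real (card (S x)) = (\<Sum>s\<in>Ex. ?g v - ?g (?y s))" using 1 by simp
  also have "\<dots> \<le> (\<Sum>s\<in>Ex. ?g v)"
    by (intro sum_mono) (simp add: green_nonneg)
  also have "\<dots> = real (card Ex) * ?g v" by simp
  \<comment> \<open>After an exit the walker is at \<open>v\<close>, so by injectivity of the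
    restarted step the forest left behind identifies the exit.\<close>
  also have "card Ex \<le> card (forests A)"
  proof (rule card_inj_on_le[where f="\<lambda>s. snd (restart_step A v s)"])
    show "inj_on (\<lambda>s. snd (restart_step A v s)) Ex"
    proof (rule inj_onI)
      fix s1 s2 assume "s1 \<in> Ex" "s2 \<in> Ex" "snd (restart_step A v s1) = snd (restart_step A v s2)"
      then have "restart_step A v s1 = restart_step A v s2" "s1 \<in> X" "s2 \<in> X"
        by (auto simp: Ex_def restart_step_def Let_def)
      then show "s1 = s2" using inj_restart_step by (auto simp: X_def inj_on_def)
    qed
    show "(\<lambda>s. snd (restart_step A v s)) ` Ex \<subseteq> forests A"
      using states_step(6) by (auto simp: Ex_def X_def restart_step_def rotor_step_def Let_def)
    show "finite (forests A)" using A by (rule finite_forests)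
  qed
  then have "real (card Ex) * ?g v \<le> real (card (forests A)) * ?g v"
    by (intro mult_right_mono green_nonneg) simp
  finally show ?thesis by (simp add: S_def)
qed

section \<open>Runs from the source until exit\<close>

definition exit_time :: "'v set \<Rightarrow> 'v \<Rightarrow> ('v \<Rightarrow> 'v) \<Rightarrow> nat" where
  "exit_time A v \<sigma> = (LEAST t. walker_at \<tau> v \<sigma> t \<notin> A)"

definition exit_rotors :: "'v set \<Rightarrow> 'v \<Rightarrow> ('v \<Rightarrow> 'v) \<Rightarrow> 'v \<Rightarrow> 'v" where
  "exit_rotors A v \<sigma> = rotors_at \<tau> v \<sigma> (exit_time A v \<sigma>)"

lemma before_exit: "t < exit_time A v \<sigma> \<Longrightarrow> walker_at \<tau> v \<sigma> t \<in> A"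
  unfolding exit_time_def using not_less_Least by blast

lemma at_exit:
  assumes "finite A" and "\<sigma> \<in> forests A"
  shows "walker_at \<tau> v \<sigma> (exit_time A v \<sigma>) \<notin> A"
proof -
  have "\<exists>t. walker_at \<tau> v \<sigma> t \<notin> A"
    by (rule leaves_finite_set[OF assms(1)]) (rule forests_nbr[OF assms(2)])
  then show ?thesis unfolding exit_time_def by (rule LeastI_ex)
qed

lemma run_in_states:
  assumes "\<sigma> \<in> forests A" and "v \<in> A" and "t < exit_time A v \<sigma>"
  shows "(walker_at \<tau> v \<sigma> t, rotors_at \<tau> v \<sigma> t) \<in> states A v"
  using assms(3)
proof (induction t)
  case 0
  then show ?case using assms forests_rooted leads_refl by (auto simp: states_def)
next
  case (Suc t)
  then have s: "(walker_at \<tau> v \<sigma> t, rotors_at \<tau> v \<sigma> t) \<in> states A v" by simp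
  show ?case using states_step(5)[OF s] before_exit[OF Suc.prems]
    unfolding rotors_at_Suc walker_at_Suc by blast
qed

text \<open>A walk coming back to \<open>v\<close> has a cycle of rotors through \<open>v\<close>,
  because \<open>v\<close> leads to the preceding position. Hence the rotors form a forest with the
  walker at \<open>v\<close> only at the start of a run.\<close>

lemma run_not_restart:
  assumes "\<sigma> \<in> forests A" and "\<rho> \<in> forests A" and "v \<in> A" and "Suc t < exit_time A v \<sigma>"
  shows "(walker_at \<tau> v \<sigma> (Suc t), rotors_at \<tau> v \<sigma> (Suc t)) \<noteq> (v, \<rho>)"
proof
  assume eq: "(walker_at \<tau> v \<sigma> (Suc t), rotors_at \<tau> v \<sigma> (Suc t)) = (v, \<rho>)"
  have s: "(walker_at \<tau> v \<sigma> t, rotors_at \<tau> v \<sigma> t) \<in> states A v"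
    using assms by (intro run_in_states) auto
  have "leads \<rho> v (walker_at \<tau> v \<sigma> t)"
    using states_step(4)[OF s] eq unfolding rotors_at_Suc walker_at_Suc prod.inject by (elim conjE) (simp only:)
  then obtain n where "(\<rho> ^^ n) v = walker_at \<tau> v \<sigma> t" by (auto simp: leads_def)
  moreover have "\<rho> (walker_at \<tau> v \<sigma> t) = v" using eq rotor_at_walker[of \<tau> v \<sigma> t] by simp
  ultimately have "(\<rho> ^^ Suc n) v = v" by simp
  then show False using forests_no_cycle assms by blast
qed

text \<open>Both runs are traced backwards by injectivity of \<open>restart_step\<close>. Whichever
  reaches its start first shows a forest with the walker at \<open>v\<close>, so the other must be
  at its start too.\<close>

lemma run_inj:
  assumes "\<sigma> \<in> forests A" and "\<sigma>' \<in> forests A" and "v \<in> A"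
    and "t < exit_time A v \<sigma>" and "t' < exit_time A v \<sigma>'"
    and "(walker_at \<tau> v \<sigma> t, rotors_at \<tau> v \<sigma> t) = (walker_at \<tau> v \<sigma>' t', rotors_at \<tau> v \<sigma>' t')"
  shows "\<sigma> = \<sigma>' \<and> t = t'"
  using assms(4-)
proof (induction t arbitrary: t')
  case 0
  then show ?case
    using run_not_restart[OF assms(2,1,3), of "t' - 1"] by (cases t') simp_all
next
  case (Suc t)
  show ?case
  proof (cases t')
    case 0
    then show ?thesis using Suc.prems run_not_restart[OF assms(1,2,3), of t] by simp
  next
    case (Suc u)
    let ?s = "(walker_at \<tau> v \<sigma> t, rotors_at \<tau> v \<sigma> t)"
    let ?s' = "(walker_at \<tau> v \<sigma>' u, rotors_at \<tau> v \<sigma>' u)"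
    have "restart_step A v ?s = restart_step A v ?s'"
      unfolding restart_step_def rotor_step_at using Suc.prems(3) Suc by simp
    moreover have "?s \<in> states A v" "?s' \<in> states A v"
      using assms Suc Suc.prems by (auto intro!: run_in_states)
    ultimately have "?s = ?s'" using inj_restart_step by (auto simp: inj_on_def)
    then show ?thesis using Suc.IH[of u] Suc.prems Suc by simp
  qed
qed

text \<open>The exit step followed by the restart is one application of \<open>restart_step\<close>,
  so the forest at exit determines the state before it and, through \<open>run_inj\<close>, the
  initial forest. On a finite set injectivity suffices.\<close>

lemma bij_exit_rotors:
  assumes A: "finite A" and v: "v \<in> A"
  shows "bij_betw (exit_rotors A v) (forests A) (forests A)"
proof -
  have last: "exit_time A v \<sigma> = Suc (exit_time A v \<sigma> - 1)" if "\<sigma> \<in> forests A" for \<sigma>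
    using at_exit[OF A that, of v] v by (cases "exit_time A v \<sigma>") auto
  have *: "restart_step A v (walker_at \<tau> v \<sigma> t, rotors_at \<tau> v \<sigma> t) = (v, exit_rotors A v \<sigma>)
     \<and> exit_rotors A v \<sigma> \<in> forests A"
    if \<sigma>: "\<sigma> \<in> forests A" and t: "exit_time A v \<sigma> = Suc t" for \<sigma> t
  proof -
    have s: "(walker_at \<tau> v \<sigma> t, rotors_at \<tau> v \<sigma> t) \<in> states A v"
      using \<sigma> v t by (intro run_in_states) auto
    show ?thesis
      using at_exit[OF A \<sigma>, of v] states_step(6)[OF s]
      by (simp add: restart_step_def rotor_step_at exit_rotors_def t rotors_at_Suc walker_at_Suc)
  qed
  have "inj_on (exit_rotors A v) (forests A)"
  proof (rule inj_onI)
    fix \<sigma> \<sigma>' assume \<sigma>: "\<sigma> \<in> forests A" "\<sigma>' \<in> forests A" and eq: "exit_rotors A v \<sigma> = exit_rotors A v \<sigma>'"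
    let ?t = "exit_time A v \<sigma> - 1" and ?t' = "exit_time A v \<sigma>' - 1"
    have lt: "?t < exit_time A v \<sigma>" "?t' < exit_time A v \<sigma>'" using last \<sigma> by (metis lessI)+
    have "(walker_at \<tau> v \<sigma> ?t, rotors_at \<tau> v \<sigma> ?t) = (walker_at \<tau> v \<sigma>' ?t', rotors_at \<tau> v \<sigma>' ?t')"
      by (rule inj_onD[OF inj_restart_step[of A v]])
        (use *[OF \<sigma>(1) last] *[OF \<sigma>(2) last] \<sigma> eq lt v in \<open>simp_all add: run_in_states\<close>)
    then show "\<sigma> = \<sigma>'" using run_inj[OF \<sigma> v lt] by simp
  qed
  moreover have "exit_rotors A v ` forests A \<subseteq> forests A" using * last by blast
  ultimately show ?thesis
    using finite_forests[OF A] by (simp add: bij_betw_def endo_inj_surj)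
qed

lemma sum_visits_le:
  assumes A: "finite A" and v: "v \<in> A" and x: "x \<in> A"
  shows "(\<Sum>\<sigma>\<in>forests A. real (card {t. t < exit_time A v \<sigma> \<and> walker_at \<tau> v \<sigma> t = x}))
    \<le> real (card (forests A)) * green x v"
proof -
  let ?V = "\<lambda>\<sigma>. {t. t < exit_time A v \<sigma> \<and> walker_at \<tau> v \<sigma> t = x}"
  let ?S = "SIGMA \<sigma>:forests A. ?V \<sigma>"
  have "(\<Sum>\<sigma>\<in>forests A. card (?V \<sigma>)) = card ?S"
    using finite_forests[OF A] by (intro card_SigmaI[symmetric]) auto
  also have "\<dots> \<le> card {\<sigma>\<in>rooted A x. leads \<sigma> v x}"
  proof (rule card_inj_on_le[where f="\<lambda>(\<sigma>, t). rotors_at \<tau> v \<sigma> t"])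
    show "inj_on (\<lambda>(\<sigma>, t). rotors_at \<tau> v \<sigma> t) ?S"
    proof (rule inj_onI, clarify)
      fix \<sigma> t \<sigma>' t'
      assume "\<sigma> \<in> forests A" "\<sigma>' \<in> forests A" "t < exit_time A v \<sigma>" "t' < exit_time A v \<sigma>'"
        "rotors_at \<tau> v \<sigma> t = rotors_at \<tau> v \<sigma>' t'" "walker_at \<tau> v \<sigma>' t' = walker_at \<tau> v \<sigma> t"
      then show "\<sigma> = \<sigma>' \<and> t = t'" using run_inj[of \<sigma> A \<sigma>' v t t'] v by simp
    qed
    show "(\<lambda>(\<sigma>, t). rotors_at \<tau> v \<sigma> t) ` ?S \<subseteq> {\<sigma>\<in>rooted A x. leads \<sigma> v x}"
      using run_in_states v by (fastforce simp: states_def)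
    show "finite {\<sigma>\<in>rooted A x. leads \<sigma> v x}" using finite_rooted[OF A] by simp
  qed
  finally have "real (\<Sum>\<sigma>\<in>forests A. card (?V \<sigma>)) \<le> real (card {\<sigma>\<in>rooted A x. leads \<sigma> v x})"
    by (simp only: of_nat_le_iff)
  also have "\<dots> \<le> real (card (forests A)) * green x v"
    by (rule card_states_at_le[OF A v x])
  finally show ?thesis by simp
qed

text \<open>One late visit is selected per forest; \<open>run_inj\<close> keeps the selected states
  apart, and the earlier position outside \<open>B\<close> is the far vertex leading to
  \<open>x\<close>.\<close>

lemma card_late_visits_le:
  assumes A: "finite A" and v: "v \<in> A" and x: "x \<in> A"
    and t0: "\<And>\<sigma>. \<sigma> \<in> forests A \<Longrightarrow> \<exists>s\<le>t0. walker_at \<tau> v \<sigma> s \<notin> B"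
  shows "card {\<sigma>\<in>forests A. \<exists>t. t0 \<le> t \<and> t < exit_time A v \<sigma> \<and> walker_at \<tau> v \<sigma> t = x}
    \<le> card {\<sigma>\<in>rooted A x. \<exists>u. u \<notin> B \<and> leads \<sigma> u x}"
proof -
  let ?L = "{\<sigma>\<in>forests A. \<exists>t. t0 \<le> t \<and> t < exit_time A v \<sigma> \<and> walker_at \<tau> v \<sigma> t = x}"
  define T where "T \<sigma> = (SOME t. t0 \<le> t \<and> t < exit_time A v \<sigma> \<and> walker_at \<tau> v \<sigma> t = x)" for \<sigma>
  have T: "t0 \<le> T \<sigma>" "T \<sigma> < exit_time A v \<sigma>" "walker_at \<tau> v \<sigma> (T \<sigma>) = x" if "\<sigma> \<in> ?L" for \<sigma>
  proof -
    have "\<exists>t. t0 \<le> t \<and> t < exit_time A v \<sigma> \<and> walker_at \<tau> v \<sigma> t = x" using that by blast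
    from someI_ex[OF this] show "t0 \<le> T \<sigma>" "T \<sigma> < exit_time A v \<sigma>" "walker_at \<tau> v \<sigma> (T \<sigma>) = x"
      by (auto simp: T_def)
  qed
  show ?thesis
  proof (rule card_inj_on_le[where f="\<lambda>\<sigma>. rotors_at \<tau> v \<sigma> (T \<sigma>)"])
    show "inj_on (\<lambda>\<sigma>. rotors_at \<tau> v \<sigma> (T \<sigma>)) ?L"
    proof (rule inj_onI)
      fix \<sigma> \<sigma>' assume *: "\<sigma> \<in> ?L" "\<sigma>' \<in> ?L" "rotors_at \<tau> v \<sigma> (T \<sigma>) = rotors_at \<tau> v \<sigma>' (T \<sigma>')"
      then show "\<sigma> = \<sigma>'"
        using run_inj[of \<sigma> A \<sigma>' v "T \<sigma>" "T \<sigma>'"] T(2,3)[of \<sigma>] T(2,3)[of \<sigma>'] v by auto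
    qed
    show "(\<lambda>\<sigma>. rotors_at \<tau> v \<sigma> (T \<sigma>)) ` ?L \<subseteq> {\<sigma>\<in>rooted A x. \<exists>u. u \<notin> B \<and> leads \<sigma> u x}"
    proof (rule image_subsetI)
      fix \<sigma> assume \<sigma>: "\<sigma> \<in> ?L"
      then have "(x, rotors_at \<tau> v \<sigma> (T \<sigma>)) \<in> states A v"
        using run_in_states[of \<sigma> A v "T \<sigma>"] T[OF \<sigma>] v by simp
      moreover obtain s where "s \<le> t0" "walker_at \<tau> v \<sigma> s \<notin> B" using t0 \<sigma> by blast
      moreover have "leads (rotors_at \<tau> v \<sigma> (T \<sigma>)) (walker_at \<tau> v \<sigma> s) x"
        using visited_leads[of s "T \<sigma>" \<tau> v \<sigma>] T[OF \<sigma>] \<open>s \<le> t0\<close> by simp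
      ultimately show "rotors_at \<tau> v \<sigma> (T \<sigma>) \<in> {\<sigma>\<in>rooted A x. \<exists>u. u \<notin> B \<and> leads \<sigma> u x}"
        by (auto simp: states_def)
    qed
    show "finite {\<sigma>\<in>rooted A x. \<exists>u. u \<notin> B \<and> leads \<sigma> u x}" using finite_rooted[OF A] by simp
  qed
qed

end


section \<open>The wired spanning forest as a random rotor configuration\<close>

definition edges_of :: "'v set \<Rightarrow> ('v \<Rightarrow> 'v) \<Rightarrow> ('v \<times> 'v) set" where
  "edges_of A \<sigma> = (\<lambda>x. (x, \<sigma> x)) ` A"

context walk_graph
begin

text \<open>Step to a neighbor that is closer to \<open>S\<close> in graph distance. This supplies
  both a forest on every box and the path along which rotors are later redirected.\<close>

lemma exists_leading_function:
  assumes "S \<noteq> {}"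
  shows "\<exists>f. (\<forall>x. x \<notin> S \<longrightarrow> f x \<in> E `` {x}) \<and> (\<forall>x. \<exists>n. (f ^^ n) x \<in> S)"
proof -
  define P where "P x n \<longleftrightarrow> (\<exists>y\<in>S. (x, y) \<in> E ^^ n)" for x n
  define d where "d x = (LEAST n. P x n)" for x
  obtain s where "s \<in> S" using assms by auto
  then have "\<exists>n. P x n" for x using connect[of x s] by (auto simp: P_def rtrancl_power)
  then have Pd: "P x (d x)" for x unfolding d_def by (rule LeastI_ex)
  have "\<exists>z. z \<in> E `` {x} \<and> d z < d x" if x: "x \<notin> S" for x
  proof -
    obtain y where y: "y \<in> S" "(x, y) \<in> E ^^ d x" using Pd by (auto simp: P_def)
    then obtain m where m: "d x = Suc m" using x y by (cases "d x") auto
    with y obtain z where z: "(x, z) \<in> E" "(z, y) \<in> E ^^ m" by (metis relpow_Suc_E2)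
    then have "d z \<le> m" unfolding d_def using y by (intro Least_le) (auto simp: P_def)
    with z m show ?thesis by auto
  qed
  then obtain f where f: "\<And>x. x \<notin> S \<Longrightarrow> f x \<in> E `` {x} \<and> d (f x) < d x" by metis
  have "\<exists>n. (f ^^ n) x \<in> S" for x
  proof (induction "d x" arbitrary: x rule: less_induct)
    case less
    show ?case
    proof (cases "x \<in> S")
      case False
      then obtain n where "(f ^^ n) (f x) \<in> S" using less f by blast
      then show ?thesis by (intro exI[of _ "Suc n"]) (simp add: funpow_swap1)
    qed (auto intro: exI[of _ 0])
  qed
  with f show ?thesis by blast
qed

end

context rotor_graph
begin

section \<open>Forests on a box as uniform spanning forests\<close>

lemma forests_nonempty:
  assumes "finite A"
  shows "forests A \<noteq> {}"
proof -
  have "- A \<noteq> {}" using assms infinite_vertices by (metis Compl_empty_eq double_complement)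
  then have "\<exists>f. (\<forall>x. x \<notin> - A \<longrightarrow> f x \<in> E `` {x}) \<and> (\<forall>x. \<exists>n. (f ^^ n) x \<in> - A)"
    by (rule exists_leading_function)
  then obtain f where f: "\<forall>x. x \<notin> - A \<longrightarrow> f x \<in> E `` {x}" "\<forall>x. \<exists>n. (f ^^ n) x \<in> - A"
    by (elim exE conjE)
  define \<sigma> where "\<sigma> x = (if x \<in> A then f x else x)" for x
  have "\<exists>n. (\<sigma> ^^ n) u \<in> - A" for u
    using first_hit_agree[OF f(2)[rule_format, of u], of \<sigma>] by (auto simp: \<sigma>_def)
  then have "\<sigma> \<in> forests A" using f(1) by (auto simp: forests_def cfgs_def \<sigma>_def)
  then show ?thesis by auto
qed

lemma card_forests_pos: "finite A \<Longrightarrow> 0 < card (forests A)"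
  by (simp add: card_gt_0_iff finite_forests forests_nonempty)

lemma Image_edges_of: "edges_of A \<sigma> `` {x} = (if x \<in> A then {\<sigma> x} else {})"
  by (auto simp: edges_of_def)

lemma trancl_edges_of:
  "(x, y) \<in> (edges_of A \<sigma>)\<^sup>+ \<Longrightarrow> x \<in> A \<and> (\<exists>k>0. (\<sigma> ^^ k) x = y)"
proof (induction rule: trancl_induct)
  case (base y)
  then show ?case by (auto simp: edges_of_def intro!: exI[of _ 1])
next
  case (step y z)
  then obtain k where k: "k > 0" "(\<sigma> ^^ k) x = y" by blast
  have "(\<sigma> ^^ Suc k) x = z" using step(2) k by (auto simp: edges_of_def)
  then show ?case using step by blast
qed

text \<open>Acyclic and absorbed orbits correspond because an orbit staying in the finite set
  \<open>A\<close> repeats a vertex.\<close>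

lemma bij_edges_of:
  assumes A: "finite A"
  shows "bij_betw (edges_of A) (forests A) {F. oriented_spanning_forest E (- A) F}"
  unfolding bij_betw_def
proof
  show "inj_on (edges_of A) (forests A)"
  proof (rule inj_onI)
    fix \<sigma> \<sigma>' assume *: "\<sigma> \<in> forests A" "\<sigma>' \<in> forests A" "edges_of A \<sigma> = edges_of A \<sigma>'"
    have "\<sigma> x = \<sigma>' x" for x
      using * Image_edges_of[of A \<sigma> x] Image_edges_of[of A \<sigma>' x]
      by (cases "x \<in> A") (auto simp: forests_def cfgs_def)
    then show "\<sigma> = \<sigma>'" by auto
  qed
  show "edges_of A ` forests A = {F. oriented_spanning_forest E (- A) F}"
  proof (intro set_eqI iffI)
    fix F assume "F \<in> edges_of A ` forests A"
    then obtain \<sigma> where F: "F = edges_of A \<sigma>" and \<sigma>: "\<sigma> \<in> forests A" by auto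
    have "F \<subseteq> E" using forests_nbr[OF \<sigma>] by (auto simp: F edges_of_def)
    moreover have "acyclic F"
      unfolding acyclic_def F
    proof (intro allI notI)
      fix x assume "(x, x) \<in> (edges_of A \<sigma>)\<^sup>+"
      from trancl_edges_of[OF this] obtain k where "x \<in> A" "k > 0" "(\<sigma> ^^ k) x = x" by auto
      then show False by (intro forests_no_cycle[OF \<sigma>])
    qed
    ultimately show "F \<in> {F. oriented_spanning_forest E (- A) F}"
      by (simp add: oriented_spanning_forest_def) (auto simp: F Image_edges_of)
  next
    fix F assume "F \<in> {F. oriented_spanning_forest E (- A) F}"
    then have FE: "F \<subseteq> E" and out0: "\<And>x. x \<notin> A \<Longrightarrow> card (F `` {x}) = 0"
      and out1: "\<And>x. x \<in> A \<Longrightarrow> card (F `` {x}) = 1" and ac: "acyclic F"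
      by (auto simp: oriented_spanning_forest_def)
    define \<sigma> where "\<sigma> x = (if x \<in> A then the_elem (F `` {x}) else x)" for x
    have s1: "F `` {x} = {\<sigma> x}" if x: "x \<in> A" for x
    proof -
      obtain y where "F `` {x} = {y}" using out1[OF x] by (auto simp: card_1_singleton_iff)
      then show ?thesis using x by (simp add: \<sigma>_def)
    qed
    \<comment> \<open>An infinite set has \<open>card\<close> 0 as well, so outdegree zero gives
      emptiness only together with local finiteness.\<close>
    have s0: "F `` {x} = {}" if "x \<notin> A" for x
    proof -
      have "finite (F `` {x})" by (rule finite_subset[OF _ finite_nbrs[of x]]) (use FE in auto)
      then show ?thesis using out0[OF that] by simp
    qed
    have F: "F = edges_of A \<sigma>"
    proof -
      have "(x, y) \<in> F \<longleftrightarrow> (x, y) \<in> edges_of A \<sigma>" for x y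
        using s1[of x] s0[of x] Image_edges_of[of A \<sigma> x] by (cases "x \<in> A") auto
      then show ?thesis by auto
    qed
    have cf: "\<sigma> \<in> cfgs A"
    proof -
      have "\<sigma> x \<in> E `` {x}" if "x \<in> A" for x using s1[OF that] FE by blast
      then show ?thesis by (auto simp: cfgs_def \<sigma>_def)
    qed
    have "\<exists>n. (\<sigma> ^^ n) u \<notin> A" for u
    proof (rule ccontr)
      assume "\<not> ?thesis"
      then have inA: "(\<sigma> ^^ n) u \<in> A" for n by auto
      have path: "((\<sigma> ^^ i) u, (\<sigma> ^^ (i + Suc k)) u) \<in> F\<^sup>+" for i k
      proof (induction k)
        case 0
        then show ?case using s1[OF inA[of i]] by auto
      next
        case (Suc k)
        then show ?case using s1[OF inA[of "i + Suc k"]] by (auto intro: trancl_into_trancl)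
      qed
      have "\<not> inj (\<lambda>n. (\<sigma> ^^ n) u)"
        using inA A by (metis finite_subset image_subset_iff infinite_UNIV_nat range_inj_infinite)
      then obtain i j where "i < j" "(\<sigma> ^^ i) u = (\<sigma> ^^ j) u"
        unfolding inj_def by (metis linorder_neq_iff)
      then show False using path[of i "j - Suc i"] ac by (auto simp: acyclic_def)
    qed
    then have "\<sigma> \<in> forests A" using cf by (auto simp: forests_def)
    then show "F \<in> edges_of A ` forests A" using F by blast
  qed
qed

definition forest_mean :: "'v set \<Rightarrow> (('v \<Rightarrow> 'v) \<Rightarrow> real) \<Rightarrow> real" where
  "forest_mean A f = (\<Sum>\<sigma>\<in>forests A. f \<sigma>) / real (card (forests A))"

lemma USF_prob:
  assumes A: "finite A" and B: "B \<subseteq> E"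
  shows "measure_pmf.prob (USF E (- A)) {F. B \<subseteq> F} = forest_mean A (\<lambda>\<sigma>. of_bool (\<forall>(x, y)\<in>B. \<sigma> x = y))"
proof -
  let ?O = "{F. oriented_spanning_forest E (- A) F}"
  note bij = bij_edges_of[OF A]
  have O: "?O \<noteq> {}" "finite ?O"
    using bij_betw_finite[OF bij] bij_betw_empty1[of "edges_of A"] finite_forests[OF A] forests_nonempty[OF A] bij
    by (auto simp: bij_betw_def)
  have eq: "{\<sigma>\<in>forests A. B \<subseteq> edges_of A \<sigma>} = {\<sigma>\<in>forests A. \<forall>(x, y)\<in>B. \<sigma> x = y}"
  proof (intro Collect_cong conj_cong refl)
    fix \<sigma> assume \<sigma>: "\<sigma> \<in> forests A"
    \<comment> \<open>The self-pointing default outside \<open>A\<close> never matches an edge of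
      \<open>B\<close>, since \<open>E\<close> has no loops.\<close>
    have "(x, y) \<in> edges_of A \<sigma> \<longleftrightarrow> \<sigma> x = y" if "(x, y) \<in> B" for x y
      using that B irrefl_E[of x] \<sigma> by (cases "x \<in> A") (auto simp: edges_of_def forests_def cfgs_def)
    then show "B \<subseteq> edges_of A \<sigma> \<longleftrightarrow> (\<forall>(x, y)\<in>B. \<sigma> x = y)" by fast
  qed
  have "measure_pmf.prob (USF E (- A)) {F. B \<subseteq> F} = card (?O \<inter> {F. B \<subseteq> F}) / card ?O"
    unfolding USF_def by (rule measure_pmf_of_set[OF O])
  also have "card ?O = card (forests A)" using bij_betw_same_card[OF bij] by simp
  also have "?O \<inter> {F. B \<subseteq> F} = edges_of A ` {\<sigma>\<in>forests A. B \<subseteq> edges_of A \<sigma>}"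
  proof -
    have "?O = edges_of A ` forests A" using bij by (simp add: bij_betw_def)
    then show ?thesis by (simp only:) auto
  qed
  also have "card \<dots> = card {\<sigma>\<in>forests A. B \<subseteq> edges_of A \<sigma>}"
    using bij by (intro card_image) (auto simp: bij_betw_def inj_on_def)
  also have "\<dots> = card {\<sigma>\<in>forests A. \<forall>(x, y)\<in>B. \<sigma> x = y}" unfolding eq ..
  also have "real \<dots> = (\<Sum>\<sigma>\<in>forests A. of_bool (\<forall>(x, y)\<in>B. \<sigma> x = y))"
    using finite_forests[OF A] by (simp add: Int_def of_bool_def sum.If_cases)
  finally show ?thesis by (simp add: forest_mean_def)
qed

lemma forest_mean_mono:
  "(\<And>\<sigma>. \<sigma> \<in> forests A \<Longrightarrow> f \<sigma> \<le> g \<sigma>) \<Longrightarrow> forest_mean A f \<le> forest_mean A g"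
  unfolding forest_mean_def by (intro divide_right_mono sum_mono) auto

lemma forest_mean_of_bool:
  "finite A \<Longrightarrow> forest_mean A (\<lambda>\<sigma>. of_bool (P \<sigma>)) = real (card {\<sigma>\<in>forests A. P \<sigma>}) / real (card (forests A))"
  using finite_forests[of A] by (simp add: forest_mean_def Int_def of_bool_def sum.If_cases)

section \<open>Exhausting boxes and functions of finitely many rotors\<close>

definition exhaust :: "nat \<Rightarrow> 'v set" where
  "exhaust R = from_nat_into UNIV ` {..<R}"

lemma finite_exhaust [simp]: "finite (exhaust R)"
  by (simp add: exhaust_def)

lemma exhaust_mono: "R \<le> R' \<Longrightarrow> exhaust R \<subseteq> exhaust R'"
  by (auto simp: exhaust_def)

lemma in_exhaust: "\<exists>R. x \<in> exhaust R"
proof -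
  have "x \<in> range (from_nat_into (UNIV :: 'v set))"
    using range_from_nat_into[of "UNIV :: 'v set"] countable_vertices by simp
  then obtain n where "x = from_nat_into UNIV n" by auto
  then have "x \<in> exhaust (Suc n)" by (auto simp: exhaust_def)
  then show ?thesis ..
qed

lemma eventually_exhaust:
  assumes "finite K"
  shows "eventually (\<lambda>R. K \<subseteq> exhaust R) sequentially"
  using assms
proof induction
  case (insert x K)
  obtain R where "x \<in> exhaust R" using in_exhaust by blast
  then have "eventually (\<lambda>R. x \<in> exhaust R) sequentially"
    using exhaust_mono by (auto simp: eventually_sequentially intro!: exI[of _ R])
  with insert(3) show ?case by eventually_elim auto
qed simp

text \<open>Only the rotors on \<open>K\<close> must be legal. So the same function can be evaluated
  on forests of a large box, which point to themselves outside it, and on configurations of the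
  whole graph.\<close>

definition cylindrical :: "'v set \<Rightarrow> (('v \<Rightarrow> 'v) \<Rightarrow> 'b) \<Rightarrow> bool" where
  "cylindrical K f \<longleftrightarrow> (\<forall>\<rho> \<rho>'. (\<forall>x\<in>K. \<rho> x \<in> E `` {x} \<and> \<rho>' x = \<rho> x) \<longrightarrow> f \<rho> = f \<rho>')"

lemma cylindricalD:
  "cylindrical K f \<Longrightarrow> (\<And>x. x \<in> K \<Longrightarrow> \<rho> x \<in> E `` {x}) \<Longrightarrow> (\<And>x. x \<in> K \<Longrightarrow> \<rho>' x = \<rho> x) \<Longrightarrow> f \<rho> = f \<rho>'"
  unfolding cylindrical_def by blast

text \<open>Expansion into the finitely many rotor patterns on \<open>K\<close>; by linearity,
  measurability and limits reduce to pattern events.\<close>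

lemma cylindrical_sum:
  assumes f: "cylindrical K f" and K: "finite K" and \<rho>: "\<And>x. x \<in> K \<Longrightarrow> \<rho> x \<in> E `` {x}"
  shows "(f \<rho> :: real) = (\<Sum>\<eta>\<in>PiE K (\<lambda>x. E `` {x}). f \<eta> * of_bool (\<forall>x\<in>K. \<rho> x = \<eta> x))"
proof -
  have fin: "finite (PiE K (\<lambda>x. E `` {x}))" using K by (intro finite_PiE) auto
  have r: "restrict \<rho> K \<in> PiE K (\<lambda>x. E `` {x})" using \<rho> by auto
  have "(\<forall>x\<in>K. \<rho> x = \<eta> x) \<longleftrightarrow> \<eta> = restrict \<rho> K" if "\<eta> \<in> PiE K (\<lambda>x. E `` {x})" for \<eta>
  proof
    assume "\<forall>x\<in>K. \<rho> x = \<eta> x"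
    then show "\<eta> = restrict \<rho> K" using that by (intro PiE_ext[OF that r]) auto
  qed simp
  then have "(\<Sum>\<eta>\<in>PiE K (\<lambda>x. E `` {x}). f \<eta> * of_bool (\<forall>x\<in>K. \<rho> x = \<eta> x))
      = (\<Sum>\<eta>\<in>PiE K (\<lambda>x. E `` {x}). if \<eta> = restrict \<rho> K then f \<eta> else 0)"
    by (intro sum.cong) auto
  also have "\<dots> = f (restrict \<rho> K)" using fin r by simp
  also have "\<dots> = f \<rho>" using \<rho> by (intro cylindricalD[OF f]) auto
  finally show ?thesis ..
qed

section \<open>The measurable space of rotor configurations\<close>

abbreviation cfg_space :: "('v \<Rightarrow> 'v) measure" where
  "cfg_space \<equiv> PiM UNIV (\<lambda>x. count_space (E `` {x}))"

lemma space_cfg_space: "space cfg_space = {\<rho>. \<forall>x. \<rho> x \<in> E `` {x}}"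
  by (auto simp: space_PiM PiE_def Pi_def)

lemma cfg_coord_measurable: "(\<lambda>\<rho>. \<rho> x) \<in> measurable cfg_space (count_space UNIV)"
proof -
  have "(\<lambda>\<rho>. \<rho> x) \<in> measurable cfg_space (count_space (E `` {x}))"
    by (rule measurable_component_singleton) simp
  then show ?thesis
    by (rule measurable_compose) simp
qed

lemma cylindrical_measurable:
  assumes "cylindrical K (f :: _ \<Rightarrow> real)" and "finite K"
  shows "f \<in> borel_measurable cfg_space"
proof -
  have [measurable]: "Measurable.pred cfg_space (\<lambda>\<rho>. \<forall>x\<in>K. \<rho> x = \<eta> x)" for \<eta> :: "'v \<Rightarrow> 'v"
    using assms(2)
  proof (intro pred_intros_finite)
    fix x
    show "Measurable.pred cfg_space (\<lambda>\<rho>. \<rho> x = \<eta> x)"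
      using measurable_compose[OF cfg_coord_measurable[of x], of "\<lambda>y. y = \<eta> x" "count_space UNIV"] by simp
  qed
  have "(\<lambda>\<rho>. \<Sum>\<eta>\<in>PiE K (\<lambda>x. E `` {x}). f \<eta> * of_bool (\<forall>x\<in>K. \<rho> x = \<eta> x)) \<in> borel_measurable cfg_space"
    by measurable
  then show ?thesis
    by (rule measurable_cong[THEN iffD1, rotated])
      (intro cylindrical_sum[OF assms, symmetric], auto simp: space_cfg_space)
qed

text \<open>Agrees with \<^const>\<open>rotor_config_of\<close> on the almost sure event that all outdegrees are one,
  but is measurable and always points to a neighbour.\<close>

definition cfg_of :: "('v \<times> 'v) set \<Rightarrow> 'v \<Rightarrow> 'v" where
  "cfg_of F x = (if \<exists>!y. (x, y) \<in> F then THE y. (x, y) \<in> F else SOME y. y \<in> E `` {x})"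

lemma cfg_of_nbr: "F \<subseteq> E \<Longrightarrow> cfg_of F x \<in> E `` {x}"
proof -
  assume F: "F \<subseteq> E"
  show ?thesis
  proof (cases "\<exists>!y. (x, y) \<in> F")
    case True
    then show ?thesis using theI'[OF True] F by (auto simp: cfg_of_def)
  next
    case False
    obtain y where "y \<in> E `` {x}" using nbrs_nonempty[of x] by blast
    then have "(SOME y. y \<in> E `` {x}) \<in> E `` {x}" by (rule someI)
    then show ?thesis using False by (simp add: cfg_of_def)
  qed
qed

end

locale wsf_graph = rotor_graph E \<tau> for E :: "('v \<times> 'v) set" and \<tau> +
  fixes W :: "('v \<times> 'v) set measure"
  assumes WSF: "is_WSF E W" and one_ended: "AE F in W. all_trees_one_ended F"
begin

sublocale W: prob_space W
  using WSF by (simp add: is_WSF_def)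

section \<open>Outdegrees in the wired spanning forest\<close>

lemma sets_W: "sets W = sets (subgraph_space E)"
  using WSF by (simp add: is_WSF_def)

lemma space_W: "space W = Pow E"
  using sets_eq_imp_space_eq[OF sets_W] by (simp add: subgraph_space_def space_measure_of_conv)

lemma edge_event: "{F \<in> space W. e \<in> F} \<in> sets W"
proof (cases "e \<in> E")
  case True
  have *: "{F \<in> Pow E. e \<in> F} \<in> sigma_sets (Pow E) ((\<lambda>e. {F \<in> Pow E. e \<in> F}) ` E)"
    using True by (intro sigma_sets.Basic) auto
  have "(\<lambda>e. {F \<in> Pow E. e \<in> F}) ` E \<subseteq> Pow (Pow E)" by auto
  then show ?thesis using * unfolding sets_W space_W by (simp add: subgraph_space_def sets_measure_of)
next
  case False
  then have empty: "{F \<in> space W. e \<in> F} = {}" by (auto simp: space_W)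
  show ?thesis unfolding empty by (rule sets.empty_sets)
qed

lemma edge_pred [measurable]: "Measurable.pred W (\<lambda>F. e \<in> F)"
  using edge_event by (simp add: pred_def)

lemma USF_tendsto:
  assumes "finite B" and "B \<subseteq> E"
  shows "(\<lambda>R. forest_mean (exhaust R) (\<lambda>\<sigma>. of_bool (\<forall>(x, y)\<in>B. \<sigma> x = y)))
    \<longlonglongrightarrow> measure W {F \<in> space W. B \<subseteq> F}"
proof -
  define Z where "Z R = - exhaust R" for R
  have "decseq Z" using exhaust_mono by (auto simp: decseq_def Z_def)
  moreover have "\<forall>R. finite (- Z R)" by (simp add: Z_def)
  moreover have "(\<Inter>R. Z R) = {}" using in_exhaust by (auto simp: Z_def)
  ultimately have "(\<lambda>R. measure_pmf.prob (USF E (Z R)) {F. B \<subseteq> F}) \<longlonglongrightarrow> measure W {F \<in> space W. B \<subseteq> F}"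
    using WSF assms unfolding is_WSF_def by blast
  then show ?thesis using USF_prob[OF finite_exhaust \<open>B \<subseteq> E\<close>] by (simp add: Z_def)
qed

lemma edge_integral: "(\<integral>F. of_bool (e \<in> F) \<partial>W) = measure W {F \<in> space W. {e} \<subseteq> F}"
proof -
  have "(\<integral>F. of_bool (e \<in> F) \<partial>W) = (\<integral>F. indicator {F \<in> space W. {e} \<subseteq> F} F \<partial>W :: real)"
    by (intro Bochner_Integration.integral_cong) (auto simp: indicator_def)
  also have "\<dots> = measure W {F \<in> space W. {e} \<subseteq> F}"
    unfolding Bochner_Integration.integral_indicator by (intro arg_cong[where f="measure W"]) auto
  finally show ?thesis .
qed

text \<open>Only limits of inclusion probabilities are given. Two given out-edges of
  \<open>x\<close> occur together with limiting probability 0, so the outdegree is at most 1. Its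
  mean is 1, being 1 in every box that contains \<open>x\<close>; so it is 1 almost surely.\<close>

lemma AE_outdegree_one: "AE F in W. \<forall>x. \<exists>!y. (x, y) \<in> F"
proof -
  have "AE F in W. \<exists>!y. (x, y) \<in> F" for x
  proof -
    let ?N = "E `` {x}"
    have ev_x: "eventually (\<lambda>R. x \<in> exhaust R) sequentially"
      using eventually_exhaust[of "{x}"] by simp
    have pair: "AE F in W. \<not> ((x, y) \<in> F \<and> (x, z) \<in> F)" if "y \<in> ?N" "z \<in> ?N" "y \<noteq> z" for y z
    proof -
      let ?B = "{(x, y), (x, z)}"
      have "(\<lambda>R. forest_mean (exhaust R) (\<lambda>\<sigma>. of_bool (\<forall>(x, y)\<in>?B. \<sigma> x = y))) \<longlonglongrightarrow> measure W {F \<in> space W. ?B \<subseteq> F}"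
        using that by (intro USF_tendsto) auto
      moreover have "(\<lambda>R. forest_mean (exhaust R) (\<lambda>\<sigma>. of_bool (\<forall>(x, y)\<in>?B. \<sigma> x = y))) = (\<lambda>R. 0)"
        using that by (auto simp: forest_mean_def fun_eq_iff intro!: sum.neutral)
      ultimately have "measure W {F \<in> space W. ?B \<subseteq> F} = 0"
        by (simp add: LIMSEQ_const_iff)
      moreover have "{F \<in> space W. ?B \<subseteq> F} \<in> sets W"
        by simp
      ultimately show ?thesis
        using W.prob_eq_0[of "{F \<in> space W. ?B \<subseteq> F}"] by (auto elim!: eventually_mono)
    qed
    have pairs: "AE F in W. \<forall>y\<in>?N. \<forall>z\<in>?N. y \<noteq> z \<longrightarrow> \<not> ((x, y) \<in> F \<and> (x, z) \<in> F)"
      using pair by (intro AE_finite_allI) auto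
    define X where "X F = (\<Sum>y\<in>?N. of_bool ((x, y) \<in> F) :: real)" for F
    have Xint: "integrable W X" unfolding X_def
      by (intro Bochner_Integration.integrable_sum W.integrable_const_bound[where B=1]) auto
    have "(\<integral>F. X F \<partial>W) = (\<Sum>y\<in>?N. measure W {F \<in> space W. {(x, y)} \<subseteq> F})"
      unfolding X_def by (subst Bochner_Integration.integral_sum)
        (auto simp: edge_integral intro!: W.integrable_const_bound[where B=1])
    also have "\<dots> = 1"
    proof (rule LIMSEQ_unique)
      show "(\<lambda>R. \<Sum>y\<in>?N. forest_mean (exhaust R) (\<lambda>\<sigma>. of_bool (\<forall>(u, w)\<in>{(x, y)}. \<sigma> u = w)))
          \<longlonglongrightarrow> (\<Sum>y\<in>?N. measure W {F \<in> space W. {(x, y)} \<subseteq> F})"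
        by (intro tendsto_sum USF_tendsto) auto
      have "eventually (\<lambda>R. (\<Sum>y\<in>?N. forest_mean (exhaust R) (\<lambda>\<sigma>. of_bool (\<forall>(u, w)\<in>{(x, y)}. \<sigma> u = w))) = 1) sequentially"
        using ev_x
      proof eventually_elim
        case (elim R)
        let ?C = "real (card (forests (exhaust R)))"
        have "(\<Sum>y\<in>?N. forest_mean (exhaust R) (\<lambda>\<sigma>. of_bool (\<forall>(u, w)\<in>{(x, y)}. \<sigma> u = w)))
          = (\<Sum>\<sigma>\<in>forests (exhaust R). \<Sum>y\<in>?N. of_bool (\<sigma> x = y)) / ?C"
          unfolding forest_mean_def by (subst sum.swap) (simp add: sum_divide_distrib)
        also have "(\<Sum>\<sigma>\<in>forests (exhaust R). \<Sum>y\<in>?N. of_bool (\<sigma> x = y)) = (\<Sum>\<sigma>\<in>forests (exhaust R). 1 :: real)"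
          using forests_nbr elim by (intro sum.cong refl) (simp add: of_bool_def)
        finally show ?case using card_forests_pos[of "exhaust R"] by simp
      qed
      then show "(\<lambda>R. \<Sum>y\<in>?N. forest_mean (exhaust R) (\<lambda>\<sigma>. of_bool (\<forall>(u, w)\<in>{(x, y)}. \<sigma> u = w))) \<longlonglongrightarrow> 1"
        by (rule tendsto_eventually)
    qed
    finally have X1: "(\<integral>F. X F \<partial>W) = 1" .
    have le1: "AE F in W. X F \<le> 1"
      using pairs
    proof eventually_elim
      case (elim F)
      show ?case
      proof (cases "\<exists>y\<in>?N. (x, y) \<in> F")
        case True
        then obtain y where y: "y \<in> ?N" "(x, y) \<in> F" by blast
        then have "X F = (\<Sum>z\<in>?N. of_bool (z = y))"
          unfolding X_def using elim by (intro sum.cong) auto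
        also have "\<dots> = 1" using y by (simp add: of_bool_def)
        finally show ?thesis by simp
      next
        case False
        then have "X F = 0" unfolding X_def by (intro sum.neutral) auto
        then show ?thesis by simp
      qed
    qed
    have "AE F in W. 1 - X F = 0"
    proof (subst integral_nonneg_eq_0_iff_AE[symmetric])
      show "integrable W (\<lambda>F. 1 - X F)" using Xint by simp
      show "AE F in W. 0 \<le> 1 - X F" using le1 by simp
      show "(\<integral>F. 1 - X F \<partial>W) = 0" using Xint X1 by (simp add: W.prob_space)
    qed
    moreover have "AE F in W. F \<subseteq> E" using AE_space by eventually_elim (simp add: space_W)
    ultimately show ?thesis using pairs
    proof eventually_elim
      case (elim F)
      have "\<exists>y\<in>?N. (x, y) \<in> F"
      proof (rule ccontr)
        assume "\<not> ?thesis"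
        then have "X F = 0" unfolding X_def by (intro sum.neutral) auto
        then show False using elim by simp
      qed
      then show ?case using elim by blast
    qed
  qed
  then show ?thesis
    using countable_vertices by (subst AE_ball_countable[of UNIV, simplified]) auto
qed

lemma AE_cfg_of_eq: "AE F in W. cfg_of F = rotor_config_of F \<and> (\<forall>x y. (x, y) \<in> F \<longleftrightarrow> y = cfg_of F x)"
  using AE_outdegree_one
proof eventually_elim
  case (elim F)
  have cfg: "cfg_of F x = (THE y. (x, y) \<in> F)" for x using elim by (simp add: cfg_of_def)
  have edge: "(x, y) \<in> F \<longleftrightarrow> y = (THE y. (x, y) \<in> F)" for x y
  proof -
    have ex: "\<exists>!y. (x, y) \<in> F" using elim by (rule spec)
    show ?thesis
    proof
      show "y = (THE y. (x, y) \<in> F)" if "(x, y) \<in> F"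
        using that by (rule the1_equality[OF ex, symmetric])
      show "(x, y) \<in> F" if "y = (THE y. (x, y) \<in> F)"
        unfolding that by (rule theI'[OF ex])
    qed
  qed
  have "cfg_of F = rotor_config_of F" by (rule ext) (simp only: cfg rotor_config_of_def)
  moreover have "\<forall>x y. (x, y) \<in> F \<longleftrightarrow> y = cfg_of F x" unfolding cfg using edge by (intro allI)
  ultimately show ?case by (rule conjI)
qed

lemma cfg_of_measurable: "cfg_of \<in> measurable W cfg_space"
proof (rule measurable_PiM_single')
  fix x :: 'v
  let ?N = "E `` {x}"
  have ex1: "(\<exists>!y. (x, y) \<in> F) \<longleftrightarrow> (\<exists>y\<in>?N. (x, y) \<in> F \<and> (\<forall>z\<in>?N. (x, z) \<in> F \<longrightarrow> z = y))"
    if "F \<in> space W" for F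
    using that by (auto simp: space_W)
  show "(\<lambda>F. cfg_of F x) \<in> measurable W (count_space ?N)"
  proof (subst measurable_count_space_eq2)
    show "finite ?N" by simp
    show "(\<lambda>F. cfg_of F x) \<in> space W \<rightarrow> ?N \<and> (\<forall>a\<in>?N. (\<lambda>F. cfg_of F x) -` {a} \<inter> space W \<in> sets W)"
    proof (intro conjI ballI)
      show "(\<lambda>F. cfg_of F x) \<in> space W \<rightarrow> ?N" using cfg_of_nbr by (auto simp: space_W)
      fix y assume y: "y \<in> ?N"
      let ?s = "SOME y. y \<in> ?N"
      have "(\<lambda>F. cfg_of F x) -` {y} \<inter> space W = {F\<in>space W. ((x, y) \<in> F \<and> (\<forall>z\<in>?N. (x, z) \<in> F \<longrightarrow> z = y)) \<or>
        (\<not> (\<exists>y\<in>?N. (x, y) \<in> F \<and> (\<forall>z\<in>?N. (x, z) \<in> F \<longrightarrow> z = y)) \<and> y = ?s)}" (is "?L = ?R")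
      proof (rule set_eqI)
        fix F
        show "F \<in> ?L \<longleftrightarrow> F \<in> ?R"
        proof (cases "F \<in> space W \<and> (\<exists>!y. (x, y) \<in> F)")
          case True
          then have F: "F \<in> space W" and ex: "\<exists>!y. (x, y) \<in> F" by (rule conjunct1, rule conjunct2)
          define w where "w = (THE y. (x, y) \<in> F)"
          have w: "(x, w) \<in> F" "\<And>z. (x, z) \<in> F \<Longrightarrow> z = w"
            unfolding w_def by (rule theI'[OF ex], rule the1_equality[OF ex, symmetric])
          have "cfg_of F x = w" unfolding cfg_of_def w_def using ex by (rule if_P)
          moreover have "w \<in> ?N" using F w(1) by (auto simp: space_W)
          moreover have "(x, z) \<in> F \<longleftrightarrow> z = w" for z using w by metis
          ultimately show ?thesis using F by auto
        next
          case False
          show ?thesis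
          proof (cases "F \<in> space W")
            case True
            then have nex: "\<not> (\<exists>!y. (x, y) \<in> F)" using False by blast
            then have "cfg_of F x = ?s" by (simp only: cfg_of_def if_False)
            moreover have "\<not> ((x, y) \<in> F \<and> (\<forall>z\<in>?N. (x, z) \<in> F \<longrightarrow> z = y))"
              using nex ex1[OF True] y by blast
            ultimately show ?thesis using nex ex1[OF True] True by auto
          qed simp
        qed
      qed
      also have "\<dots> \<in> sets W" by measurable
      finally show "?L \<in> sets W" .
    qed
  qed
next
  show "cfg_of \<in> space W \<rightarrow> (\<Pi>\<^sub>E i\<in>UNIV. space (count_space (E `` {i})))"
    using cfg_of_nbr by (auto simp: space_W)
qed

section \<open>The law of the random configuration as a limit over boxes\<close>

definition \<mu> :: "('v \<Rightarrow> 'v) measure" where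
  "\<mu> = distr W cfg_space cfg_of"

lemma sets_\<mu> [simp, measurable_cong]: "sets \<mu> = sets cfg_space"
  by (simp add: \<mu>_def)

lemma space_\<mu>: "space \<mu> = {\<rho>. \<forall>x. \<rho> x \<in> E `` {x}}"
  unfolding \<mu>_def space_distr by (rule space_cfg_space)

sublocale \<mu>: prob_space \<mu>
  unfolding \<mu>_def by (rule W.prob_space_distr[OF cfg_of_measurable])

lemma cylindrical_integrable:
  assumes "cylindrical K (f :: _ \<Rightarrow> real)" and "finite K"
  shows "integrable \<mu> f"
proof (rule \<mu>.integrable_const_bound)
  show "f \<in> borel_measurable \<mu>" using cylindrical_measurable[OF assms] by simp
  show "AE \<rho> in \<mu>. norm (f \<rho>) \<le> (\<Sum>\<eta>\<in>PiE K (\<lambda>x. E `` {x}). \<bar>f \<eta>\<bar>)"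
    using AE_space
  proof eventually_elim
    case (elim \<rho>)
    have "f \<rho> = (\<Sum>\<eta>\<in>PiE K (\<lambda>x. E `` {x}). f \<eta> * of_bool (\<forall>x\<in>K. \<rho> x = \<eta> x))"
      using elim by (intro cylindrical_sum[OF assms]) (auto simp: space_\<mu>)
    then have "norm (f \<rho>) \<le> (\<Sum>\<eta>\<in>PiE K (\<lambda>x. E `` {x}). norm (f \<eta> * of_bool (\<forall>x\<in>K. \<rho> x = \<eta> x)))"
      by (simp only: norm_sum)
    also have "\<dots> \<le> (\<Sum>\<eta>\<in>PiE K (\<lambda>x. E `` {x}). \<bar>f \<eta>\<bar>)"
      by (intro sum_mono) (auto simp: abs_mult)
    finally show ?case .
  qed
qed

text \<open>Both sides are the same finite linear combination of pattern probabilities, and for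
  these convergence is what \<open>is_WSF\<close> asserts.\<close>

lemma forest_mean_tendsto:
  assumes f: "cylindrical K f" and K: "finite K"
  shows "(\<lambda>R. forest_mean (exhaust R) f) \<longlonglongrightarrow> (\<integral>\<rho>. f \<rho> \<partial>\<mu>)"
proof -
  let ?P = "PiE K (\<lambda>x. E `` {x})"
  define B where "B \<eta> = (\<lambda>x. (x, \<eta> x)) ` K" for \<eta> :: "'v \<Rightarrow> 'v"
  have B: "finite (B \<eta>)" "\<eta> \<in> ?P \<Longrightarrow> B \<eta> \<subseteq> E" for \<eta> using K by (auto simp: B_def PiE_def Pi_def)
  have Bev: "{F \<in> space W. B \<eta> \<subseteq> F} \<in> sets W" for \<eta>
  proof -
    have "{F \<in> space W. B \<eta> \<subseteq> F} = {F \<in> space W. \<forall>e\<in>B \<eta>. e \<in> F}" by auto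
    then show ?thesis using B by simp
  qed
  have "(\<lambda>R. \<Sum>\<eta>\<in>?P. f \<eta> * forest_mean (exhaust R) (\<lambda>\<sigma>. of_bool (\<forall>(x, y)\<in>B \<eta>. \<sigma> x = y)))
     \<longlonglongrightarrow> (\<Sum>\<eta>\<in>?P. f \<eta> * measure W {F \<in> space W. B \<eta> \<subseteq> F})"
    using B by (intro tendsto_sum tendsto_mult tendsto_const USF_tendsto) auto
  also have "(\<Sum>\<eta>\<in>?P. f \<eta> * measure W {F \<in> space W. B \<eta> \<subseteq> F}) = (\<integral>\<rho>. f \<rho> \<partial>\<mu>)"
  proof -
    have "(\<integral>\<rho>. f \<rho> \<partial>\<mu>) = (\<integral>F. f (cfg_of F) \<partial>W)"
      unfolding \<mu>_def by (intro integral_distr cfg_of_measurable cylindrical_measurable[OF f K])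
    also have "\<dots> = (\<integral>F. (\<Sum>\<eta>\<in>?P. f \<eta> * indicator {F \<in> space W. B \<eta> \<subseteq> F} F) \<partial>W)"
    proof (intro integral_cong_AE)
      show "(\<lambda>F. f (cfg_of F)) \<in> borel_measurable W"
        by (rule measurable_compose[OF cfg_of_measurable cylindrical_measurable[OF f K]])
      show "(\<lambda>F. \<Sum>\<eta>\<in>?P. f \<eta> * indicator {F \<in> space W. B \<eta> \<subseteq> F} F) \<in> borel_measurable W"
        using Bev by measurable
      show "AE F in W. f (cfg_of F) = (\<Sum>\<eta>\<in>?P. f \<eta> * indicator {F \<in> space W. B \<eta> \<subseteq> F} F)"
        using AE_space AE_cfg_of_eq
      proof eventually_elim
        case (elim F)
        have "f (cfg_of F) = (\<Sum>\<eta>\<in>?P. f \<eta> * of_bool (\<forall>x\<in>K. cfg_of F x = \<eta> x))"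
          using elim cfg_of_nbr by (intro cylindrical_sum[OF f K]) (auto simp: space_W)
        also have "\<dots> = (\<Sum>\<eta>\<in>?P. f \<eta> * indicator {F \<in> space W. B \<eta> \<subseteq> F} F)"
        proof (intro sum.cong refl arg_cong2[where f="(*)"])
          fix \<eta> assume "\<eta> \<in> ?P"
          have "(\<forall>x\<in>K. cfg_of F x = \<eta> x) \<longleftrightarrow> B \<eta> \<subseteq> F" using elim by (auto simp: B_def)
          then show "of_bool (\<forall>x\<in>K. cfg_of F x = \<eta> x) = (indicator {F \<in> space W. B \<eta> \<subseteq> F} F :: real)"
            using elim by (simp add: indicator_def)
        qed
        finally show ?case .
      qed
    qed
    also have "\<dots> = (\<Sum>\<eta>\<in>?P. f \<eta> * measure W {F \<in> space W. B \<eta> \<subseteq> F})"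
      using Bev by (subst Bochner_Integration.integral_sum)
        (auto intro!: integrable_mult_right W.integrable_const_bound[where B=1] arg_cong[where f="measure W"])
    finally show ?thesis ..
  qed
  finally show ?thesis
  proof (rule Lim_transform_eventually)
    \<comment> \<open>In boxes containing \<open>K\<close> the forests have legal rotors on
      \<open>K\<close>, so the pattern expansion applies to them.\<close>
    show "eventually (\<lambda>R. (\<Sum>\<eta>\<in>?P. f \<eta> * forest_mean (exhaust R) (\<lambda>\<sigma>. of_bool (\<forall>(x, y)\<in>B \<eta>. \<sigma> x = y)))
        = forest_mean (exhaust R) f) sequentially"
      using eventually_exhaust[OF K]
    proof eventually_elim
      case (elim R)
      have "(\<Sum>\<sigma>\<in>forests (exhaust R). f \<sigma>) =
          (\<Sum>\<sigma>\<in>forests (exhaust R). \<Sum>\<eta>\<in>?P. f \<eta> * of_bool (\<forall>x\<in>K. \<sigma> x = \<eta> x))"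
        using forests_nbr elim by (intro sum.cong refl cylindrical_sum[OF f K]) blast
      also have "\<dots> = (\<Sum>\<eta>\<in>?P. f \<eta> * (\<Sum>\<sigma>\<in>forests (exhaust R). of_bool (\<forall>x\<in>K. \<sigma> x = \<eta> x)))"
        by (subst sum.swap) (simp add: sum_distrib_left)
      finally show ?case
        unfolding forest_mean_def times_divide_eq_right sum_divide_distrib[symmetric] by (simp add: B_def)
    qed
  qed
qed

end


section \<open>Finite pasts\<close>

lemma leads_funpow: "leads \<sigma> ((\<sigma> ^^ n) u) x \<Longrightarrow> leads \<sigma> u x"
  unfolding leads_def by (metis funpow_add comp_apply)

text \<open>The walk reads only the rotors of the vertices it has stood at.\<close>

lemma walk_agree:
  assumes "\<And>y. y \<in> S \<Longrightarrow> \<sigma>' y = \<sigma> y" and "\<And>s. s < t \<Longrightarrow> walker_at \<tau> a \<sigma> s \<in> S"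
  shows "walker_at \<tau> a \<sigma>' t = walker_at \<tau> a \<sigma> t \<and>
    (\<forall>x. \<sigma>' x = \<sigma> x \<longrightarrow> rotors_at \<tau> a \<sigma>' t x = rotors_at \<tau> a \<sigma> t x)"
  using assms(2)
proof (induction t)
  case (Suc t)
  then have IH: "walker_at \<tau> a \<sigma>' t = walker_at \<tau> a \<sigma> t"
    "\<And>x. \<sigma>' x = \<sigma> x \<Longrightarrow> rotors_at \<tau> a \<sigma>' t x = rotors_at \<tau> a \<sigma> t x" by auto
  let ?w = "walker_at \<tau> a \<sigma> t"
  have "\<sigma>' ?w = \<sigma> ?w" using Suc.prems[of t] by (intro assms(1)) simp
  from IH(2)[OF this] have w: "walker_at \<tau> a \<sigma>' (Suc t) = walker_at \<tau> a \<sigma> (Suc t)"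
    by (simp add: walker_at_Suc IH(1))
  moreover have "rotors_at \<tau> a \<sigma>' (Suc t) x = rotors_at \<tau> a \<sigma> (Suc t) x" if "\<sigma>' x = \<sigma> x" for x
    unfolding rotors_at_Suc w IH(1) using IH(2)[OF that] by simp
  ultimately show ?case by blast
qed simp

text \<open>An infinite past contains, by Koenig's lemma, a backward ray; together with the forward
  orbit it would give two ends.\<close>

lemma finite_past_if_one_ended:
  assumes edges: "\<And>x y. (x, y) \<in> F \<longleftrightarrow> y = \<rho> x"
    and acyclic: "\<And>x n. n > 0 \<Longrightarrow> (\<rho> ^^ n) x \<noteq> x"
    and preds: "\<And>x. finite {w. \<rho> w = x}"
    and one_ended: "all_trees_one_ended F"
  shows "finite {u. leads \<rho> u x}"
proof (rule ccontr)
  define Past where "Past y = {u. leads \<rho> u y}" for y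
  assume "infinite {u. leads \<rho> u x}"
  then have inf: "infinite (Past x)" by (simp add: Past_def)
  have "\<exists>w. \<rho> w = y \<and> infinite (Past w)" if "infinite (Past y)" for y
  proof (rule ccontr)
    assume "\<nexists>w. \<rho> w = y \<and> infinite (Past w)"
    then have "finite (insert y (\<Union>w\<in>{w. \<rho> w = y}. Past w))" using preds by auto
    moreover have "Past y \<subseteq> insert y (\<Union>w\<in>{w. \<rho> w = y}. Past w)"
    proof
      fix u assume "u \<in> Past y"
      then obtain n where n: "(\<rho> ^^ n) u = y" by (auto simp: Past_def leads_def)
      then show "u \<in> insert y (\<Union>w\<in>{w. \<rho> w = y}. Past w)"
        by (cases n) (auto simp: Past_def leads_def)
    qed
    ultimately show False using that finite_subset by blast
  qed
  then obtain q where "q 0 = x" and "\<And>n. infinite (Past (q n)) \<and> \<rho> (q (Suc n)) = q n"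
    using inf dependent_nat_choice[of "\<lambda>n y. infinite (Past y) \<and> (n = 0 \<longrightarrow> y = x)" "\<lambda>n y w. \<rho> w = y"]
    by (metis Zero_not_Suc)
  then have q0: "q 0 = x" and q: "\<And>n. \<rho> (q (Suc n)) = q n" by auto
  define p where "p n = (\<rho> ^^ n) x" for n
  let ?H = "F \<union> F\<inverse>"
  have qp: "(\<rho> ^^ k) (q (i + k)) = q i" for i k
    by (induction k) (simp_all add: funpow_swap1 q)
  have pp: "(\<rho> ^^ k) (p i) = p (i + k)" for i k
    by (simp add: p_def flip: funpow_add[THEN fun_cong, simplified] add: add.commute)
  have inj_p: "inj p"
  proof (rule linorder_injI)
    fix i j :: nat assume "i < j"
    then show "p i \<noteq> p j" using acyclic[of "j - i" "p i"] by (simp add: pp)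
  qed
  have inj_q: "inj q"
  proof (rule linorder_injI)
    fix i j :: nat assume "i < j"
    then show "q i \<noteq> q j" using acyclic[of "j - i" "q j"] qp[of "j - i" i] by auto
  qed
  have p_edge: "(p n, p (Suc n)) \<in> ?H" for n by (simp add: edges p_def)
  have q_edge: "(q n, q (Suc n)) \<in> ?H" for n by (simp add: edges q)
  have p_conn: "(x, p n) \<in> ?H\<^sup>*" for n
  proof (induction n)
    case (Suc n)
    then show ?case using p_edge[of n] by (rule rtrancl_into_rtrancl)
  qed (simp add: p_def)
  have q_conn: "(x, q n) \<in> ?H\<^sup>*" for n
  proof (induction n)
    case (Suc n)
    then show ?case using q_edge[of n] by (rule rtrancl_into_rtrancl)
  qed (simp add: q0)
  have rays: "p \<in> rays_of_component ?H x" "q \<in> rays_of_component ?H x"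
    using inj_p inj_q p_edge q_edge p_conn q_conn by (auto simp: rays_of_component_def)
  define r where "r = {(p, q). p \<in> rays_of_component ?H x \<and> q \<in> rays_of_component ?H x \<and>
        finite (range p - range q) \<and> finite (range q - range p)}"
  have "card (rays_of_component ?H x // r) = 1"
    using one_ended unfolding all_trees_one_ended_def ends_of_component_def r_def by blast
  then obtain C where C: "rays_of_component ?H x // r = {C}" by (auto simp: card_1_singleton_iff)
  have "r `` {p} = C" "r `` {q} = C"
    using quotientI[OF rays(1), of r] quotientI[OF rays(2), of r] C by auto
  moreover have "q \<in> r `` {q}" using rays by (simp add: r_def)
  ultimately have "q \<in> r `` {p}" by simp
  then have "finite (range p - range q)" by (auto simp: r_def)
  \<comment> \<open>Beyond \<open>x\<close> the rays are disjoint: a common vertex leads to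
    \<open>x\<close> because it is on \<open>q\<close> and is reached from \<open>x\<close> because
    it is on \<open>p\<close>, which gives a cycle.\<close>
  moreover have "p ` {1..} \<subseteq> range p - range q"
  proof
    fix z assume "z \<in> p ` {1..}"
    then obtain i where i: "i \<ge> 1" "z = p i" by auto
    have "p i \<noteq> q j" for j
    proof
      assume "p i = q j"
      then have "(\<rho> ^^ j) (p i) = x" using qp[of j 0] q0 by simp
      then have "(\<rho> ^^ (i + j)) x = x" by (simp add: pp) (simp add: p_def)
      then show False using acyclic[of "i + j" x] i by simp
    qed
    then show "z \<in> range p - range q" using i by auto
  qed
  ultimately have "finite (p ` {1..})" by (rule finite_subset[rotated])
  then have "finite {1::nat..}" using inj_p by (subst (asm) finite_image_iff) (auto intro: inj_on_subset)
  then show False by (simp add: infinite_Ici)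
qed

context rotor_graph
begin

lemma cylindrical_of_boolI:
  assumes "\<And>\<rho> \<rho>'. (\<And>x. x \<in> K \<Longrightarrow> \<rho> x \<in> E `` {x}) \<Longrightarrow> (\<And>x. x \<in> K \<Longrightarrow> \<rho>' x = \<rho> x) \<Longrightarrow> P \<rho> \<Longrightarrow> P \<rho>'"
  shows "cylindrical K (\<lambda>\<rho>. of_bool (P \<rho>) :: real)"
  unfolding cylindrical_def
proof (intro allI impI)
  fix \<rho> \<rho>' :: "'v \<Rightarrow> 'v"
  assume *: "\<forall>x\<in>K. \<rho> x \<in> E `` {x} \<and> \<rho>' x = \<rho> x"
  have "P \<rho> \<Longrightarrow> P \<rho>'" using * by (intro assms[of \<rho> \<rho>']) auto
  moreover have "P \<rho>' \<Longrightarrow> P \<rho>" using * by (intro assms[of \<rho>' \<rho>]) auto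
  ultimately have "P \<rho> = P \<rho>'" by blast
  then show "of_bool (P \<rho>) = (of_bool (P \<rho>') :: real)" by simp
qed

lemma cylindrical_pred:
  assumes "cylindrical K (\<lambda>\<rho>. of_bool (P \<rho>) :: real)" and "finite K"
  shows "Measurable.pred cfg_space P"
proof -
  have "(\<lambda>\<rho>. of_bool (P \<rho>) :: real) \<in> borel_measurable cfg_space"
    by (rule cylindrical_measurable[OF assms])
  then have "Measurable.pred cfg_space (\<lambda>\<rho>. of_bool (P \<rho>) = (1 :: real))" by measurable
  then show ?thesis by simp
qed

text \<open>A local substitute for having a vertex outside \<open>B\<close> in the past of
  \<open>y\<close>: only the part of the path after its last vertex outside \<open>B\<close> is
  recorded. This depends on rotors in \<open>B\<close> and its neighbors alone, so its probability
  passes from boxes to the limit.\<close>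

definition enters_from_outside :: "'v set \<Rightarrow> ('v \<Rightarrow> 'v) \<Rightarrow> 'v \<Rightarrow> bool" where
  "enters_from_outside B \<rho> y \<longleftrightarrow>
     (\<exists>u\<in>E `` B - B. \<exists>n. (\<forall>i<n. (\<rho> ^^ Suc i) u \<in> B) \<and> (\<rho> ^^ n) u = y)"

lemma finite_Image_E: "finite B \<Longrightarrow> finite (E `` B)"
proof -
  assume "finite B"
  moreover have "E `` B = (\<Union>x\<in>B. E `` {x})" by auto
  ultimately show ?thesis by simp
qed

lemma cylindrical_enters:
  "cylindrical (B \<union> E `` B) (\<lambda>\<rho>. of_bool (\<exists>y\<in>P. enters_from_outside B \<rho> y) :: real)"
proof (rule cylindrical_of_boolI)
  fix \<rho> \<rho>' assume eq: "\<And>x. x \<in> B \<union> E `` B \<Longrightarrow> \<rho>' x = \<rho> x" and "\<exists>y\<in>P. enters_from_outside B \<rho> y"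
  then obtain y u n where y: "y \<in> P" and u: "u \<in> E `` B - B" and n: "\<And>i. i < n \<Longrightarrow> (\<rho> ^^ Suc i) u \<in> B" "(\<rho> ^^ n) u = y"
    by (auto simp: enters_from_outside_def)
  have K: "(\<rho> ^^ i) u \<in> B \<union> E `` B" if "i < n" for i
    using u n(1)[of "i - 1"] that by (cases i) auto
  have "(\<rho>' ^^ i) u = (\<rho> ^^ i) u" if "i \<le> n" for i
    using that by (intro funpow_agree[where n=n]) (use K eq in blast)+
  then have "(\<forall>i<n. (\<rho>' ^^ Suc i) u \<in> B) \<and> (\<rho>' ^^ n) u = y" using n by (metis Suc_leI order_refl)
  then show "\<exists>y\<in>P. enters_from_outside B \<rho>' y" using y u unfolding enters_from_outside_def by blast
qed

lemma enters_from_outside_leads: "enters_from_outside B \<rho> y \<Longrightarrow> \<exists>u. u \<notin> B \<and> leads \<rho> u y"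
  unfolding enters_from_outside_def leads_def by blast

text \<open>Cut the path at its last vertex outside \<open>B\<close>. The alternative of a
  self-pointing rotor admits forests of a box, whose sink vertices have no legal rotor.\<close>

lemma enters_from_outsideI:
  assumes "leads \<rho> u y" and "y \<in> B" and "u \<notin> B" and nbr: "\<And>w. \<rho> w = w \<or> \<rho> w \<in> E `` {w}"
  shows "enters_from_outside B \<rho> y"
proof -
  obtain n where n: "(\<rho> ^^ n) u = y" using assms by (auto simp: leads_def)
  define k where "k = Max {k. k \<le> n \<and> (\<rho> ^^ k) u \<notin> B}"
  have fin: "finite {k. k \<le> n \<and> (\<rho> ^^ k) u \<notin> B}" by simp
  have "0 \<in> {k. k \<le> n \<and> (\<rho> ^^ k) u \<notin> B}" using assms by simp
  then have "k \<in> {k. k \<le> n \<and> (\<rho> ^^ k) u \<notin> B}" unfolding k_def by (intro Max_in[OF fin]) blast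
  then have k: "k \<le> n" "(\<rho> ^^ k) u \<notin> B" by simp_all
  have k_max: "(\<rho> ^^ i) u \<in> B" if "k < i" "i \<le> n" for i
  proof (rule ccontr)
    assume "(\<rho> ^^ i) u \<notin> B"
    then have "i \<le> k" unfolding k_def using that by (intro Max_ge[OF fin]) simp
    then show False using that by simp
  qed
  have "k < n" using k n \<open>y \<in> B\<close> by (cases "k = n") auto
  let ?w = "(\<rho> ^^ k) u"
  have it: "(\<rho> ^^ i) ?w = (\<rho> ^^ (k + i)) u" for i by (metis add.commute comp_apply funpow_add)
  have "\<rho> ?w \<in> B" using k_max[of "Suc k"] \<open>k < n\<close> by simp
  then have "(\<rho> ?w, ?w) \<in> E" using nbr[of ?w] k sym_E by auto
  then have "?w \<in> E `` B - B" using \<open>\<rho> ?w \<in> B\<close> k by blast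
  moreover have "(\<rho> ^^ Suc i) ?w \<in> B" if "i < n - k" for i
    unfolding it using that by (intro k_max) auto
  moreover have "(\<rho> ^^ (n - k)) ?w = y" unfolding it using k n by simp
  ultimately show ?thesis unfolding enters_from_outside_def by blast
qed

text \<open>If \<^term>\<open>v\<close> is not in the tree rooted at \<^term>\<open>x\<close>, redirecting the rotors along a path from
  \<^term>\<open>x\<close> to \<^term>\<open>v\<close> until it leaves that tree produces a spanning forest in which some vertex of
  the path inherits the far away past of \<^term>\<open>x\<close>.\<close>

lemma card_rooted_far_le:
  assumes A: "finite A" and BA: "B \<subseteq> A" and x: "x \<in> A"
    and f: "\<And>y. y \<noteq> v \<Longrightarrow> f y \<in> E `` {y}"
    and m: "(f ^^ m) x = v" "\<And>i. i < m \<Longrightarrow> (f ^^ i) x \<noteq> v"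
    and P: "P = (\<lambda>i. (f ^^ i) x) ` {..<m}" "P \<subseteq> B"
  shows "card {\<sigma>\<in>rooted A x. (\<exists>u. u \<notin> B \<and> leads \<sigma> u x) \<and> \<not> leads \<sigma> v x}
    \<le> card {\<sigma>\<in>forests A. \<exists>y\<in>P. enters_from_outside B \<sigma> y} * card (PiE P (\<lambda>y. E `` {y}))"
proof -
  let ?p = "\<lambda>i. (f ^^ i) x"
  let ?X = "{\<sigma>\<in>rooted A x. (\<exists>u. u \<notin> B \<and> leads \<sigma> u x) \<and> \<not> leads \<sigma> v x}"
  let ?Y = "{\<sigma>\<in>forests A. \<exists>y\<in>P. enters_from_outside B \<sigma> y}"
  \<comment> \<open>The first index at which the path from \<open>x\<close> is out of the tree
    rooted at \<open>x\<close>; the rotors on the part \<open>S\<close> before it are redirected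
    along the path.\<close>
  define k where "k \<sigma> = (LEAST i. \<not> leads \<sigma> (?p i) x)" for \<sigma>
  define S where "S \<sigma> = ?p ` {..<k \<sigma>}" for \<sigma>
  define \<phi> where "\<phi> \<sigma> = (\<lambda>y. if y \<in> S \<sigma> then f y else \<sigma> y)" for \<sigma>
  have kX: "k \<sigma> \<le> m" "0 < k \<sigma>" "\<not> leads \<sigma> (?p (k \<sigma>)) x" "\<And>i. i < k \<sigma> \<Longrightarrow> leads \<sigma> (?p i) x"
    if "\<sigma> \<in> ?X" for \<sigma>
  proof -
    have nl: "\<not> leads \<sigma> (?p m) x" using that m(1) by simp
    show "k \<sigma> \<le> m" unfolding k_def by (rule Least_le[of "\<lambda>i. \<not> leads \<sigma> (?p i) x", OF nl])
    show k: "\<not> leads \<sigma> (?p (k \<sigma>)) x" unfolding k_def by (rule LeastI[of "\<lambda>i. \<not> leads \<sigma> (?p i) x", OF nl])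
    show "leads \<sigma> (?p i) x" if "i < k \<sigma>" for i
      using not_less_Least[of i "\<lambda>i. \<not> leads \<sigma> (?p i) x"] that by (auto simp: k_def)
    show "0 < k \<sigma>" using k leads_refl[of \<sigma> x] by (cases "k \<sigma>") auto
  qed
  have SP: "S \<sigma> \<subseteq> P" if "\<sigma> \<in> ?X" for \<sigma>
    using kX(1)[OF that] by (auto simp: S_def P(1))
  have \<phi>: "\<phi> \<sigma> \<in> ?Y" if \<sigma>: "\<sigma> \<in> ?X" for \<sigma>
  proof -
    note k = kX[OF \<sigma>]
    have root: "\<sigma> \<in> rooted A x" and cf: "\<sigma> \<in> cfgs A" using \<sigma> by (auto simp: rooted_def)
    have S_leads: "leads \<sigma> y x" if "y \<in> S \<sigma>" for y using that k(4) by (auto simp: S_def)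
    have xS: "x \<in> S \<sigma>" using k(2) by (force simp: S_def)
    have SA: "S \<sigma> \<subseteq> A" using SP[OF \<sigma>] P(2) BA by blast
    have Snv: "y \<noteq> v" if "y \<in> S \<sigma>" for y
    proof -
      from that obtain i where "i < k \<sigma>" "y = ?p i" unfolding S_def by blast
      then show ?thesis using m(2)[of i] k(1) by simp
    qed
    have \<phi>cf: "\<phi> \<sigma> \<in> cfgs A"
      using cf SA f Snv by (auto simp: cfgs_def \<phi>_def)
    \<comment> \<open>All of \<open>S\<close> leads to \<open>x\<close> but the end point of the
      redirected part does not. So its old orbit never meets \<open>S\<close>, is unchanged, and is
      absorbed by the sink.\<close>
    have exit_end: "\<exists>n. (\<phi> \<sigma> ^^ n) (?p (k \<sigma>)) \<notin> A"
    proof -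
      have nS: "(\<sigma> ^^ i) (?p (k \<sigma>)) \<notin> S \<sigma>" for i
        using S_leads leads_funpow[of \<sigma> i "?p (k \<sigma>)" x] k(3) by blast
      obtain n where n: "(\<sigma> ^^ n) (?p (k \<sigma>)) \<in> insert x (- A)" using root by (auto simp: rooted_def)
      have "(\<phi> \<sigma> ^^ n) (?p (k \<sigma>)) = (\<sigma> ^^ n) (?p (k \<sigma>))"
        using nS by (intro funpow_agree[where n=n]) (auto simp: \<phi>_def)
      then show ?thesis using n nS[of n] xS by (intro exI[of _ n]) auto
    qed
    have exit_S: "\<exists>n. (\<phi> \<sigma> ^^ n) y \<notin> A" if "y \<in> S \<sigma>" for y
    proof -
      from that obtain i where i: "i < k \<sigma>" "y = ?p i" unfolding S_def by blast
      have "(\<phi> \<sigma> ^^ j) (?p i) = ?p (i + j)" if "i + j \<le> k \<sigma>" for j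
        using that
      proof (induction j)
        case (Suc j)
        then show ?case by (auto simp: \<phi>_def S_def)
      qed simp
      from this[of "k \<sigma> - i"] have "(\<phi> \<sigma> ^^ (k \<sigma> - i)) y = ?p (k \<sigma>)" using i by simp
      with exit_end obtain n where "(\<phi> \<sigma> ^^ n) ((\<phi> \<sigma> ^^ (k \<sigma> - i)) y) \<notin> A" by auto
      then show ?thesis by (metis comp_apply funpow_add)
    qed
    have hit: "\<exists>n. (\<phi> \<sigma> ^^ n) u \<in> S \<sigma> \<union> - A \<and> (\<phi> \<sigma> ^^ n) u = (\<sigma> ^^ n) u" for u
    proof (rule first_hit_agree)
      show "\<exists>n. (\<sigma> ^^ n) u \<in> S \<sigma> \<union> - A" using root xS by (force simp: rooted_def)
    qed (auto simp: \<phi>_def)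
    have "\<exists>n. (\<phi> \<sigma> ^^ n) u \<notin> A" for u
    proof -
      obtain n where "(\<phi> \<sigma> ^^ n) u \<in> S \<sigma> \<union> - A" using hit by blast
      then show ?thesis using exit_S by (metis Un_iff Compl_iff comp_apply funpow_add)
    qed
    then have forest: "\<phi> \<sigma> \<in> forests A" using \<phi>cf by (auto simp: forests_def)
    obtain u where u: "u \<notin> B" "leads \<sigma> u x" using \<sigma> by blast
    \<comment> \<open>The old orbit of the far vertex reached \<open>x\<close>, which is in
      \<open>S\<close>. The new one agrees with it up to its first vertex in \<open>S\<close>, and
      that vertex inherits the far past.\<close>
    have "\<exists>n. (\<phi> \<sigma> ^^ n) u \<in> S \<sigma>"
    proof -
      have "\<exists>n. (\<sigma> ^^ n) u \<in> S \<sigma>" using u xS by (auto simp: leads_def)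
      from first_hit_agree[OF this, of "\<phi> \<sigma>"] show ?thesis by (auto simp: \<phi>_def)
    qed
    then obtain y where y: "y \<in> S \<sigma>" "leads (\<phi> \<sigma>) u y" by (auto simp: leads_def)
    have "enters_from_outside B (\<phi> \<sigma>) y"
      using y u SP[OF \<sigma>] P(2) \<phi>cf by (intro enters_from_outsideI[of _ u]) (auto simp: cfgs_def)
    then show ?thesis using forest y SP[OF \<sigma>] by blast
  qed
  have finP: "finite P" by (simp add: P(1))
  \<comment> \<open>The redirection changes rotors on \<open>P\<close> only, so remembering the old
    ones there makes it injective. The resulting factor does not depend on \<open>A\<close>.\<close>
  have "card ?X \<le> card (?Y \<times> PiE P (\<lambda>y. E `` {y}))"
  proof (rule card_inj_on_le[where f="\<lambda>\<sigma>. (\<phi> \<sigma>, restrict \<sigma> P)"])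
    show "inj_on (\<lambda>\<sigma>. (\<phi> \<sigma>, restrict \<sigma> P)) ?X"
    proof (rule inj_onI)
      fix \<sigma> \<sigma>' assume *: "\<sigma> \<in> ?X" "\<sigma>' \<in> ?X" "(\<phi> \<sigma>, restrict \<sigma> P) = (\<phi> \<sigma>', restrict \<sigma>' P)"
      have "\<sigma> y = \<sigma>' y" for y
      proof (cases "y \<in> P")
        case True
        then show ?thesis using * by (metis prod.inject restrict_apply')
      next
        case False
        then have "\<phi> \<sigma> y = \<sigma> y" "\<phi> \<sigma>' y = \<sigma>' y" using SP *(1,2) by (auto simp: \<phi>_def)
        then show ?thesis using *(3) by simp
      qed
      then show "\<sigma> = \<sigma>'" by auto
    qed
    show "(\<lambda>\<sigma>. (\<phi> \<sigma>, restrict \<sigma> P)) ` ?X \<subseteq> ?Y \<times> PiE P (\<lambda>y. E `` {y})"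
    proof (rule image_subsetI)
      fix \<sigma> assume \<sigma>: "\<sigma> \<in> ?X"
      have "restrict \<sigma> P \<in> PiE P (\<lambda>y. E `` {y})"
        using \<sigma> P(2) BA by (auto simp: rooted_def cfgs_def)
      with \<phi>[OF \<sigma>] show "(\<phi> \<sigma>, restrict \<sigma> P) \<in> ?Y \<times> PiE P (\<lambda>y. E `` {y})" by blast
    qed
    show "finite (?Y \<times> PiE P (\<lambda>y. E `` {y}))"
      using finite_forests[OF A] finP by (intro finite_cartesian_product finite_PiE) auto
  qed
  then show ?thesis by (simp add: card_cartesian_product)
qed

section \<open>Locality of the walk over a bounded time\<close>

primrec nbhd :: "'v \<Rightarrow> nat \<Rightarrow> 'v set" where
  "nbhd a 0 = {a}"
| "nbhd a (Suc n) = nbhd a n \<union> E `` nbhd a n"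

lemma finite_nbhd [simp]: "finite (nbhd a n)"
  by (induction n) (auto simp: finite_Image_E)

lemma nbhd_mono: "m \<le> n \<Longrightarrow> nbhd a m \<subseteq> nbhd a n"
  by (induction n rule: dec_induct) auto

lemma centre_in_nbhd: "a \<in> nbhd a n"
  using nbhd_mono[of 0 n a] by auto

lemma walker_in_nbhd:
  assumes "\<And>y. y \<in> nbhd a t \<Longrightarrow> \<rho> y \<in> E `` {y}" and "s \<le> t"
  shows "walker_at \<tau> a \<rho> s \<in> nbhd a s"
  using assms(2)
proof (induction s)
  case (Suc s)
  then have w: "walker_at \<tau> a \<rho> s \<in> nbhd a s" by simp
  then have "walker_at \<tau> a \<rho> s \<in> nbhd a t" using nbhd_mono[of s t a] Suc.prems by auto
  then have "walker_at \<tau> a \<rho> (Suc s) \<in> E `` {walker_at \<tau> a \<rho> s}"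
    by (intro walker_at_nbr assms(1))
  then show ?case using w by auto
qed simp

lemma walk_agree_nbhd:
  assumes "\<And>y. y \<in> nbhd a t \<Longrightarrow> \<rho> y \<in> E `` {y}" and "\<And>y. y \<in> nbhd a t \<Longrightarrow> \<rho>' y = \<rho> y" and "s \<le> t"
  shows "walker_at \<tau> a \<rho>' s = walker_at \<tau> a \<rho> s"
    and "\<rho>' x = \<rho> x \<Longrightarrow> rotors_at \<tau> a \<rho>' s x = rotors_at \<tau> a \<rho> s x"
proof -
  have "walker_at \<tau> a \<rho> r \<in> nbhd a t" if "r < s" for r
    using walker_in_nbhd[of a t \<rho> r, OF assms(1)] nbhd_mono[of r t a] that assms(3) by auto
  from walk_agree[of "nbhd a t" \<rho>' \<rho> s \<tau> a, OF assms(2) this]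
  show "walker_at \<tau> a \<rho>' s = walker_at \<tau> a \<rho> s"
    "\<rho>' x = \<rho> x \<Longrightarrow> rotors_at \<tau> a \<rho>' s x = rotors_at \<tau> a \<rho> s x" by auto
qed

text \<open>The exit time from \<open>B\<close> is a function of the rotors on \<open>B\<close>,
  which have finitely many patterns; the sum over all patterns bounds each of their exit
  times.\<close>

lemma uniform_exit_bound:
  assumes B: "finite B"
  shows "\<exists>t0. \<forall>\<sigma>. (\<forall>x\<in>B. \<sigma> x \<in> E `` {x}) \<longrightarrow> (\<exists>s\<le>t0. walker_at \<tau> a \<sigma> s \<notin> B)"
proof -
  let ?P = "PiE B (\<lambda>x. E `` {x})"
  define T where "T \<eta> = (LEAST t. walker_at \<tau> a \<eta> t \<notin> B)" for \<eta>
  have fin: "finite ?P" using B by (intro finite_PiE) auto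
  have "\<exists>s\<le>sum T ?P. walker_at \<tau> a \<sigma> s \<notin> B" if \<sigma>: "\<forall>x\<in>B. \<sigma> x \<in> E `` {x}" for \<sigma>
  proof -
    let ?\<eta> = "restrict \<sigma> B"
    have \<eta>: "?\<eta> \<in> ?P" using \<sigma> by auto
    have "\<exists>t. walker_at \<tau> a ?\<eta> t \<notin> B" using \<sigma> by (intro leaves_finite_set[OF B]) auto
    then have T: "walker_at \<tau> a ?\<eta> (T ?\<eta>) \<notin> B" unfolding T_def by (rule LeastI_ex)
    have "walker_at \<tau> a ?\<eta> s \<in> B" if "s < T ?\<eta>" for s
      using not_less_Least[of s "\<lambda>t. walker_at \<tau> a ?\<eta> t \<notin> B"] that by (auto simp: T_def)
    then have "walker_at \<tau> a \<sigma> (T ?\<eta>) = walker_at \<tau> a ?\<eta> (T ?\<eta>)"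
      using walk_agree[of B \<sigma> ?\<eta> "T ?\<eta>" \<tau> a] by auto
    moreover have "T ?\<eta> \<le> sum T ?P" using fin \<eta> by (intro member_le_sum) auto
    ultimately show ?thesis using T by metis
  qed
  then show ?thesis by blast
qed

lemma exit_time_gt:
  assumes A: "finite A" and "nbhd a t \<subseteq> A" and \<sigma>: "\<sigma> \<in> forests A"
  shows "t < exit_time A a \<sigma>"
proof (rule ccontr)
  assume "\<not> t < exit_time A a \<sigma>"
  then have le: "exit_time A a \<sigma> \<le> t" by simp
  have "walker_at \<tau> a \<sigma> (exit_time A a \<sigma>) \<in> nbhd a (exit_time A a \<sigma>)"
    using forests_nbr[OF \<sigma>] assms(2) le by (intro walker_in_nbhd[of a t]) auto
  then show False using at_exit[OF A \<sigma>, of a] nbhd_mono[OF le, of a] assms(2) by blast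
qed

end

section \<open>Rarity of far pasts\<close>

context wsf_graph
begin

lemma integral_\<mu>:
  assumes "cylindrical K (f :: _ \<Rightarrow> real)" and "finite K"
  shows "(\<integral>\<rho>. f \<rho> \<partial>\<mu>) = (\<integral>F. f (cfg_of F) \<partial>W)"
  unfolding \<mu>_def by (intro integral_distr cfg_of_measurable cylindrical_measurable[OF assms])

text \<open>A given cycle length through a given vertex inside a fixed box is an event of finitely
  many rotors, and forests of larger boxes never satisfy it. Countably many such events cover all
  cycles.\<close>

lemma AE_acyclic: "AE \<rho> in \<mu>. \<forall>x n. n > 0 \<longrightarrow> (\<rho> ^^ n) x \<noteq> x"
proof -
  have 1: "AE \<rho> in \<mu>. \<not> ((\<rho> ^^ n) x = x \<and> (\<forall>i<n. (\<rho> ^^ i) x \<in> exhaust R))" if n: "n > 0" for x n R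
  proof -
    let ?P = "\<lambda>\<rho>. (\<rho> ^^ n) x = x \<and> (\<forall>i<n. (\<rho> ^^ i) x \<in> exhaust R)"
    have cyl: "cylindrical (exhaust R) (\<lambda>\<rho>. of_bool (?P \<rho>) :: real)"
    proof (rule cylindrical_of_boolI)
      fix \<rho> \<rho>' :: "'v \<Rightarrow> 'v" assume eq: "\<And>x. x \<in> exhaust R \<Longrightarrow> \<rho>' x = \<rho> x" and P: "?P \<rho>"
      have "(\<rho>' ^^ i) x = (\<rho> ^^ i) x" if "i \<le> n" for i
        using P that by (intro funpow_agree[where n=n]) (auto intro: eq)
      then show "?P \<rho>'" using P by auto
    qed
    have "eventually (\<lambda>R'. forest_mean (exhaust R') (\<lambda>\<rho>. of_bool (?P \<rho>)) = 0) sequentially"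
      using eventually_ge_at_top[of R]
    proof eventually_elim
      case (elim R')
      have "\<not> ?P \<sigma>" if "\<sigma> \<in> forests (exhaust R')" for \<sigma>
      proof
        assume P: "?P \<sigma>"
        then have "(\<sigma> ^^ 0) x \<in> exhaust R" using n by blast
        then have "x \<in> exhaust R'" using exhaust_mono[OF elim] by auto
        then show False using forests_no_cycle[OF that, of x n] P n by blast
      qed
      then have "(\<Sum>\<sigma>\<in>forests (exhaust R'). of_bool (?P \<sigma>)) = (0 :: real)"
        by (intro sum.neutral) simp
      then show ?case by (simp add: forest_mean_def)
    qed
    then have "(\<lambda>R'. forest_mean (exhaust R') (\<lambda>\<rho>. of_bool (?P \<rho>))) \<longlonglongrightarrow> 0"
      by (rule tendsto_eventually)
    then have "(\<integral>\<rho>. of_bool (?P \<rho>) \<partial>\<mu>) = (0 :: real)"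
      using forest_mean_tendsto[OF cyl finite_exhaust] LIMSEQ_unique by blast
    then have "AE \<rho> in \<mu>. of_bool (?P \<rho>) = (0 :: real)"
      by (subst (asm) integral_nonneg_eq_0_iff_AE) (auto intro: cylindrical_integrable[OF cyl])
    then show ?thesis by simp
  qed
  have "AE \<rho> in \<mu>. \<forall>x\<in>UNIV. \<forall>n R. n > 0 \<longrightarrow> \<not> ((\<rho> ^^ n) x = x \<and> (\<forall>i<n. (\<rho> ^^ i) x \<in> exhaust R))"
    unfolding AE_ball_countable[OF countable_vertices] AE_all_countable
  proof (intro ballI allI)
    show "AE \<rho> in \<mu>. n > 0 \<longrightarrow> \<not> ((\<rho> ^^ n) x = x \<and> (\<forall>i<n. (\<rho> ^^ i) x \<in> exhaust R))" for x n R
      using 1[of n x R] by (cases "n > 0") simp_all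
  qed
  then show ?thesis
  proof eventually_elim
    case (elim \<rho>)
    show ?case
    proof (intro allI impI notI)
      fix x n assume n: "(n :: nat) > 0" and cyc: "(\<rho> ^^ n) x = x"
      have "eventually (\<lambda>R. (\<lambda>i. (\<rho> ^^ i) x) ` {..<n} \<subseteq> exhaust R) sequentially"
        by (rule eventually_exhaust) simp
      then obtain R where "(\<lambda>i. (\<rho> ^^ i) x) ` {..<n} \<subseteq> exhaust R"
        by (auto simp: eventually_sequentially)
      then show False using elim n cyc by blast
    qed
  qed
qed

lemma AE_finite_past: "AE F in W. \<forall>x. finite {u. leads (cfg_of F) u x}"
proof -
  have "AE F in W. \<forall>x n. n > 0 \<longrightarrow> ((cfg_of F) ^^ n) x \<noteq> x"
    by (rule AE_distrD[OF cfg_of_measurable]) (rule AE_acyclic[unfolded \<mu>_def])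
  then show ?thesis using AE_cfg_of_eq one_ended AE_space
  proof eventually_elim
    case (elim F)
    have "finite {w. cfg_of F w = x}" for x
    proof (rule finite_subset)
      show "{w. cfg_of F w = x} \<subseteq> E `` {x}" using elim cfg_of_nbr[of F] sym_E by (auto simp: space_W)
    qed simp
    then show ?case using elim by (intro allI finite_past_if_one_ended[of F "cfg_of F"]) auto
  qed
qed

text \<open>Relative to the number of forests, states whose tree at \<open>x\<close> contains
  \<open>v\<close> make up at most \<epsilon>/2 by \<open>card_states_at_le\<close>. For the others
  the redirection costs a factor \<open>M\<close> fixed by the path to \<open>v\<close>; so
  \<open>B\<close> is chosen after the path, such that a past beyond \<open>B\<close> of some vertex
  of \<open>P\<close> has probability below \<epsilon>/(2M).\<close>

lemma rooted_far_small:
  assumes "\<epsilon> > 0"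
  shows "\<exists>B. finite B \<and> eventually (\<lambda>R. real (card {\<sigma>\<in>rooted (exhaust R) x. \<exists>u. u \<notin> B \<and> leads \<sigma> u x})
    \<le> \<epsilon> * real (card (forests (exhaust R)))) sequentially"
proof -
  obtain v where v: "green x v < \<epsilon> / 2" using green_arbitrarily_small[of "\<epsilon> / 2" x] assms by auto
  have "\<exists>f. (\<forall>y. y \<notin> {v} \<longrightarrow> f y \<in> E `` {y}) \<and> (\<forall>y. \<exists>n. (f ^^ n) y \<in> {v})"
    by (rule exists_leading_function) simp
  then obtain f where f: "\<forall>y. y \<notin> {v} \<longrightarrow> f y \<in> E `` {y}" "\<forall>y. \<exists>n. (f ^^ n) y \<in> {v}"
    by (elim exE conjE)
  define m where "m = (LEAST n. (f ^^ n) x \<in> {v})"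
  have "(f ^^ m) x \<in> {v}" unfolding m_def by (rule LeastI_ex) (rule f(2)[rule_format])
  then have m: "(f ^^ m) x = v" "\<And>i. i < m \<Longrightarrow> (f ^^ i) x \<noteq> v"
    using not_less_Least[of _ "\<lambda>n. (f ^^ n) x \<in> {v}"] by (auto simp: m_def)
  define P where "P = (\<lambda>i. (f ^^ i) x) ` {..<m}"
  have finP: "finite P" by (simp add: P_def)
  define M where "M = real (card (PiE P (\<lambda>y. E `` {y})))"
  have M: "M > 0"
    using finP nbrs_nonempty by (auto simp: M_def card_PiE intro!: prod_pos)
  define D where "D R \<rho> = (of_bool (\<exists>y\<in>P. enters_from_outside (exhaust R) \<rho> y) :: real)" for R \<rho>
  have cyl: "cylindrical (exhaust R \<union> E `` exhaust R) (D R)" for R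
    unfolding D_def by (rule cylindrical_enters)
  have finK: "finite (exhaust R \<union> E `` exhaust R)" for R by (simp add: finite_Image_E)
  \<comment> \<open>Here one-endedness enters: the pasts of the finitely many vertices of
    \<open>P\<close> are finite, hence eventually inside the box.\<close>
  have "(\<lambda>R. \<integral>F. D R (cfg_of F) \<partial>W) \<longlonglongrightarrow> (\<integral>F. 0 \<partial>W)"
  proof (rule integral_dominated_convergence[where w="\<lambda>_. 1"])
    show "(\<lambda>F. D R (cfg_of F)) \<in> borel_measurable W" for R
      by (rule measurable_compose[OF cfg_of_measurable cylindrical_measurable[OF cyl finK]])
    show "AE F in W. (\<lambda>R. D R (cfg_of F)) \<longlonglongrightarrow> 0"
      using AE_finite_past
    proof eventually_elim
      case (elim F)
      have "finite (\<Union>y\<in>P. {u. leads (cfg_of F) u y})" using elim finP by simp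
      from eventually_exhaust[OF this]
      have "eventually (\<lambda>R. D R (cfg_of F) = 0) sequentially"
      proof eventually_elim
        case (elim R)
        have "\<not> enters_from_outside (exhaust R) (cfg_of F) y" if "y \<in> P" for y
          using elim that enters_from_outside_leads by blast
        then show ?case by (simp add: D_def)
      qed
      then show ?case by (rule tendsto_eventually)
    qed
  qed (auto simp: D_def)
  then have "(\<lambda>R. \<integral>\<rho>. D R \<rho> \<partial>\<mu>) \<longlonglongrightarrow> 0" by (simp add: integral_\<mu>[OF cyl finK])
  then have "eventually (\<lambda>R. (\<integral>\<rho>. D R \<rho> \<partial>\<mu>) < \<epsilon> / (2 * M)) sequentially"
    by (rule order_tendstoD) (use assms M in simp)
  moreover have "eventually (\<lambda>R. insert x P \<subseteq> exhaust R) sequentially"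
    using finP by (intro eventually_exhaust) simp
  ultimately have "eventually (\<lambda>R. (\<integral>\<rho>. D R \<rho> \<partial>\<mu>) < \<epsilon> / (2 * M) \<and> insert x P \<subseteq> exhaust R) sequentially"
    by (rule eventually_conj)
  then obtain R0 where R0: "(\<integral>\<rho>. D R0 \<rho> \<partial>\<mu>) < \<epsilon> / (2 * M)" "insert x P \<subseteq> exhaust R0"
    by (auto simp: eventually_sequentially)
  let ?B = "exhaust R0"
  have "eventually (\<lambda>R. forest_mean (exhaust R) (D R0) < \<epsilon> / (2 * M)) sequentially"
    using forest_mean_tendsto[OF cyl finK] R0(1) by (rule order_tendstoD)
  moreover have "eventually (\<lambda>R. insert v ?B \<subseteq> exhaust R) sequentially"
    by (intro eventually_exhaust) simp
  ultimately have "eventually (\<lambda>R. real (card {\<sigma>\<in>rooted (exhaust R) x. \<exists>u. u \<notin> ?B \<and> leads \<sigma> u x})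
    \<le> \<epsilon> * real (card (forests (exhaust R)))) sequentially"
  proof eventually_elim
    case (elim R)
    let ?A = "exhaust R"
    let ?C = "real (card (forests ?A))"
    have C: "?C > 0" using card_forests_pos[of ?A] by simp
    have vx: "v \<in> ?A" "x \<in> ?A" using elim R0 by auto
    let ?X1 = "{\<sigma>\<in>rooted ?A x. leads \<sigma> v x}"
    let ?X2 = "{\<sigma>\<in>rooted ?A x. (\<exists>u. u \<notin> ?B \<and> leads \<sigma> u x) \<and> \<not> leads \<sigma> v x}"
    have "card {\<sigma>\<in>rooted ?A x. \<exists>u. u \<notin> ?B \<and> leads \<sigma> u x} \<le> card (?X1 \<union> ?X2)"
      by (intro card_mono) (auto simp: finite_rooted)
    also have "\<dots> \<le> card ?X1 + card ?X2" by (rule card_Un_le)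
    finally have "real (card {\<sigma>\<in>rooted ?A x. \<exists>u. u \<notin> ?B \<and> leads \<sigma> u x}) \<le> real (card ?X1) + real (card ?X2)"
      by linarith
    moreover have "real (card ?X1) \<le> ?C * (\<epsilon> / 2)"
      using card_states_at_le[of ?A v x] vx mult_left_mono[of "green x v" "\<epsilon> / 2" ?C] v by simp
    moreover have "real (card ?X2) \<le> ?C * (\<epsilon> / 2)"
    proof -
      have "card ?X2 \<le> card {\<sigma>\<in>forests ?A. \<exists>y\<in>P. enters_from_outside ?B \<sigma> y} * card (PiE P (\<lambda>y. E `` {y}))"
        using elim R0 vx f(1) m by (intro card_rooted_far_le[where f=f and m=m and v=v]) (auto simp: P_def)
      then have "real (card ?X2) \<le> real (card {\<sigma>\<in>forests ?A. \<exists>y\<in>P. enters_from_outside ?B \<sigma> y}) * M"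
        unfolding M_def of_nat_mult[symmetric] of_nat_le_iff .
      also have "real (card {\<sigma>\<in>forests ?A. \<exists>y\<in>P. enters_from_outside ?B \<sigma> y}) \<le> ?C * (\<epsilon> / (2 * M))"
      proof -
        have "forest_mean ?A (D R0) = real (card {\<sigma>\<in>forests ?A. \<exists>y\<in>P. enters_from_outside ?B \<sigma> y}) / ?C"
          unfolding D_def by (rule forest_mean_of_bool) simp
        then have "real (card {\<sigma>\<in>forests ?A. \<exists>y\<in>P. enters_from_outside ?B \<sigma> y}) = ?C * forest_mean ?A (D R0)"
          using C by simp
        also have "\<dots> \<le> ?C * (\<epsilon> / (2 * M))" using elim(1) by (intro mult_left_mono) auto
        finally show ?thesis .
      qed
      finally show ?thesis using M by (simp add: mult_right_mono)
    qed
    ultimately show ?case by (simp add: field_simps)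
  qed
  then show ?thesis by (intro exI[of _ ?B]) simp
qed

end


section \<open>Visits and stationarity\<close>

text \<open>The walk is not stopped at \<open>a\<close>. Where the rotors never settle, the initial
  rotor serves as default, so that the map sends legal configurations to legal ones without
  exception.\<close>

definition final_rotors :: "('v \<Rightarrow> 'v \<Rightarrow> 'v) \<Rightarrow> 'v \<Rightarrow> ('v \<Rightarrow> 'v) \<Rightarrow> 'v \<Rightarrow> 'v" where
  "final_rotors \<tau> a \<rho> x =
    (if \<exists>y. eventually (\<lambda>t. rotors_at \<tau> a \<rho> t x = y) sequentially
     then THE y. eventually (\<lambda>t. rotors_at \<tau> a \<rho> t x = y) sequentially else \<rho> x)"

definition visits_before :: "('v \<Rightarrow> 'v \<Rightarrow> 'v) \<Rightarrow> 'v \<Rightarrow> nat \<Rightarrow> ('v \<Rightarrow> 'v) \<Rightarrow> nat" where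
  "visits_before \<tau> a t \<rho> = card {s. s < t \<and> walker_at \<tau> a \<rho> s = a}"

text \<open>An infinite set of visits gives 0 by convention, so this is used only together with
  finiteness, which holds almost surely.\<close>

definition visits :: "('v \<Rightarrow> 'v \<Rightarrow> 'v) \<Rightarrow> 'v \<Rightarrow> ('v \<Rightarrow> 'v) \<Rightarrow> nat" where
  "visits \<tau> a \<rho> = card {s. walker_at \<tau> a \<rho> s = a}"

lemma eventually_const_unique:
  assumes "eventually (\<lambda>t. f t = y) sequentially" and "eventually (\<lambda>t. f t = z) sequentially"
  shows "y = z"
proof -
  have "eventually (\<lambda>t. y = z) sequentially"
    using assms by eventually_elim simp
  then show ?thesis by simp
qed

lemma The_eventually_const:
  assumes "eventually (\<lambda>t. f t = y) sequentially"
  shows "(THE y. eventually (\<lambda>t. f t = y) sequentially) = y"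
  using assms eventually_const_unique by (intro the_equality)

lemma final_rotors_eq:
  "eventually (\<lambda>t. rotors_at \<tau> a \<rho> t x = y) sequentially \<Longrightarrow> final_rotors \<tau> a \<rho> x = y"
  using The_eventually_const[of "\<lambda>t. rotors_at \<tau> a \<rho> t x" y] unfolding final_rotors_def by metis

lemma eventually_rotor_final:
  assumes "finite {t. walker_at \<tau> a \<rho> t = x}"
  shows "eventually (\<lambda>t. rotors_at \<tau> a \<rho> t x = final_rotors \<tau> a \<rho> x) sequentially"
proof -
  obtain t0 where "\<forall>t\<in>{t. walker_at \<tau> a \<rho> t = x}. t < t0"
    using assms unfolding finite_nat_set_iff_bounded by (rule exE)
  then have t0: "\<And>t. walker_at \<tau> a \<rho> t = x \<Longrightarrow> t < t0" by simp
  have "eventually (\<lambda>t. rotors_at \<tau> a \<rho> t x = rotors_at \<tau> a \<rho> t0 x) sequentially"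
    unfolding eventually_sequentially
  proof (intro exI[of _ t0] allI impI)
    fix t assume "t0 \<le> t"
    then show "rotors_at \<tau> a \<rho> t x = rotors_at \<tau> a \<rho> t0 x"
      by (rule rotors_at_unvisited) (use t0 in fastforce)
  qed
  then show ?thesis using final_rotors_eq by metis
qed

lemma visits_before_tendsto:
  assumes "finite {s. walker_at \<tau> a \<rho> s = a}"
  shows "eventually (\<lambda>t. visits_before \<tau> a t \<rho> = visits \<tau> a \<rho>) sequentially"
proof -
  obtain t0 where t0: "\<forall>t\<in>{t. walker_at \<tau> a \<rho> t = a}. t < t0"
    using assms unfolding finite_nat_set_iff_bounded by (rule exE)
  have "{s. s < t \<and> walker_at \<tau> a \<rho> s = a} = {s. walker_at \<tau> a \<rho> s = a}" if "t \<ge> t0" for t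
    using t0 that less_le_trans by blast
  then show ?thesis unfolding eventually_sequentially visits_before_def visits_def by metis
qed

context rotor_graph
begin

lemma cylindrical_visits_before:
  "cylindrical (nbhd a t) (\<lambda>\<rho>. real (visits_before \<tau> a t \<rho>))"
  unfolding cylindrical_def
proof (intro allI impI)
  fix \<rho> \<rho>' :: "'v \<Rightarrow> 'v"
  assume *: "\<forall>x\<in>nbhd a t. \<rho> x \<in> E `` {x} \<and> \<rho>' x = \<rho> x"
  have "walker_at \<tau> a \<rho>' s = walker_at \<tau> a \<rho> s" if "s < t" for s
    using * that by (intro walk_agree_nbhd(1)[of a t]) auto
  then have "{s. s < t \<and> walker_at \<tau> a \<rho> s = a} = {s. s < t \<and> walker_at \<tau> a \<rho>' s = a}" by auto
  then show "real (visits_before \<tau> a t \<rho>) = real (visits_before \<tau> a t \<rho>')"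
    by (simp add: visits_before_def)
qed

lemma cylindrical_rotors_at:
  "cylindrical (nbhd a t \<union> K) (\<lambda>\<rho>. of_bool (\<forall>x\<in>K. rotors_at \<tau> a \<rho> t x \<in> A x) :: real)"
proof (rule cylindrical_of_boolI)
  fix \<rho> \<rho>' assume nbr: "\<And>x. x \<in> nbhd a t \<union> K \<Longrightarrow> \<rho> x \<in> E `` {x}" and eq: "\<And>x. x \<in> nbhd a t \<union> K \<Longrightarrow> \<rho>' x = \<rho> x"
    and P: "\<forall>x\<in>K. rotors_at \<tau> a \<rho> t x \<in> A x"
  have "rotors_at \<tau> a \<rho>' t x = rotors_at \<tau> a \<rho> t x" if "x \<in> K" for x
    using nbr eq that by (intro walk_agree_nbhd(2)[of a t]) auto
  then show "\<forall>x\<in>K. rotors_at \<tau> a \<rho>' t x \<in> A x" using P by simp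
qed

text \<open>Infinitely many visits to one vertex would spread through neighbors to
  \<open>a\<close>.\<close>

lemma finite_visits_everywhere:
  assumes \<rho>: "\<And>x. \<rho> x \<in> E `` {x}" and a: "finite {t. walker_at \<tau> a \<rho> t = a}"
  shows "finite {t. walker_at \<tau> a \<rho> t = x}"
proof (rule ccontr)
  assume "infinite {t. walker_at \<tau> a \<rho> t = x}"
  then have x: "\<exists>\<^sub>\<infinity>t. walker_at \<tau> a \<rho> t = x" by (simp add: INFM_iff_infinite)
  have "\<exists>\<^sub>\<infinity>t. walker_at \<tau> a \<rho> t = y" for y
    using connect[of x y]
  proof (induction rule: rtrancl_induct)
    case (step y z)
    then show ?case by (intro infinitely_often_nbr[OF step(3) \<rho>]) auto
  qed (rule x)
  then show False using a by (metis INFM_iff_infinite)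
qed

lemma final_rotors_nbr:
  assumes "\<And>x. \<rho> x \<in> E `` {x}"
  shows "final_rotors \<tau> a \<rho> x \<in> E `` {x}"
proof (cases "\<exists>y. eventually (\<lambda>t. rotors_at \<tau> a \<rho> t x = y) sequentially")
  case True
  then obtain y where y: "eventually (\<lambda>t. rotors_at \<tau> a \<rho> t x = y) sequentially" by blast
  then obtain t where "rotors_at \<tau> a \<rho> t x = y" by (auto simp: eventually_sequentially)
  then have "y \<in> E `` {x}" using rotors_at_nbr[of \<rho> x a t] assms by auto
  then show ?thesis using final_rotors_eq[OF y] by simp
next
  case False
  then show ?thesis using assms by (simp add: final_rotors_def)
qed

lemma rotors_at_pred:
  "Measurable.pred cfg_space (\<lambda>\<rho>. rotors_at \<tau> a \<rho> t x = y)"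
  using cylindrical_pred[OF cylindrical_rotors_at[of a t "{x}" "\<lambda>_. {y}"]] by simp

lemma final_rotors_measurable: "final_rotors \<tau> a \<in> measurable cfg_space cfg_space"
proof (rule measurable_PiM_single')
  fix x :: 'v
  let ?N = "E `` {x}"
  let ?ev = "\<lambda>\<rho> y. eventually (\<lambda>t. rotors_at \<tau> a \<rho> t x = y) sequentially"
  have [measurable]: "Measurable.pred cfg_space (\<lambda>\<rho>. ?ev \<rho> y)" for y
    unfolding eventually_sequentially using rotors_at_pred by measurable
  have [measurable]: "Measurable.pred cfg_space (\<lambda>\<rho>. \<rho> x = y)" for y
    using measurable_compose[OF cfg_coord_measurable[of x], of "\<lambda>z. z = y" "count_space UNIV"] by simp
  show "(\<lambda>\<rho>. final_rotors \<tau> a \<rho> x) \<in> measurable cfg_space (count_space ?N)"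
  proof (subst measurable_count_space_eq2)
    show "finite ?N" by simp
    show "(\<lambda>\<rho>. final_rotors \<tau> a \<rho> x) \<in> space cfg_space \<rightarrow> ?N \<and>
      (\<forall>y\<in>?N. (\<lambda>\<rho>. final_rotors \<tau> a \<rho> x) -` {y} \<inter> space cfg_space \<in> sets cfg_space)"
    proof (intro conjI ballI funcsetI)
      show "final_rotors \<tau> a \<rho> x \<in> ?N" if "\<rho> \<in> space cfg_space" for \<rho>
        using that by (intro final_rotors_nbr) (auto simp: space_cfg_space)
      fix y assume y: "y \<in> ?N"
      have "(\<lambda>\<rho>. final_rotors \<tau> a \<rho> x) -` {y} \<inter> space cfg_space =
        {\<rho>\<in>space cfg_space. ?ev \<rho> y \<or> ((\<forall>z\<in>?N. \<not> ?ev \<rho> z) \<and> \<rho> x = y)}"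
      proof (intro set_eqI iffI)
        fix \<rho> assume *: "\<rho> \<in> (\<lambda>\<rho>. final_rotors \<tau> a \<rho> x) -` {y} \<inter> space cfg_space"
        show "\<rho> \<in> {\<rho>\<in>space cfg_space. ?ev \<rho> y \<or> ((\<forall>z\<in>?N. \<not> ?ev \<rho> z) \<and> \<rho> x = y)}"
        proof (cases "\<exists>z. ?ev \<rho> z")
          case True
          then obtain z where z: "?ev \<rho> z" by blast
          with final_rotors_eq[OF z] * show ?thesis by auto
        next
          case False
          then have "final_rotors \<tau> a \<rho> x = \<rho> x" by (simp add: final_rotors_def)
          with False * show ?thesis by auto
        qed
      next
        fix \<rho> assume *: "\<rho> \<in> {\<rho>\<in>space cfg_space. ?ev \<rho> y \<or> ((\<forall>z\<in>?N. \<not> ?ev \<rho> z) \<and> \<rho> x = y)}"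
        show "\<rho> \<in> (\<lambda>\<rho>. final_rotors \<tau> a \<rho> x) -` {y} \<inter> space cfg_space"
        proof (cases "\<exists>z. ?ev \<rho> z")
          case True
          then obtain z where z: "?ev \<rho> z" by blast
          then have "final_rotors \<tau> a \<rho> x = z" by (rule final_rotors_eq)
          moreover have "z \<in> ?N"
            using calculation final_rotors_nbr[of \<rho> a x] * by (auto simp: space_cfg_space)
          ultimately show ?thesis using * z final_rotors_eq by auto
        next
          case False
          then have "final_rotors \<tau> a \<rho> x = \<rho> x" by (simp add: final_rotors_def)
          with False * show ?thesis by auto
        qed
      qed
      also have "\<dots> \<in> sets cfg_space" by measurable
      finally show "(\<lambda>\<rho>. final_rotors \<tau> a \<rho> x) -` {y} \<inter> space cfg_space \<in> sets cfg_space" .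
    qed
  qed
next
  show "final_rotors \<tau> a \<in> space cfg_space \<rightarrow> (\<Pi>\<^sub>E i\<in>UNIV. space (count_space (E `` {i})))"
    using final_rotors_nbr by (auto simp: space_cfg_space)
qed

lemma visits_before_measurable [measurable]: "(\<lambda>\<rho>. real (visits_before \<tau> a t \<rho>)) \<in> borel_measurable cfg_space"
  by (rule cylindrical_measurable[OF cylindrical_visits_before]) simp

end

section \<open>Mean number of visits and invariance of the measure\<close>

context wsf_graph
begin

text \<open>In a box containing the ball of radius \<open>t\<close>, the first \<open>t\<close>
  steps precede the exit, so \<open>sum_visits_le\<close> bounds the box average uniformly. Up to a
  fixed time the number of visits is a function of finitely many rotors, so the limit over boxes
  applies.\<close>

lemma integral_visits_before_le: "(\<integral>\<rho>. real (visits_before \<tau> a t \<rho>) \<partial>\<mu>) \<le> green a a"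
proof (rule LIMSEQ_le_const2[OF forest_mean_tendsto[OF cylindrical_visits_before]])
  have "eventually (\<lambda>R. nbhd a t \<subseteq> exhaust R) sequentially" by (intro eventually_exhaust) simp
  then obtain R0 where "\<And>R. R \<ge> R0 \<Longrightarrow> nbhd a t \<subseteq> exhaust R" by (auto simp: eventually_sequentially)
  moreover have "forest_mean (exhaust R) (\<lambda>\<rho>. real (visits_before \<tau> a t \<rho>)) \<le> green a a"
    if "nbhd a t \<subseteq> exhaust R" for R
  proof -
    let ?A = "exhaust R"
    have aA: "a \<in> ?A" using that centre_in_nbhd by blast
    have "forest_mean ?A (\<lambda>\<rho>. real (visits_before \<tau> a t \<rho>))
      \<le> forest_mean ?A (\<lambda>\<sigma>. real (card {s. s < exit_time ?A a \<sigma> \<and> walker_at \<tau> a \<sigma> s = a}))"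
    proof (rule forest_mean_mono)
      fix \<sigma> assume \<sigma>: "\<sigma> \<in> forests ?A"
      have "t < exit_time ?A a \<sigma>" using that \<sigma> by (intro exit_time_gt) auto
      then show "real (visits_before \<tau> a t \<sigma>) \<le> real (card {s. s < exit_time ?A a \<sigma> \<and> walker_at \<tau> a \<sigma> s = a})"
        unfolding visits_before_def of_nat_le_iff by (intro card_mono) auto
    qed
    also have "\<dots> \<le> green a a"
      using sum_visits_le[OF finite_exhaust aA aA] card_forests_pos[of ?A]
      by (simp add: forest_mean_def divide_le_eq mult.commute)
    finally show ?thesis .
  qed
  ultimately show "\<exists>N. \<forall>n\<ge>N. forest_mean (exhaust n) (\<lambda>\<rho>. real (visits_before \<tau> a t \<rho>)) \<le> green a a" by blast
qed simp

lemma nn_integral_visits_le: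
  "(\<integral>\<^sup>+\<rho>. (SUP t. ennreal (real (visits_before \<tau> a t \<rho>))) \<partial>\<mu>) \<le> ennreal (green a a)"
proof -
  have mono: "visits_before \<tau> a s \<rho> \<le> visits_before \<tau> a t \<rho>" if "s \<le> t" for s t \<rho>
    unfolding visits_before_def using that by (intro card_mono) auto
  have "(\<integral>\<^sup>+\<rho>. (SUP t. ennreal (real (visits_before \<tau> a t \<rho>))) \<partial>\<mu>)
    = (SUP t. \<integral>\<^sup>+\<rho>. ennreal (real (visits_before \<tau> a t \<rho>)) \<partial>\<mu>)"
    by (intro nn_integral_monotone_convergence_SUP) (auto simp: incseq_def le_fun_def mono intro!: ennreal_leI)
  also have "\<dots> \<le> ennreal (green a a)"
  proof (rule SUP_least)
    fix t
    have "integrable \<mu> (\<lambda>\<rho>. real (visits_before \<tau> a t \<rho>))"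
      by (rule cylindrical_integrable[OF cylindrical_visits_before]) simp
    then show "(\<integral>\<^sup>+\<rho>. ennreal (real (visits_before \<tau> a t \<rho>)) \<partial>\<mu>) \<le> ennreal (green a a)"
      using integral_visits_before_le[of a t] by (subst nn_integral_eq_integral) (auto intro: ennreal_leI)
  qed
  finally show ?thesis .
qed

text \<open>A visit count with finite mean is finite almost surely, so the rotor walk is transient
  for almost every configuration.\<close>

lemma AE_finite_visits: "AE \<rho> in \<mu>. finite {t. walker_at \<tau> a \<rho> t = a}"
proof -
  have "AE \<rho> in \<mu>. (SUP t. ennreal (real (visits_before \<tau> a t \<rho>))) \<noteq> \<infinity>"
  proof (rule nn_integral_PInf_AE)
    show "(\<integral>\<^sup>+\<rho>. (SUP t. ennreal (real (visits_before \<tau> a t \<rho>))) \<partial>\<mu>) \<noteq> \<infinity>"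
      using nn_integral_visits_le[of a] by (auto simp: top_unique)
  qed measurable
  then show ?thesis
  proof eventually_elim
    case (elim \<rho>)
    let ?S = "{t. walker_at \<tau> a \<rho> t = a}"
    show ?case
    proof (rule ccontr)
      assume inf: "infinite ?S"
      obtain c where c: "(SUP t. ennreal (real (visits_before \<tau> a t \<rho>))) = ennreal c" "0 \<le> c"
        using elim by (cases "SUP t. ennreal (real (visits_before \<tau> a t \<rho>))") auto
      obtain n :: nat where n: "c < real n" using reals_Archimedean2 by blast
      obtain F where F: "F \<subseteq> ?S" "finite F" "card F = n"
        using infinite_arbitrarily_large[OF inf] by blast
      obtain t where t: "\<And>s. s \<in> F \<Longrightarrow> s < t" using F(2) by (metis finite_nat_set_iff_bounded)
      have "n \<le> visits_before \<tau> a t \<rho>"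
        unfolding visits_before_def F(3)[symmetric] using F t by (intro card_mono) auto
      then have "ennreal (real n) \<le> ennreal (real (visits_before \<tau> a t \<rho>))" by (intro ennreal_leI) simp
      also have "\<dots> \<le> ennreal c" unfolding c(1)[symmetric] by (rule SUP_upper) simp
      finally show False using n c by (simp add: ennreal_le_iff)
    qed
  qed
qed

text \<open>The limit of the truncated counts serves as a measurable version of
  \<open>visits\<close>.\<close>

lemma visits_integrable_le:
  "integrable \<mu> (\<lambda>\<rho>. lim (\<lambda>t. real (visits_before \<tau> a t \<rho>)))"
  "(\<integral>\<rho>. lim (\<lambda>t. real (visits_before \<tau> a t \<rho>)) \<partial>\<mu>) \<le> green a a"
  "AE \<rho> in \<mu>. lim (\<lambda>t. real (visits_before \<tau> a t \<rho>)) = real (visits \<tau> a \<rho>)"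
proof -
  let ?f = "\<lambda>\<rho>. lim (\<lambda>t. real (visits_before \<tau> a t \<rho>))"
  have meas: "?f \<in> borel_measurable \<mu>" by measurable
  have eq: "AE \<rho> in \<mu>. ?f \<rho> = real (visits \<tau> a \<rho>) \<and>
    (SUP t. ennreal (real (visits_before \<tau> a t \<rho>))) = ennreal (real (visits \<tau> a \<rho>))"
    using AE_finite_visits[of a]
  proof eventually_elim
    case (elim \<rho>)
    from visits_before_tendsto[OF elim]
    have "(\<lambda>t. real (visits_before \<tau> a t \<rho>)) \<longlonglongrightarrow> real (visits \<tau> a \<rho>)"
      by (intro tendsto_eventually) (auto elim: eventually_mono)
    moreover have "(SUP t. ennreal (real (visits_before \<tau> a t \<rho>))) = ennreal (real (visits \<tau> a \<rho>))"
    proof (rule antisym)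
      show "(SUP t. ennreal (real (visits_before \<tau> a t \<rho>))) \<le> ennreal (real (visits \<tau> a \<rho>))"
        unfolding visits_before_def visits_def using elim
        by (intro SUP_least ennreal_leI) (auto intro!: card_mono)
      obtain t where "visits_before \<tau> a t \<rho> = visits \<tau> a \<rho>"
        using visits_before_tendsto[OF elim] by (auto simp: eventually_sequentially)
      then show "ennreal (real (visits \<tau> a \<rho>)) \<le> (SUP t. ennreal (real (visits_before \<tau> a t \<rho>)))"
        by (metis SUP_upper UNIV_I)
    qed
    ultimately show ?case by (simp add: limI)
  qed
  then show "AE \<rho> in \<mu>. ?f \<rho> = real (visits \<tau> a \<rho>)" by eventually_elim simp
  have "(\<integral>\<^sup>+\<rho>. ennreal (norm (?f \<rho>)) \<partial>\<mu>) = (\<integral>\<^sup>+\<rho>. (SUP t. ennreal (real (visits_before \<tau> a t \<rho>))) \<partial>\<mu>)"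
    using eq by (intro nn_integral_cong_AE) (auto elim: eventually_mono)
  also note nn_integral_visits_le
  finally have le: "(\<integral>\<^sup>+\<rho>. ennreal (norm (?f \<rho>)) \<partial>\<mu>) \<le> ennreal (green a a)" .
  then show int: "integrable \<mu> ?f"
    using meas by (auto simp: integrable_iff_bounded less_top top_unique intro: le_less_trans)
  have nn: "AE \<rho> in \<mu>. 0 \<le> ?f \<rho>" using eq by eventually_elim simp
  have "ennreal (\<integral>\<rho>. ?f \<rho> \<partial>\<mu>) = (\<integral>\<^sup>+\<rho>. ennreal (?f \<rho>) \<partial>\<mu>)"
    using nn_integral_eq_integral[OF int nn] by simp
  also have "\<dots> = (\<integral>\<^sup>+\<rho>. ennreal (norm (?f \<rho>)) \<partial>\<mu>)"
    using nn by (intro nn_integral_cong_AE) (auto elim: eventually_mono)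
  finally have "ennreal (\<integral>\<rho>. ?f \<rho> \<partial>\<mu>) \<le> ennreal (green a a)"
    using le by (simp only:)
  then show "(\<integral>\<rho>. ?f \<rho> \<partial>\<mu>) \<le> green a a"
    by (simp only: ennreal_le_iff[OF green_nonneg])
qed

text \<open>By the time \<open>t\<close> the walk has left a large set \<open>B x\<close> for each
  \<open>x\<close> in \<open>K\<close>. In every large box a visit to \<open>x\<close> after that
  has small probability, uniformly in the box; without such a visit the rotors on \<open>K\<close>
  are already those at exit, whose law is uniform again. The limit over boxes is taken first, then
  the one over \<open>t\<close>.\<close>

lemma rotors_at_asymptotically_stationary:
  fixes S :: "'v \<Rightarrow> 'v set" and a :: 'v
  assumes K: "finite K"
  defines "f \<equiv> \<lambda>t \<rho>. of_bool (\<forall>x\<in>K. rotors_at \<tau> a \<rho> t x \<in> S x) :: real"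
  shows "(\<lambda>t. \<integral>\<rho>. f t \<rho> \<partial>\<mu>) \<longlonglongrightarrow> (\<integral>\<rho>. f 0 \<rho> \<partial>\<mu>)"
proof (rule LIMSEQ_I)
  fix r :: real assume r: "r > 0"
  \<comment> \<open>An equal share for every vertex of \<open>K\<close>; the added 1 covers empty
    \<open>K\<close>.\<close>
  define \<epsilon> where "\<epsilon> = r / (2 * (real (card K) + 1))"
  have \<epsilon>: "\<epsilon> > 0" using r by (simp add: \<epsilon>_def add_nonneg_pos)
  have K\<epsilon>: "real (card K) * \<epsilon> < r"
  proof -
    have "real (card K) * \<epsilon> = r * (real (card K) / (2 * (real (card K) + 1)))" by (simp add: \<epsilon>_def)
    also have "\<dots> < r * 1"
      using r by (intro mult_strict_left_mono) (auto simp: divide_less_eq add_nonneg_pos)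
    finally show ?thesis by simp
  qed
  define far where "far x B R \<longleftrightarrow> real (card {\<sigma>\<in>rooted (exhaust R) x. \<exists>u. u \<notin> B \<and> leads \<sigma> u x})
    \<le> \<epsilon> * real (card (forests (exhaust R)))" for x B R
  have "\<forall>x. \<exists>B. finite B \<and> eventually (\<lambda>R. far x B R) sequentially"
    unfolding far_def using rooted_far_small[OF \<epsilon>] by blast
  then obtain B where B: "\<And>x. finite (B x)" "\<And>x. eventually (\<lambda>R. far x (B x) R) sequentially" by metis
  have "\<forall>x. \<exists>t0. \<forall>\<sigma>. (\<forall>y\<in>B x. \<sigma> y \<in> E `` {y}) \<longrightarrow> (\<exists>s\<le>t0. walker_at \<tau> a \<sigma> s \<notin> B x)"
    using uniform_exit_bound[OF B(1)] by blast
  then obtain T where T: "\<And>x \<sigma>. (\<forall>y\<in>B x. \<sigma> y \<in> E `` {y}) \<Longrightarrow> \<exists>s\<le>T x. walker_at \<tau> a \<sigma> s \<notin> B x" by metis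
  show "\<exists>no. \<forall>t\<ge>no. norm ((\<integral>\<rho>. f t \<rho> \<partial>\<mu>) - (\<integral>\<rho>. f 0 \<rho> \<partial>\<mu>)) < r"
  proof (intro exI allI impI)
    fix t assume t: "t \<ge> sum T K"
    have Tt: "T x \<le> t" if "x \<in> K" for x using member_le_sum[of x K T] K that t by simp
    have cyl: "cylindrical (nbhd a t \<union> K) (f t)" "cylindrical (nbhd a 0 \<union> K) (f 0)"
      unfolding f_def by (rule cylindrical_rotors_at)+
    have lim: "(\<lambda>R. \<bar>forest_mean (exhaust R) (f t) - forest_mean (exhaust R) (f 0)\<bar>)
        \<longlonglongrightarrow> \<bar>(\<integral>\<rho>. f t \<rho> \<partial>\<mu>) - (\<integral>\<rho>. f 0 \<rho> \<partial>\<mu>)\<bar>"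
      using K by (intro tendsto_rabs tendsto_diff forest_mean_tendsto[OF cyl(1)] forest_mean_tendsto[OF cyl(2)]) auto
    have "eventually (\<lambda>R. nbhd a t \<union> K \<union> (\<Union>x\<in>K. B x) \<subseteq> exhaust R) sequentially"
      using K B by (intro eventually_exhaust) auto
    moreover have "eventually (\<lambda>R. \<forall>x\<in>K. far x (B x) R) sequentially"
      using K B by (intro eventually_ball_finite) auto
    ultimately have "eventually (\<lambda>R. \<bar>forest_mean (exhaust R) (f t) - forest_mean (exhaust R) (f 0)\<bar> \<le> real (card K) * \<epsilon>) sequentially"
    proof eventually_elim
      case (elim R)
      let ?A = "exhaust R"
      let ?C = "real (card (forests ?A))"
      have C: "?C > 0" using card_forests_pos[of ?A] by simp
      have aA: "a \<in> ?A" using elim(1) centre_in_nbhd[of a t] by blast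
      let ?L = "\<lambda>x. {\<sigma>\<in>forests ?A. \<exists>t'. t \<le> t' \<and> t' < exit_time ?A a \<sigma> \<and> walker_at \<tau> a \<sigma> t' = x}"
      have bij: "bij_betw (exit_rotors ?A a) (forests ?A) (forests ?A)"
        using aA by (intro bij_exit_rotors) auto
      \<comment> \<open>Invariance under \<open>exit_rotors\<close> replaces the initial rotors by
        those at exit, which differ on \<open>K\<close> from the rotors at time \<open>t\<close>
        only through a visit to \<open>K\<close> at time \<open>t\<close> or later.\<close>
      have "(\<Sum>\<sigma>\<in>forests ?A. f 0 (exit_rotors ?A a \<sigma>)) = (\<Sum>\<sigma>\<in>forests ?A. f 0 \<sigma>)"
        by (rule sum.reindex_bij_betw[OF bij])
      then have "\<bar>(\<Sum>\<sigma>\<in>forests ?A. f t \<sigma>) - (\<Sum>\<sigma>\<in>forests ?A. f 0 \<sigma>)\<bar>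
        = \<bar>\<Sum>\<sigma>\<in>forests ?A. f t \<sigma> - f 0 (exit_rotors ?A a \<sigma>)\<bar>" by (simp add: sum_subtractf)
      also have "\<dots> \<le> (\<Sum>\<sigma>\<in>forests ?A. \<bar>f t \<sigma> - f 0 (exit_rotors ?A a \<sigma>)\<bar>)" by (rule sum_abs)
      also have "\<dots> \<le> (\<Sum>\<sigma>\<in>forests ?A. \<Sum>x\<in>K. of_bool (\<sigma> \<in> ?L x))"
      proof (rule sum_mono)
        fix \<sigma> assume \<sigma>: "\<sigma> \<in> forests ?A"
        show "\<bar>f t \<sigma> - f 0 (exit_rotors ?A a \<sigma>)\<bar> \<le> (\<Sum>x\<in>K. of_bool (\<sigma> \<in> ?L x))"
        proof (cases "\<exists>x\<in>K. \<sigma> \<in> ?L x")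
          case True
          then obtain x where x: "x \<in> K" "\<sigma> \<in> ?L x" by blast
          have "1 = (of_bool (\<sigma> \<in> ?L x) :: real)" using x by simp
          also have "\<dots> \<le> (\<Sum>x\<in>K. of_bool (\<sigma> \<in> ?L x))" using x K by (intro member_le_sum) auto
          finally show ?thesis by (auto simp: f_def)
        next
          case False
          have "t < exit_time ?A a \<sigma>" using elim(1) \<sigma> by (intro exit_time_gt) auto
          then have "exit_rotors ?A a \<sigma> x = rotors_at \<tau> a \<sigma> t x" if "x \<in> K" for x
            unfolding exit_rotors_def using False \<sigma> that by (intro rotors_at_unvisited) auto
          then have "f t \<sigma> = f 0 (exit_rotors ?A a \<sigma>)" by (simp add: f_def)
          then show ?thesis by (simp add: sum_nonneg)
        qed
      qed
      also have "\<dots> = (\<Sum>x\<in>K. real (card (?L x)))"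
        using finite_forests[OF finite_exhaust[of R]]
        by (subst sum.swap) (auto simp: of_bool_def sum.If_cases Int_def intro!: sum.cong arg_cong[where f=card])
      also have "\<dots> \<le> (\<Sum>x\<in>K. \<epsilon> * ?C)"
      proof (rule sum_mono)
        fix x assume x: "x \<in> K"
        have "card (?L x) \<le> card {\<sigma>\<in>rooted ?A x. \<exists>u. u \<notin> B x \<and> leads \<sigma> u x}"
        proof (rule card_late_visits_le)
          fix \<sigma> assume \<sigma>: "\<sigma> \<in> forests ?A"
          have "\<forall>y\<in>B x. \<sigma> y \<in> E `` {y}" using forests_nbr[OF \<sigma>] elim(1) x by blast
          from T[OF this] show "\<exists>s\<le>t. walker_at \<tau> a \<sigma> s \<notin> B x" using Tt[OF x] order_trans by blast
        qed (use elim(1) x aA in auto)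
        then show "real (card (?L x)) \<le> \<epsilon> * ?C" using elim(2) x unfolding far_def by (meson of_nat_mono order_trans)
      qed
      also have "\<dots> = real (card K) * \<epsilon> * ?C" by simp
      finally show ?case
        using C unfolding forest_mean_def by (simp add: diff_divide_distrib[symmetric] divide_le_eq)
    qed
    then have "\<bar>(\<integral>\<rho>. f t \<rho> \<partial>\<mu>) - (\<integral>\<rho>. f 0 \<rho> \<partial>\<mu>)\<bar> \<le> real (card K) * \<epsilon>"
      by (intro tendsto_upperbound[OF lim]) auto
    then show "norm ((\<integral>\<rho>. f t \<rho> \<partial>\<mu>) - (\<integral>\<rho>. f 0 \<rho> \<partial>\<mu>)) < r" using K\<epsilon> by simp
  qed
qed

text \<open>Events of finitely many rotors determine the measure. For these, almost surely the
  rotors settle in finite time, so bounded convergence identifies the limit of the laws at time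
  \<open>t\<close> with the law of the final rotors.\<close>

lemma final_rotors_stationary: "distr \<mu> cfg_space (final_rotors \<tau> a) = \<mu>"
proof (rule measure_eqI_PiM_infinite[symmetric])
  show "sets \<mu> = sets cfg_space" by simp
  show "sets (distr \<mu> cfg_space (final_rotors \<tau> a)) = sets cfg_space" by simp
  show "finite_measure \<mu>" by (rule \<mu>.finite_measure_axioms)
  have final: "final_rotors \<tau> a \<in> measurable \<mu> cfg_space"
    using final_rotors_measurable by (simp cong: measurable_cong_sets)
  fix S :: "'v \<Rightarrow> 'v set" and K :: "'v set"
  assume K: "finite K" and S: "\<And>x. x \<in> K \<Longrightarrow> S x \<in> sets (count_space (E `` {x}))"
  let ?X = "prod_emb UNIV (\<lambda>x. count_space (E `` {x})) K (Pi\<^sub>E K S)"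
  let ?f = "\<lambda>t \<rho>. of_bool (\<forall>x\<in>K. rotors_at \<tau> a \<rho> t x \<in> S x) :: real"
  let ?g = "\<lambda>\<rho>. of_bool (\<forall>x\<in>K. final_rotors \<tau> a \<rho> x \<in> S x) :: real"
  have X: "?X \<in> sets cfg_space" using K S by (intro sets_PiM_I) auto
  have mem: "\<rho> \<in> ?X \<longleftrightarrow> (\<forall>x\<in>K. \<rho> x \<in> S x)" if "\<rho> \<in> space cfg_space" for \<rho>
    using that by (auto simp: prod_emb_def space_cfg_space PiE_iff)
  have f_meas: "?f t \<in> borel_measurable \<mu>" for t
    using cylindrical_measurable[OF cylindrical_rotors_at[of a t K S]] K by simp
  have "(\<lambda>t. \<integral>\<rho>. ?f t \<rho> \<partial>\<mu>) \<longlonglongrightarrow> (\<integral>\<rho>. ?g \<rho> \<partial>\<mu>)"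
  proof (rule integral_dominated_convergence[where w="\<lambda>_. 1"])
    show "?g \<in> borel_measurable \<mu>"
    proof -
      have "Measurable.pred \<mu> (\<lambda>\<rho>. final_rotors \<tau> a \<rho> \<in> ?X)"
        using measurable_sets[OF final X] by (simp add: pred_def vimage_def Int_def conj_commute)
      then have "(\<lambda>\<rho>. of_bool (final_rotors \<tau> a \<rho> \<in> ?X) :: real) \<in> borel_measurable \<mu>" by measurable
      then show ?thesis
        by (rule measurable_cong[THEN iffD1, rotated])
          (use mem measurable_space[OF final] in simp)
    qed
    show "AE \<rho> in \<mu>. (\<lambda>t. ?f t \<rho>) \<longlonglongrightarrow> ?g \<rho>"
      using AE_finite_visits[of a] AE_space
    proof eventually_elim
      case (elim \<rho>)
      have "\<rho> x \<in> E `` {x}" for x using elim(2) by (simp add: space_\<mu>)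
      then have fin: "finite {t. walker_at \<tau> a \<rho> t = x}" for x
        using elim(1) by (rule finite_visits_everywhere)
      have "eventually (\<lambda>t. \<forall>x\<in>K. rotors_at \<tau> a \<rho> t x = final_rotors \<tau> a \<rho> x) sequentially"
        using K eventually_rotor_final[OF fin] by (intro eventually_ball_finite) auto
      then show ?case
        by (intro tendsto_eventually) (auto elim!: eventually_mono)
    qed
  qed (use f_meas in auto)
  then have "(\<integral>\<rho>. ?g \<rho> \<partial>\<mu>) = (\<integral>\<rho>. ?f 0 \<rho> \<partial>\<mu>)"
    using rotors_at_asymptotically_stationary[OF K, of a S] LIMSEQ_unique by blast
  also have "(\<integral>\<rho>. ?f 0 \<rho> \<partial>\<mu>) = (\<integral>\<rho>. indicator ?X \<rho> \<partial>\<mu>)"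
    using mem by (intro Bochner_Integration.integral_cong refl) (auto simp: space_\<mu> space_cfg_space indicator_def)
  also have "\<dots> = measure \<mu> ?X"
    using X sets.sets_into_space[OF X] by (simp add: space_\<mu> space_cfg_space Int_absorb2)
  also have "(\<integral>\<rho>. ?g \<rho> \<partial>\<mu>) = (\<integral>\<rho>. indicator (final_rotors \<tau> a -` ?X \<inter> space \<mu>) \<rho> \<partial>\<mu>)"
    using mem measurable_space[OF final]
    by (intro Bochner_Integration.integral_cong refl) (auto simp: indicator_def)
  also have "\<dots> = measure (distr \<mu> cfg_space (final_rotors \<tau> a)) ?X"
    using X final by (simp add: measure_distr)
  finally have eq: "measure (distr \<mu> cfg_space (final_rotors \<tau> a)) ?X = measure \<mu> ?X" .
  interpret d: prob_space "distr \<mu> cfg_space (final_rotors \<tau> a)"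
    by (rule \<mu>.prob_space_distr[OF final])
  show "emeasure \<mu> ?X = emeasure (distr \<mu> cfg_space (final_rotors \<tau> a)) ?X"
    using eq by (simp add: \<mu>.emeasure_eq_measure d.emeasure_eq_measure)
qed

end


section \<open>A pointwise ergodic theorem from one-sided bounds\<close>

locale mpt = prob_space M for M :: "'x measure" +
  fixes T :: "'x \<Rightarrow> 'x"
  assumes T_measurable [measurable]: "T \<in> measurable M M" and T_stationary: "distr M M T = M"
begin

lemma iterate_measurable [measurable]: "(T ^^ i) \<in> measurable M M"
  by (induction i) (auto intro: measurable_comp)

lemma distr_iterate: "distr M M (T ^^ i) = M"
proof (induction i)
  case (Suc i)
  have "distr M M (T ^^ Suc i) = distr (distr M M (T ^^ i)) M T"
    by (simp add: distr_distr comp_def)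
  then show ?case by (simp only: Suc T_stationary)
qed (simp add: distr_id2 id_def)

lemma AE_iterate:
  assumes "AE x in M. P x"
  shows "AE x in M. P ((T ^^ i) x)"
proof (rule AE_distrD[OF iterate_measurable])
  show "AE x in distr M M (T ^^ i). P x" using assms by (simp only: distr_iterate)
qed

lemma iterate_integral:
  assumes "(f :: 'x \<Rightarrow> real) \<in> borel_measurable M"
  shows "(\<integral>x. f ((T ^^ i) x) \<partial>M) = (\<integral>x. f x \<partial>M)"
  using integral_distr[OF iterate_measurable[of i] assms] by (simp add: distr_iterate)

lemma iterate_integrable:
  assumes "integrable M (f :: 'x \<Rightarrow> real)"
  shows "integrable M (\<lambda>x. f ((T ^^ i) x))"
  using integrable_distr[OF iterate_measurable[of i], of f] assms by (simp add: distr_iterate)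

text \<open>The largest of the orbit sums of lengths 0 to \<open>n\<close>, written as the recursion
  on which Garsia's inequality rests.\<close>

primrec max_sum :: "('x \<Rightarrow> real) \<Rightarrow> nat \<Rightarrow> 'x \<Rightarrow> real" where
  "max_sum g 0 = (\<lambda>x. 0)"
| "max_sum g (Suc n) = (\<lambda>x. max 0 (g x + max_sum g n (T x)))"

lemma max_sum_nonneg: "0 \<le> max_sum g n x"
  by (cases n) auto

lemma max_sum_mono_Suc: "max_sum g n x \<le> max_sum g (Suc n) x"
proof (induction n arbitrary: x)
  case (Suc n)
  from Suc[of "T x"] show ?case by auto
qed simp

lemma sum_le_max_sum: "(\<Sum>i<n. g ((T ^^ i) x)) \<le> max_sum g n x"
proof (induction n arbitrary: x)
  case (Suc n)
  have "(\<Sum>i<Suc n. g ((T ^^ i) x)) = g x + (\<Sum>i<n. g ((T ^^ i) (T x)))"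
    by (subst sum.lessThan_Suc_shift) (simp add: funpow_swap1)
  then show ?case using Suc[of "T x"] by simp
qed simp

lemma max_sum_integrable:
  assumes "integrable M g"
  shows "integrable M (max_sum g n)"
proof (induction n)
  case (Suc n)
  then show ?case using assms iterate_integrable[of "max_sum g n" 1] by simp
qed simp

text \<open>Garsia's argument for the maximal ergodic theorem.\<close>

lemma max_sum_integral_nonneg:
  assumes g: "integrable M g"
  shows "0 \<le> (\<integral>x. g x * indicator {x. max_sum g (Suc n) x > 0} x \<partial>M)"
proof -
  note [measurable] = borel_measurable_integrable[OF g]
    borel_measurable_integrable[OF max_sum_integrable[OF g]]
  have intT: "integrable M (\<lambda>x. max_sum g n (T x))"
    using iterate_integrable[OF max_sum_integrable[OF g, of n], of 1] by simp
  have "0 \<le> (\<integral>x. max_sum g (Suc n) x \<partial>M) - (\<integral>x. max_sum g n x \<partial>M)"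
    using integral_mono[OF max_sum_integrable[OF g] max_sum_integrable[OF g] max_sum_mono_Suc, of n]
    by simp
  also have "(\<integral>x. max_sum g n x \<partial>M) = (\<integral>x. max_sum g n (T x) \<partial>M)"
    using iterate_integral[of "max_sum g n" 1] by simp
  also have "(\<integral>x. max_sum g (Suc n) x \<partial>M) - (\<integral>x. max_sum g n (T x) \<partial>M)
      = (\<integral>x. max_sum g (Suc n) x - max_sum g n (T x) \<partial>M)"
    using max_sum_integrable[OF g, of "Suc n"] intT by (subst Bochner_Integration.integral_diff) simp_all
  also have "\<dots> \<le> (\<integral>x. g x * indicator {x. max_sum g (Suc n) x > 0} x \<partial>M)"
  proof (rule integral_mono)
    show "integrable M (\<lambda>x. max_sum g (Suc n) x - max_sum g n (T x))"
      using max_sum_integrable[OF g, of "Suc n"] intT by (rule Bochner_Integration.integrable_diff)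
    show "integrable M (\<lambda>x. g x * indicator {x. max_sum g (Suc n) x > 0} x)"
      by (rule Bochner_Integration.integrable_bound[OF g]) (auto simp: indicator_def)
    fix x
    \<comment> \<open>Where the maximum is positive the recursion makes this an equality; elsewhere
      the left side is at most 0.\<close>
    show "max_sum g (Suc n) x - max_sum g n (T x) \<le> g x * indicator {x. max_sum g (Suc n) x > 0} x"
      using max_sum_nonneg[of g n "T x"] by (auto simp: indicator_def max_def)
  qed
  finally show ?thesis .
qed

text \<open>A one-sided bound on ergodic averages together with the matching bound on the mean forces
  convergence: the invariant set where the upper limit exceeds \<^term>\<open>c > G\<close> must be null, since its
  complement already carries its full share of the mean by Fatou.\<close>

lemma ergodic_upper_bound:
  assumes f: "integrable M f" and f0: "\<And>x. 0 \<le> f x" and G: "0 \<le> G" and mean: "(\<integral>x. f x \<partial>M) \<le> G"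
    and lower: "AE x in M. \<forall>r<G. eventually (\<lambda>k. r * real k \<le> (\<Sum>i<k. f ((T ^^ i) x))) sequentially"
    and c: "c > G"
  shows "AE x in M. eventually (\<lambda>k. (\<Sum>i<k. f ((T ^^ i) x)) \<le> c * real k) sequentially"
proof -
  note [measurable] = borel_measurable_integrable[OF f]
  define S where "S k x = (\<Sum>i<k. f ((T ^^ i) x))" for k x
  define c' where "c' = (c + G) / 2"
  have c': "G < c'" "c' < c" using c by (auto simp: c'_def)
  \<comment> \<open>\<open>B\<close> says that the upper limit of the averages exceeds c'. The slack
    1/(j+1) above c' leaves room to absorb the bounded changes caused by shifting the orbit, which
    makes \<open>B\<close> invariant.\<close>
  define cc where "cc j = c' + 1 / real (Suc j)" for j
  have cc: "c' < cc j" for j by (simp add: cc_def)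
  define B where "B = {x\<in>space M. \<exists>j. \<forall>K. \<exists>k\<ge>K. cc j * real k < S k x}"
  have [measurable]: "S k \<in> borel_measurable M" for k unfolding S_def by measurable
  have [measurable]: "B \<in> sets M" unfolding B_def by measurable
  have S_Suc: "S (Suc k) x = f x + S k (T x)" for k x
    unfolding S_def by (subst sum.lessThan_Suc_shift) (simp add: funpow_swap1)
  \<comment> \<open>A bounded error \<open>b\<close> is paid for by passing from \<open>cc j\<close>
    to the smaller \<open>cc (Suc j)\<close>, for large \<open>k\<close>.\<close>
  have shift: "\<exists>j. \<forall>K. \<exists>k\<ge>K. cc j * real k < v k"
    if j: "\<forall>K. \<exists>k\<ge>K. cc j * real k + b < v k" for j v b
  proof (rule exI[of _ "Suc j"], rule allI)
    fix K
    define \<delta> where "\<delta> = 1 / real (Suc j) - 1 / real (Suc (Suc j))"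
    have "1 / real (Suc (Suc j)) < 1 / real (Suc j)" by (intro divide_strict_left_mono) auto
    then have \<delta>: "\<delta> > 0" by (simp add: \<delta>_def)
    obtain K' where K': "real K' > - b / \<delta>" using reals_Archimedean2 by blast
    obtain k where k: "k \<ge> max K K'" "cc j * real k + b < v k" using j by blast
    have "- b / \<delta> < real k" using K' k(1) by (meson less_le_trans max.bounded_iff of_nat_mono)
    then have "- b < \<delta> * real k" using \<delta> by (simp add: field_simps)
    moreover have "cc j = cc (Suc j) + \<delta>" by (simp add: cc_def \<delta>_def)
    ultimately have "cc (Suc j) * real k < cc j * real k + b"
      by (simp add: algebra_simps)
    then show "\<exists>k\<ge>K. cc (Suc j) * real k < v k" using k by (intro exI[of _ k]) auto
  qed
  have inv: "T x \<in> B \<longleftrightarrow> x \<in> B" if x: "x \<in> space M" for x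
  proof
    have Tx: "T x \<in> space M" using x measurable_space[OF T_measurable] by blast
    assume "T x \<in> B"
    then obtain j where j: "\<forall>K. \<exists>k\<ge>K. cc j * real k < S k (T x)" by (auto simp: B_def)
    have "\<forall>K. \<exists>k\<ge>K. cc j * real k + - cc j < S k x"
    proof
      fix K
      obtain k where k: "k \<ge> K" "cc j * real k < S k (T x)" using j by blast
      then have "cc j * real (Suc k) + - cc j < S (Suc k) x"
        using f0[of x] by (simp add: S_Suc algebra_simps)
      then show "\<exists>k\<ge>K. cc j * real k + - cc j < S k x"
        using k by (intro exI[of _ "Suc k"]) auto
    qed
    from shift[OF this] show "x \<in> B" using x by (simp add: B_def)
  next
    have Tx: "T x \<in> space M" using x measurable_space[OF T_measurable] by blast
    assume "x \<in> B"
    then obtain j where j: "\<forall>K. \<exists>k\<ge>K. cc j * real k < S k x" by (auto simp: B_def)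
    have "\<forall>K. \<exists>k\<ge>K. cc j * real k + (cc j - f x) < S k (T x)"
    proof
      fix K
      obtain k where k: "k \<ge> Suc K" "cc j * real k < S k x" using j by blast
      then obtain m where m: "k = Suc m" by (cases k) auto
      have "cc j * real m + (cc j - f x) < S m (T x)"
        using k(2) by (simp add: m S_Suc algebra_simps)
      then show "\<exists>k\<ge>K. cc j * real k + (cc j - f x) < S k (T x)"
        using k m by (intro exI[of _ m]) auto
    qed
    from shift[OF this] show "T x \<in> B" using Tx by (simp add: B_def)
  qed
  have inv_i: "(T ^^ i) x \<in> B \<longleftrightarrow> x \<in> B" if "x \<in> space M" for x i
  proof (induction i)
    case (Suc i)
    then show ?case using inv[OF measurable_space[OF iterate_measurable[of i] that]] by simp
  qed simp
  have intI: "integrable M (indicator B :: _ \<Rightarrow> real)"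
    by (rule integrable_const_bound[where B=1]) auto
  define P where "P = prob B"
  have intB: "integrable M (\<lambda>x. f x * indicator B x)"
    by (rule Bochner_Integration.integrable_bound[OF f]) (auto simp: indicator_def)
  have intC: "integrable M (\<lambda>x. f x * indicator (space M - B) x)"
    by (rule Bochner_Integration.integrable_bound[OF f]) (auto simp: indicator_def)
  \<comment> \<open>On \<open>B\<close> some orbit sum of f - c' is positive, so the sets in the
    maximal inequality exhaust \<open>B\<close>, and in the limit the integral of \<open>g\<close>
    is nonnegative.\<close>
  define g where "g x = (f x - c') * indicator B x" for x
  have gint: "integrable M g"
  proof -
    have "integrable M (\<lambda>x. f x * indicator B x - c' * indicator B x)"
      using intB intI by (intro Bochner_Integration.integrable_diff integrable_mult_right)
    then show ?thesis by (simp add: g_def[abs_def] left_diff_distrib)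
  qed
  note [measurable] = borel_measurable_integrable[OF gint]
    borel_measurable_integrable[OF max_sum_integrable[OF gint]]
  have sum_g: "(\<Sum>i<k. g ((T ^^ i) x)) = (S k x - c' * real k) * indicator B x" if "x \<in> space M" for k x
    using inv_i[OF that] by (simp add: g_def S_def indicator_def sum_subtractf mult.commute)
  have "(\<lambda>n. \<integral>x. g x * indicator {x. max_sum g (Suc n) x > 0} x \<partial>M) \<longlonglongrightarrow> (\<integral>x. g x \<partial>M)"
  proof (rule integral_dominated_convergence[where w="\<lambda>x. \<bar>g x\<bar>"])
    show "AE x in M. (\<lambda>n. g x * indicator {x. max_sum g (Suc n) x > 0} x) \<longlonglongrightarrow> g x"
      using AE_space
    proof eventually_elim
      case (elim x)
      show ?case
      proof (cases "x \<in> B")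
        case True
        then obtain j where "\<forall>K. \<exists>k\<ge>K. cc j * real k < S k x" by (auto simp: B_def)
        then obtain k where k: "k \<ge> 1" "cc j * real k < S k x" by blast
        have "c' * real k < S k x"
          using k(2) mult_right_mono[OF less_imp_le[OF cc[of j]], of "real k"] by simp
        then have pos: "0 < max_sum g k x"
          using sum_le_max_sum[of g x k] sum_g[OF elim, of k] True by simp
        have "eventually (\<lambda>n. g x * indicator {x. max_sum g (Suc n) x > 0} x = g x) sequentially"
          using eventually_ge_at_top[of k]
        proof eventually_elim
          case (elim n)
          have "incseq (\<lambda>n. max_sum g n x)" by (intro incseq_SucI max_sum_mono_Suc)
          then have "max_sum g k x \<le> max_sum g (Suc n) x" using elim by (auto simp: incseq_def simp del: max_sum.simps)
          then show ?case using pos by (simp add: indicator_def del: max_sum.simps)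
        qed
        then show ?thesis by (rule tendsto_eventually)
      qed (simp add: g_def)
    qed
    show "integrable M (\<lambda>x. \<bar>g x\<bar>)" using gint by simp
    show "AE x in M. norm (g x * indicator {x. max_sum g (Suc n) x > 0} x) \<le> \<bar>g x\<bar>" for n
      by (auto simp: indicator_def)
  qed measurable
  then have "0 \<le> (\<integral>x. g x \<partial>M)"
    using max_sum_integral_nonneg[OF gint] by (intro LIMSEQ_le_const) auto
  also have "(\<integral>x. g x \<partial>M) = (\<integral>x. f x * indicator B x - c' * indicator B x \<partial>M)"
    by (intro Bochner_Integration.integral_cong refl) (simp add: g_def left_diff_distrib)
  also have "\<dots> = (\<integral>x. f x * indicator B x \<partial>M) - c' * P"
    using intB intI by (subst Bochner_Integration.integral_diff)
      (auto simp: P_def Int_absorb2 sets.sets_into_space)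
  finally have onB: "c' * P \<le> (\<integral>x. f x * indicator B x \<partial>M)" by simp
  have offB: "G * (1 - P) \<le> (\<integral>x. f x * indicator (space M - B) x \<partial>M)"
  proof -
    let ?I = "\<lambda>x. indicator (space M - B) x :: real"
    have fi: "(\<integral>x. f ((T ^^ i) x) * ?I x \<partial>M) = (\<integral>x. f x * ?I x \<partial>M)" for i
    proof -
      have "(\<integral>x. f ((T ^^ i) x) * ?I x \<partial>M) = (\<integral>x. f ((T ^^ i) x) * ?I ((T ^^ i) x) \<partial>M)"
        using inv_i measurable_space[OF iterate_measurable[of i]]
        by (intro Bochner_Integration.integral_cong refl) (auto simp: indicator_def)
      also have "\<dots> = (\<integral>x. f x * ?I x \<partial>M)"
        by (rule iterate_integral[of "\<lambda>x. f x * ?I x"]) measurable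
      finally show ?thesis .
    qed
    have ii: "integrable M (\<lambda>x. f ((T ^^ i) x) * ?I x)" for i
      by (rule Bochner_Integration.integrable_bound[OF iterate_integrable[OF f, of i]]) (auto simp: indicator_def)
    have Sk: "(\<integral>x. S k x / real k * ?I x \<partial>M) = (\<integral>x. f x * ?I x \<partial>M)"
      and Ski: "integrable M (\<lambda>x. S k x / real k * ?I x)" if "k > 0" for k
    proof -
      have eq: "S k x / real k * ?I x = (\<Sum>i<k. f ((T ^^ i) x) * ?I x) / real k" for x
        by (simp add: S_def sum_distrib_right)
      show "integrable M (\<lambda>x. S k x / real k * ?I x)"
        unfolding eq using ii by (intro integrable_divide Bochner_Integration.integrable_sum) auto
      have "(\<integral>x. S k x / real k * ?I x \<partial>M) = (\<Sum>i<k. \<integral>x. f ((T ^^ i) x) * ?I x \<partial>M) / real k"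
        unfolding eq integral_divide_zero by (subst Bochner_Integration.integral_sum) (rule ii, rule refl)
      then show "(\<integral>x. S k x / real k * ?I x \<partial>M) = (\<integral>x. f x * ?I x \<partial>M)"
        using that by (simp add: fi)
    qed
    have S0: "0 \<le> S k x" for k x by (simp add: S_def sum_nonneg f0)
    \<comment> \<open>Truncation at \<open>G\<close> turns the asymptotic lower bound into
      convergence with bounded integrands; \<open>Suc k\<close> avoids division by 0.\<close>
    have "(\<lambda>k. \<integral>x. min (S (Suc k) x / real (Suc k)) G * ?I x \<partial>M) \<longlonglongrightarrow> (\<integral>x. G * ?I x \<partial>M)"
    proof (rule integral_dominated_convergence[where w="\<lambda>_. G"])
      show "AE x in M. (\<lambda>k. min (S (Suc k) x / real (Suc k)) G * ?I x) \<longlonglongrightarrow> G * ?I x"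
        using lower
      proof eventually_elim
        case (elim x)
        have "(\<lambda>k. min (S k x / real k) G) \<longlonglongrightarrow> G"
        proof (rule order_tendstoI)
          fix r assume r: "r < G"
          obtain r' where r': "r < r'" "r' < G" using dense[OF r] by blast
          have "eventually (\<lambda>k. r' * real k \<le> S k x) sequentially" using elim r' by (simp add: S_def)
          then show "eventually (\<lambda>k. r < min (S k x / real k) G) sequentially"
            using eventually_gt_at_top[of 0]
          proof eventually_elim
            case (elim k)
            then have "r' \<le> S k x / real k" by (simp add: le_divide_eq)
            then show ?case using r r' by simp
          qed
        next
          fix r assume "G < r"
          then show "eventually (\<lambda>k. min (S k x / real k) G < r) sequentially"
            by (intro always_eventually) auto
        qed
        from LIMSEQ_Suc[OF this] show ?case by (intro tendsto_mult tendsto_const) 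
      qed
      show "AE x in M. norm (min (S (Suc k) x / real (Suc k)) G * ?I x) \<le> G" for k
        using S0 G by (auto simp: indicator_def min_def)
    qed auto
    moreover have "(\<integral>x. min (S (Suc k) x / real (Suc k)) G * ?I x \<partial>M) \<le> (\<integral>x. f x * ?I x \<partial>M)" for k
    proof -
      have "(\<integral>x. min (S (Suc k) x / real (Suc k)) G * ?I x \<partial>M) \<le> (\<integral>x. S (Suc k) x / real (Suc k) * ?I x \<partial>M)"
      proof (rule integral_mono)
        show "integrable M (\<lambda>x. S (Suc k) x / real (Suc k) * ?I x)" by (rule Ski) simp
        show "integrable M (\<lambda>x. min (S (Suc k) x / real (Suc k)) G * ?I x)"
          using S0 G by (intro integrable_const_bound[where B=G]) (auto simp: indicator_def min_def)
      qed (auto simp: indicator_def)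
      then show ?thesis by (simp only: Sk[OF zero_less_Suc])
    qed
    ultimately have "(\<integral>x. G * ?I x \<partial>M) \<le> (\<integral>x. f x * ?I x \<partial>M)"
      by (intro LIMSEQ_le_const2) auto
    moreover have "(\<integral>x. G * ?I x \<partial>M) = G * prob (space M - B)" by simp
    moreover have "prob (space M - B) = 1 - P" by (simp add: P_def prob_compl)
    ultimately show ?thesis by (simp only:)
  qed
  have "(\<integral>x. f x \<partial>M) = (\<integral>x. f x * indicator B x + f x * indicator (space M - B) x \<partial>M)"
    by (intro Bochner_Integration.integral_cong refl) (auto simp: indicator_def)
  also have "\<dots> = (\<integral>x. f x * indicator B x \<partial>M) + (\<integral>x. f x * indicator (space M - B) x \<partial>M)"
    using intB intC by (rule Bochner_Integration.integral_add)
  \<comment> \<open>The mean is at least c' on the share \<open>P\<close> and \<open>G\<close> on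
    the rest, yet at most \<open>G\<close> in total; this leaves no room for
    \<open>P > 0\<close>.\<close>
  finally have "c' * P + G * (1 - P) \<le> G" using onB offB mean by linarith
  then have "(c' - G) * P \<le> 0" by (simp add: algebra_simps)
  then have "P \<le> 0" using c'(1) by (simp add: mult_le_0_iff)
  then have "AE x in M. x \<notin> B"
    using measure_nonneg[of M B] prob_eq_0[of B] by (simp add: P_def)
  then show ?thesis using AE_space
  proof eventually_elim
    case (elim x)
    obtain j where "1 / real (Suc j) < c - c'" using c' by (metis diff_gt_0_iff_gt nat_approx_posE)
    then have j: "cc j < c" by (simp add: cc_def)
    obtain K where K: "\<And>k. k \<ge> K \<Longrightarrow> S k x \<le> cc j * real k"
      using elim unfolding B_def by (auto simp: not_less)
    show ?case unfolding eventually_sequentially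
    proof (intro exI[of _ K] allI impI)
      fix k assume "K \<le> k"
      then have "S k x \<le> cc j * real k" by (rule K)
      also have "\<dots> \<le> c * real k" using j by (intro mult_right_mono) auto
      finally show "(\<Sum>i<k. f ((T ^^ i) x)) \<le> c * real k" by (simp add: S_def)
    qed
  qed
qed

end


section \<open>Escape rate\<close>

lemma walk_shift:
  assumes "walker_at \<tau> a \<rho> s = b"
  shows "walker_at \<tau> b (rotors_at \<tau> a \<rho> s) t = walker_at \<tau> a \<rho> (s + t)"
    and "rotors_at \<tau> b (rotors_at \<tau> a \<rho> s) t = rotors_at \<tau> a \<rho> (s + t)"
proof -
  have "(rotor_step \<tau> ^^ s) (a, \<rho>) = (b, rotors_at \<tau> a \<rho> s)"
    using assms by (simp add: walker_at_def rotors_at_def prod_eq_iff)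
  then have "(rotor_step \<tau> ^^ t) (b, rotors_at \<tau> a \<rho> s) = (rotor_step \<tau> ^^ (s + t)) (a, \<rho>)"
    by (metis add.commute comp_apply funpow_add)
  then show "walker_at \<tau> b (rotors_at \<tau> a \<rho> s) t = walker_at \<tau> a \<rho> (s + t)"
    "rotors_at \<tau> b (rotors_at \<tau> a \<rho> s) t = rotors_at \<tau> a \<rho> (s + t)"
    by (simp_all add: walker_at_def rotors_at_def)
qed

lemma first_return:
  assumes "returns \<tau> a \<rho>"
  shows "\<exists>s\<ge>1. walker_at \<tau> a \<rho> s = a \<and> (\<forall>t. 1 \<le> t \<longrightarrow> t < s \<longrightarrow> walker_at \<tau> a \<rho> t \<noteq> a) \<and>
    leftover \<tau> a \<rho> = rotors_at \<tau> a \<rho> s"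
proof -
  define s where "s = (LEAST t. t \<ge> 1 \<and> walker_at \<tau> a \<rho> t = a)"
  have ex: "\<exists>t. t \<ge> 1 \<and> walker_at \<tau> a \<rho> t = a" using assms by (auto simp: returns_def)
  have "s \<ge> 1 \<and> walker_at \<tau> a \<rho> s = a" unfolding s_def by (rule LeastI_ex[OF ex])
  moreover have "walker_at \<tau> a \<rho> t \<noteq> a" if "1 \<le> t" "t < s" for t
    using not_less_Least[of t "\<lambda>t. t \<ge> 1 \<and> walker_at \<tau> a \<rho> t = a"] that by (auto simp: s_def)
  moreover have "leftover \<tau> a \<rho> = rotors_at \<tau> a \<rho> s" using assms by (simp add: leftover_def s_def)
  ultimately show ?thesis by blast
qed

lemma not_returns_visits: "\<not> returns \<tau> a \<rho> \<Longrightarrow> {t. walker_at \<tau> a \<rho> t = a} = {0}"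
proof (intro set_eqI)
  fix t assume "\<not> returns \<tau> a \<rho>"
  then show "t \<in> {t. walker_at \<tau> a \<rho> t = a} \<longleftrightarrow> t \<in> {0}"
    by (cases t) (auto simp: returns_def)
qed

lemma escape_count_0 [simp]: "escape_count \<tau> a \<rho> 0 = 0"
  by (simp add: escape_count_def)

lemma escape_count_Suc:
  "escape_count \<tau> a \<rho> (Suc n) = of_bool (\<not> returns \<tau> a \<rho>) + escape_count \<tau> a (leftover \<tau> a \<rho>) n"
proof -
  have sum: "escape_count \<tau> a \<rho> n = (\<Sum>k<n. of_bool (\<not> returns \<tau> a ((leftover \<tau> a ^^ k) \<rho>)))" for \<rho> n
  proof -
    have "(\<Sum>k<n. of_bool (P k)) = card {k. k < n \<and> P k}" for P :: "nat \<Rightarrow> bool"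
      by (simp add: of_bool_def sum.If_cases Int_def)
    then show ?thesis unfolding escape_count_def by (rule sym)
  qed
  show ?thesis
    unfolding sum sum.lessThan_Suc_shift funpow_Suc_right comp_apply funpow_0 ..
qed

lemma escape_count_mono: "m \<le> n \<Longrightarrow> escape_count \<tau> a \<rho> m \<le> escape_count \<tau> a \<rho> n"
  unfolding escape_count_def by (intro card_mono) auto

section \<open>Rotor weights and Schramm's bound\<close>

context rotor_graph
begin

text \<open>A single orbit under a bijection is a cycle, and its minimal period is therefore the
  degree.\<close>

lemma tau_cycle:
  assumes y: "y \<in> E `` {x}"
  shows "bij_betw (\<lambda>j. (\<tau> x ^^ j) y) {..<card (E `` {x})} (E `` {x})"
    and "(\<tau> x ^^ card (E `` {x})) y = y"
proof -
  let ?f = "\<tau> x" and ?N = "E `` {x}"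
  obtain i where "(?f ^^ i) (?f y) = y" using tau_orbit[OF tau_nbr[OF y] y] by blast
  then have ex: "\<exists>k. k > 0 \<and> (?f ^^ k) y = y" by (intro exI[of _ "Suc i"]) (simp add: funpow_swap1)
  define n where "n = (LEAST k. k > 0 \<and> (?f ^^ k) y = y)"
  have n: "n > 0" "(?f ^^ n) y = y" using LeastI_ex[OF ex] by (auto simp: n_def)
  have n_min: "(?f ^^ k) y \<noteq> y" if "0 < k" "k < n" for k
    using not_less_Least[of k "\<lambda>k. k > 0 \<and> (?f ^^ k) y = y"] that by (auto simp: n_def)
  have bij: "bij_betw (?f ^^ i) ?N ?N" for i using tau_bij by (rule bij_betw_funpow)
  have in_N: "(?f ^^ i) y \<in> ?N" for i using bij[of i] y by (auto simp: bij_betw_def)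
  have "inj_on (\<lambda>j. (?f ^^ j) y) {..<n}"
  proof (rule linorder_inj_onI)
    fix i j assume ij: "i < j" "j \<in> {..<n}"
    show "(?f ^^ i) y \<noteq> (?f ^^ j) y"
    proof
      assume eq: "(?f ^^ i) y = (?f ^^ j) y"
      have "(?f ^^ j) y = (?f ^^ i) ((?f ^^ (j - i)) y)"
        using ij by (metis comp_apply funpow_add le_add_diff_inverse less_imp_le)
      then have "(?f ^^ (j - i)) y = y"
        using eq bij[of i] in_N y by (auto simp: bij_betw_def inj_on_def)
      moreover have "0 < j - i" "j - i < n" using ij by auto
      ultimately show False using n_min by blast
    qed
  qed auto
  moreover have im: "(\<lambda>j. (?f ^^ j) y) ` {..<n} = ?N"
  proof
    show "?N \<subseteq> (\<lambda>j. (?f ^^ j) y) ` {..<n}"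
    proof
      fix z assume "z \<in> ?N"
      then obtain i where "(?f ^^ i) y = z" using tau_orbit[OF y] by blast
      then have "(?f ^^ (i mod n)) y = z" using funpow_mod_eq[OF n(2)] by simp
      then show "z \<in> (\<lambda>j. (?f ^^ j) y) ` {..<n}" using n(1) by (intro image_eqI[of _ _ "i mod n"]) auto
    qed
  qed (use in_N in auto)
  ultimately have b: "bij_betw (\<lambda>j. (?f ^^ j) y) {..<n} ?N" by (simp add: bij_betw_def)
  have "card ?N = n" using bij_betw_same_card[OF b] by simp
  then show "bij_betw (\<lambda>j. (?f ^^ j) y) {..<card ?N} ?N" "(?f ^^ card ?N) y = y" using b n by simp_all
qed

text \<open>A function with sum 0 around a cycle is a discrete derivative. The primitive used here,
  the weighted sum of j times the j-th value divided by the degree, needs no base point; summation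
  by parts verifies it.\<close>

lemma rotor_potential:
  assumes zero: "(\<Sum>y\<in>E `` {u}. \<psi> y) = (0 :: real)"
  shows "\<exists>w. \<forall>y\<in>E `` {u}. w (\<tau> u y) - w y = \<psi> y"
proof -
  let ?d = "card (E `` {u})"
  have d: "?d > 0" by simp
  define w where "w y = (\<Sum>j<?d. real j * \<psi> ((\<tau> u ^^ j) y)) / real ?d" for y
  have "w (\<tau> u y) - w y = \<psi> y" if y: "y \<in> E `` {u}" for y
  proof -
    define \<alpha> where "\<alpha> j = \<psi> ((\<tau> u ^^ j) y)" for j
    have "(\<Sum>j<?d. \<alpha> j) = 0"
      unfolding \<alpha>_def using sum.reindex_bij_betw[OF tau_cycle(1)[OF y], of \<psi>] zero by simp
    moreover have per: "\<alpha> ?d = \<alpha> 0" using tau_cycle(2)[OF y] by (simp add: \<alpha>_def)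
    ultimately have s1: "(\<Sum>j<?d. \<alpha> (Suc j)) = 0"
      using sum.lessThan_Suc_shift[of \<alpha> ?d] by simp
    have "(\<Sum>j<?d. real (Suc j) * \<alpha> (Suc j)) = (\<Sum>j<?d. real j * \<alpha> j) + real ?d * \<alpha> ?d"
      using sum.lessThan_Suc_shift[of "\<lambda>j. real j * \<alpha> j" ?d] by simp
    moreover have "(\<Sum>j<?d. real (Suc j) * \<alpha> (Suc j)) = (\<Sum>j<?d. real j * \<alpha> (Suc j)) + (\<Sum>j<?d. \<alpha> (Suc j))"
      by (simp add: sum.distrib[symmetric] algebra_simps)
    ultimately have diff: "(\<Sum>j<?d. real j * \<alpha> (Suc j)) - (\<Sum>j<?d. real j * \<alpha> j) = real ?d * \<alpha> 0"
      using s1 per by simp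
    have "w (\<tau> u y) - w y = ((\<Sum>j<?d. real j * \<alpha> (Suc j)) - (\<Sum>j<?d. real j * \<alpha> j)) / real ?d"
      by (simp add: w_def \<alpha>_def funpow_swap1 diff_divide_distrib)
    also have "\<dots> = \<psi> y" unfolding diff using d by (simp add: \<alpha>_def)
    finally show ?thesis .
  qed
  then show ?thesis by blast
qed

lemma leftover_escape:
  assumes nbr: "\<And>x. \<rho> x \<in> E `` {x}" and "\<not> returns \<tau> a \<rho>"
  shows "leftover \<tau> a \<rho> = final_rotors \<tau> a \<rho>"
    and "finite {t. walker_at \<tau> a \<rho> t = x}"
proof -
  have fin: "finite {t. walker_at \<tau> a \<rho> t = x}" for x
    using nbr by (rule finite_visits_everywhere) (simp add: not_returns_visits[OF assms(2)])
  then show "finite {t. walker_at \<tau> a \<rho> t = x}" .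
  show "leftover \<tau> a \<rho> = final_rotors \<tau> a \<rho>"
    using The_eventually_const[OF eventually_rotor_final[OF fin]] assms(2)
    by (simp add: leftover_def fun_eq_iff)
qed

lemma leftover_nbr:
  assumes nbr: "\<And>x. \<rho> x \<in> E `` {x}"
  shows "leftover \<tau> a \<rho> x \<in> E `` {x}"
proof (cases "returns \<tau> a \<rho>")
  case True
  then obtain s where "leftover \<tau> a \<rho> = rotors_at \<tau> a \<rho> s" using first_return[OF True] by blast
  then show ?thesis using rotors_at_nbr[of \<rho> x a s] nbr by simp
next
  case False
  then show ?thesis using leftover_escape(1)[OF nbr False] final_rotors_nbr[OF nbr] by simp
qed

text \<open>Schramm's bound. The function \<^term>\<open>hit E a n\<close> is subharmonic off \<^term>\<open>a\<close> and has finite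
  support; adding suitable rotor weights makes its value at the walker nondecreasing along the walk,
  so each particle that escapes must be compensated through particles that return.\<close>

lemma escape_count_le:
  "\<exists>C. \<forall>\<rho> m. (\<forall>x. \<rho> x \<in> E `` {x}) \<longrightarrow>
     real (escape_count \<tau> a \<rho> m) \<le> real m * (1 - nbr_avg E (hit E a n) a) + C"
proof -
  define h where "h = hit E a n"
  define c where "c = nbr_avg E h a"
  define S where "S = nbhd a n"
  have fin_S: "finite S" by (simp add: S_def)
  have h0: "0 \<le> h u" for u by (simp add: h_def hit_nonneg)
  have ha: "h a = 1" by (simp add: h_def)
  have aS: "a \<in> S" by (simp add: S_def centre_in_nbhd)
  have supp: "u \<in> nbhd a n" if "hit E a n u \<noteq> 0" for n u
    using that
  proof (induction n arbitrary: u)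
    case 0
    then show ?case by (simp split: if_splits)
  next
    case (Suc n)
    show ?case
    proof (cases "u = a")
      case False
      have "\<exists>y\<in>E `` {u}. hit E a n y \<noteq> 0"
      proof (rule ccontr)
        assume "\<not> ?thesis"
        then have "(\<Sum>y\<in>E `` {u}. hit E a n y) = 0" by (intro sum.neutral) blast
        then show False using Suc.prems False by (simp add: nbr_avg_def)
      qed
      then obtain y where y: "y \<in> E `` {u}" "hit E a n y \<noteq> 0" by blast
      from Suc.IH[OF y(2)] show ?thesis using y(1) sym_E[of u y] by auto
    qed (use centre_in_nbhd in auto)
  qed
  have h_out: "h u = 0" if "u \<notin> S" for u using supp[of n u] that by (auto simp: h_def S_def)
  have h_sub: "h u \<le> nbr_avg E h u" if "u \<noteq> a" for u
    using hit_mono_Suc[of a n u] that by (simp add: h_def)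
  \<comment> \<open>The weight of a rotor changes at each step by the difference between the
    neighbor average of \<open>h\<close> and its value at the next position, so the sum of
    \<open>h\<close> and the weights moves as if \<open>h\<close> were averaged.\<close>
  have "\<exists>w. \<forall>y\<in>E `` {u}. w (\<tau> u y) - w y = nbr_avg E h u - h (\<tau> u y)" for u
  proof (rule rotor_potential)
    have "(\<Sum>y\<in>E `` {u}. h (\<tau> u y)) = (\<Sum>y\<in>E `` {u}. h y)" by (rule sum.reindex_bij_betw[OF tau_bij])
    then show "(\<Sum>y\<in>E `` {u}. nbr_avg E h u - h (\<tau> u y)) = 0"
      using card_nbrs_pos[of u] by (simp add: sum_subtractf nbr_avg_def)
  qed
  then obtain w where w: "\<And>u y. y \<in> E `` {u} \<Longrightarrow> w u (\<tau> u y) - w u y = nbr_avg E h u - h (\<tau> u y)"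
    by metis
  define Wt where "Wt \<rho> = (\<Sum>u\<in>S. w u (\<rho> u))" for \<rho>
  define C where "C = (\<Sum>u\<in>S. \<Sum>y\<in>E `` {u}. \<bar>w u y\<bar>)"
  have Wt_bound: "\<bar>Wt \<rho>\<bar> \<le> C" if "\<And>x. \<rho> x \<in> E `` {x}" for \<rho>
  proof -
    have "\<bar>Wt \<rho>\<bar> \<le> (\<Sum>u\<in>S. \<bar>w u (\<rho> u)\<bar>)" unfolding Wt_def by (rule sum_abs)
    also have "\<dots> \<le> C" unfolding C_def
      by (intro sum_mono member_le_sum[of "\<rho> _" _ "\<lambda>y. \<bar>w _ y\<bar>"]) (use that in auto)
    finally show ?thesis .
  qed
  \<comment> \<open>With \<open>h\<close> at the walker plus the weights as potential, a particle
    starts at \<open>1 + Wt \<rho>\<close>; leaving \<open>a\<close> replaces the 1 by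
    \<open>c\<close>, and no later step decreases the potential. It ends with \<open>h\<close> equal
    to 1 at \<open>a\<close> after a return, or 0 outside \<open>S\<close> after an escape.\<close>
  have particle: "Wt \<rho> + c \<le> of_bool (returns \<tau> a \<rho>) + Wt (leftover \<tau> a \<rho>)"
    if nbr: "\<And>x. \<rho> x \<in> E `` {x}" for \<rho>
  proof -
    define \<Phi> where "\<Phi> t = h (walker_at \<tau> a \<rho> t) + Wt (rotors_at \<tau> a \<rho> t)" for t
    have step: "\<Phi> (Suc t) = \<Phi> t - h (walker_at \<tau> a \<rho> t) + nbr_avg E h (walker_at \<tau> a \<rho> t)"
      if "walker_at \<tau> a \<rho> t \<in> S" for t
    proof -
      let ?u = "walker_at \<tau> a \<rho> t" and ?r = "rotors_at \<tau> a \<rho> t"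
      have "Wt (rotors_at \<tau> a \<rho> (Suc t)) = w ?u (\<tau> ?u (?r ?u)) + (\<Sum>u\<in>S - {?u}. w u (?r u))"
        unfolding Wt_def using that fin_S
        by (subst sum.remove[of S ?u]) (auto simp: rotors_at_Suc walker_at_Suc intro!: sum.cong)
      moreover have "Wt ?r = w ?u (?r ?u) + (\<Sum>u\<in>S - {?u}. w u (?r u))"
        unfolding Wt_def using that fin_S by (rule sum.remove[rotated])
      moreover have "w ?u (\<tau> ?u (?r ?u)) - w ?u (?r ?u) = nbr_avg E h ?u - h (\<tau> ?u (?r ?u))"
        by (intro w rotors_at_nbr nbr)
      ultimately show ?thesis by (simp add: \<Phi>_def walker_at_Suc)
    qed
    have mono: "\<Phi> t \<le> \<Phi> (Suc t)" if "walker_at \<tau> a \<rho> t \<noteq> a" for t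
    proof (cases "walker_at \<tau> a \<rho> t \<in> S")
      case True
      then show ?thesis using step h_sub[OF that] by simp
    next
      case False
      have "Wt (rotors_at \<tau> a \<rho> (Suc t)) = Wt (rotors_at \<tau> a \<rho> t)"
        unfolding Wt_def using False by (intro sum.cong) (auto simp: rotors_at_Suc)
      then show ?thesis using h0 h_out[OF False] by (simp add: \<Phi>_def)
    qed
    have \<Phi>1: "\<Phi> 1 = Wt \<rho> + c" using step[of 0] aS by (simp add: \<Phi>_def ha c_def)
    have \<Phi>_ge: "Wt \<rho> + c \<le> \<Phi> t" if "1 \<le> t" "\<And>s. 1 \<le> s \<Longrightarrow> s < t \<Longrightarrow> walker_at \<tau> a \<rho> s \<noteq> a" for t
      using that
    proof (induction t rule: dec_induct)
      case base
      then show ?case using \<Phi>1 by simp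
    next
      case (step t)
      have "Wt \<rho> + c \<le> \<Phi> t" using step by auto
      also have "\<dots> \<le> \<Phi> (Suc t)" using step by (intro mono) auto
      finally show ?case .
    qed
    show ?thesis
    proof (cases "returns \<tau> a \<rho>")
      case True
      then obtain s where s: "s \<ge> 1" "walker_at \<tau> a \<rho> s = a" "\<forall>t. 1 \<le> t \<longrightarrow> t < s \<longrightarrow> walker_at \<tau> a \<rho> t \<noteq> a"
        "leftover \<tau> a \<rho> = rotors_at \<tau> a \<rho> s" using first_return[OF True] by blast
      then show ?thesis using \<Phi>_ge[of s] True by (simp add: \<Phi>_def ha)
    next
      case False
      note esc = leftover_escape[OF nbr False]
      have "eventually (\<lambda>t. \<forall>x\<in>S. rotors_at \<tau> a \<rho> t x = final_rotors \<tau> a \<rho> x) sequentially"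
        using fin_S eventually_rotor_final[OF esc(2)] by (intro eventually_ball_finite) auto
      moreover have "eventually (\<lambda>t. \<forall>x\<in>S. walker_at \<tau> a \<rho> t \<noteq> x) sequentially"
      proof (intro eventually_ball_finite[OF fin_S] ballI)
        fix x
        have "eventually (\<lambda>t. \<not> walker_at \<tau> a \<rho> t = x) cofinite"
          using esc(2)[of x] by (simp add: eventually_cofinite)
        then show "eventually (\<lambda>t. walker_at \<tau> a \<rho> t \<noteq> x) sequentially"
          by (simp add: cofinite_eq_sequentially)
      qed
      ultimately have "eventually (\<lambda>t. (\<forall>x\<in>S. rotors_at \<tau> a \<rho> t x = final_rotors \<tau> a \<rho> x) \<and>
          (\<forall>x\<in>S. walker_at \<tau> a \<rho> t \<noteq> x) \<and> 1 \<le> t) sequentially"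
        using eventually_ge_at_top[of "1 :: nat"] by eventually_elim blast
      then obtain t where t: "\<forall>x\<in>S. rotors_at \<tau> a \<rho> t x = final_rotors \<tau> a \<rho> x"
        "\<forall>x\<in>S. walker_at \<tau> a \<rho> t \<noteq> x" "1 \<le> t"
        by (auto simp: eventually_sequentially)
      have "walker_at \<tau> a \<rho> t \<notin> S" using t(2) by blast
      then have "\<Phi> t = Wt (rotors_at \<tau> a \<rho> t)" by (simp add: \<Phi>_def h_out)
      also have "\<dots> = Wt (leftover \<tau> a \<rho>)"
        unfolding Wt_def esc(1) using t(1) by (intro sum.cong) auto
      finally have "\<Phi> t = Wt (leftover \<tau> a \<rho>)" .
      moreover have "Wt \<rho> + c \<le> \<Phi> t"
        using t(3) False by (intro \<Phi>_ge) (auto simp: returns_def)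
      ultimately show ?thesis by simp
    qed
  qed
  have bound: "real (escape_count \<tau> a \<rho> m) \<le> real m * (1 - c) + C - Wt \<rho>"
    if "\<And>x. \<rho> x \<in> E `` {x}" for \<rho> m
    using that
  proof (induction m arbitrary: \<rho>)
    case 0
    then show ?case using Wt_bound[of \<rho>] by simp
  next
    case (Suc m)
    have "real (escape_count \<tau> a (leftover \<tau> a \<rho>) m) \<le> real m * (1 - c) + C - Wt (leftover \<tau> a \<rho>)"
      using leftover_nbr[OF Suc.prems] by (rule Suc.IH)
    moreover have "real (escape_count \<tau> a \<rho> (Suc m)) =
        of_bool (\<not> returns \<tau> a \<rho>) + real (escape_count \<tau> a (leftover \<tau> a \<rho>) m)"
      by (simp add: escape_count_Suc)
    ultimately show ?case
      using particle[OF Suc.prems] by (cases "returns \<tau> a \<rho>") (simp_all add: algebra_simps)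
  qed
  have "real (escape_count \<tau> a \<rho> m) \<le> real m * (1 - c) + 2 * C" if "\<forall>x. \<rho> x \<in> E `` {x}" for \<rho> m
  proof -
    have nbr: "\<rho> x \<in> E `` {x}" for x using that by (rule spec)
    show ?thesis using bound[OF nbr, of m] Wt_bound[OF nbr] by (simp add: abs_le_iff)
  qed
  then show ?thesis unfolding c_def h_def by blast
qed

text \<open>The probability of avoiding \<open>a\<close> up to a finite horizon decreases to the
  escape probability, so some horizon brings the rate below \<open>\<beta>\<close>. The constant is
  uniform over all legal configurations.\<close>

lemma escape_count_rate_upper:
  assumes "\<beta> > escape_prob E a"
  shows "\<exists>C\<ge>0. \<forall>\<rho> m. (\<forall>x. \<rho> x \<in> E `` {x}) \<longrightarrow> real (escape_count \<tau> a \<rho> m) \<le> \<beta> * real m + C"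
proof -
  have "(\<lambda>n. 1 - nbr_avg E (hit E a n) a) \<longlonglongrightarrow> escape_prob E a"
    unfolding escape_prob_eq by (intro tendsto_diff tendsto_const nbr_avg_hit_tendsto)
  from order_tendstoD(2)[OF this assms] obtain n where n: "1 - nbr_avg E (hit E a n) a < \<beta>"
    by (auto simp: eventually_sequentially)
  obtain C where C: "\<And>\<rho> m. (\<forall>x. \<rho> x \<in> E `` {x}) \<Longrightarrow>
      real (escape_count \<tau> a \<rho> m) \<le> real m * (1 - nbr_avg E (hit E a n) a) + C"
    using escape_count_le by blast
  have "real (escape_count \<tau> a \<rho> m) \<le> \<beta> * real m + max 0 C" if "\<forall>x. \<rho> x \<in> E `` {x}" for \<rho> m
  proof -
    have "real m * (1 - nbr_avg E (hit E a n) a) \<le> \<beta> * real m"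
      using n mult_right_mono[of "1 - nbr_avg E (hit E a n) a" \<beta> "real m"] by (simp add: mult.commute)
    then show ?thesis using C[OF that, of m] by linarith
  qed
  then show ?thesis by (intro exI[of _ "max 0 C"]) auto
qed

text \<open>Cut the full walk at its visits to \<open>a\<close>: every stretch but the last is a
  returning particle, the last one escapes. The induction removes the first stretch, which does not
  alter the final rotors.\<close>

lemma escape_count_block:
  assumes "\<And>x. \<rho> x \<in> E `` {x}" and "finite {t. walker_at \<tau> a \<rho> t = a}"
  shows "escape_count \<tau> a \<rho> (visits \<tau> a \<rho> + n) = 1 + escape_count \<tau> a (final_rotors \<tau> a \<rho>) n"
  using assms
proof (induction "visits \<tau> a \<rho>" arbitrary: \<rho> rule: less_induct)
  case less
  note nbr = less.prems(1) and fin = less.prems(2)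
  show ?case
  proof (cases "returns \<tau> a \<rho>")
    case False
    have "visits \<tau> a \<rho> = 1" by (simp add: visits_def not_returns_visits[OF False])
    then show ?thesis using False leftover_escape(1)[OF nbr False] by (simp add: escape_count_Suc)
  next
    case True
    then obtain s where s: "s \<ge> 1" "walker_at \<tau> a \<rho> s = a" "\<forall>t. 1 \<le> t \<longrightarrow> t < s \<longrightarrow> walker_at \<tau> a \<rho> t \<noteq> a"
        "leftover \<tau> a \<rho> = rotors_at \<tau> a \<rho> s" using first_return[OF True] by blast
    let ?L = "leftover \<tau> a \<rho>"
    have shift: "walker_at \<tau> a ?L t = walker_at \<tau> a \<rho> (s + t)" "rotors_at \<tau> a ?L t = rotors_at \<tau> a \<rho> (s + t)" for t
      unfolding s(4) by (rule walk_shift[OF s(2)])+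
    let ?V = "\<lambda>\<rho>. {t. walker_at \<tau> a \<rho> t = a}"
    have V: "?V \<rho> = insert 0 ((+) s ` ?V ?L)"
    proof (intro set_eqI iffI)
      fix t assume t: "t \<in> ?V \<rho>"
      show "t \<in> insert 0 ((+) s ` ?V ?L)"
      proof (cases "t = 0")
        case False
        then have "t \<ge> s" using s(3) t by (cases "t < s") auto
        then have "t = s + (t - s)" "t - s \<in> ?V ?L" using t by (auto simp: shift)
        then show ?thesis by blast
      qed simp
    next
      fix t assume "t \<in> insert 0 ((+) s ` ?V ?L)"
      then show "t \<in> ?V \<rho>" by (auto simp: shift(1))
    qed
    have finL: "finite (?V ?L)" using fin unfolding V by (simp add: finite_image_iff)
    have nbrL: "?L x \<in> E `` {x}" for x by (rule leftover_nbr[OF nbr])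
    have "0 \<notin> (+) s ` ?V ?L" using s(1) by auto
    then have vis: "visits \<tau> a \<rho> = Suc (visits \<tau> a ?L)"
      unfolding visits_def V using finL by (simp add: card_image)
    have final: "final_rotors \<tau> a ?L = final_rotors \<tau> a \<rho>"
    proof
      fix x
      have "eventually (\<lambda>t. rotors_at \<tau> a \<rho> t x = final_rotors \<tau> a \<rho> x) sequentially"
        by (rule eventually_rotor_final[OF finite_visits_everywhere[OF nbr fin]])
      then have "eventually (\<lambda>t. rotors_at \<tau> a ?L t x = final_rotors \<tau> a \<rho> x) sequentially"
        unfolding shift using eventually_sequentially_seg[of "\<lambda>t. rotors_at \<tau> a \<rho> t x = final_rotors \<tau> a \<rho> x" s]
        by (simp add: add.commute)
      then show "final_rotors \<tau> a ?L x = final_rotors \<tau> a \<rho> x" by (rule final_rotors_eq)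
    qed
    have "escape_count \<tau> a \<rho> (visits \<tau> a \<rho> + n) = escape_count \<tau> a ?L (visits \<tau> a ?L + n)"
      unfolding vis using True by (simp add: escape_count_Suc)
    also have "\<dots> = 1 + escape_count \<tau> a (final_rotors \<tau> a ?L) n"
      using vis by (intro less.hyps nbrL finL) simp
    finally show ?thesis unfolding final .
  qed
qed

lemma escape_count_blocks:
  assumes "\<And>x. \<rho> x \<in> E `` {x}" and "\<And>i. finite {t. walker_at \<tau> a ((final_rotors \<tau> a ^^ i) \<rho>) t = a}"
  shows "escape_count \<tau> a \<rho> (\<Sum>i<k. visits \<tau> a ((final_rotors \<tau> a ^^ i) \<rho>)) = k"
  using assms
proof (induction k arbitrary: \<rho>)
  case (Suc k)
  let ?T = "final_rotors \<tau> a"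
  have "(\<Sum>i<Suc k. visits \<tau> a ((?T ^^ i) \<rho>)) = visits \<tau> a \<rho> + (\<Sum>i<k. visits \<tau> a ((?T ^^ i) (?T \<rho>)))"
    by (subst sum.lessThan_Suc_shift) (simp add: funpow_swap1)
  moreover have "escape_count \<tau> a (?T \<rho>) (\<Sum>i<k. visits \<tau> a ((?T ^^ i) (?T \<rho>))) = k"
  proof (rule Suc.IH)
    show "?T \<rho> x \<in> E `` {x}" for x by (rule final_rotors_nbr[OF Suc.prems(1)])
    show "finite {t. walker_at \<tau> a ((?T ^^ i) (?T \<rho>)) t = a}" for i
      using Suc.prems(2)[of "Suc i"] by (simp add: funpow_swap1)
  qed
  ultimately show ?case
    using escape_count_block[OF Suc.prems(1), of a] Suc.prems(2)[of 0] by simp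
qed simp

text \<open>Below the limit, the escape count is known exactly at the block ends and is monotone in
  between, so a bound on block lengths suffices; above it, Schramm's bound holds for every legal
  configuration.\<close>

lemma escape_rate_limit:
  assumes nbr: "\<And>x. \<rho> x \<in> E `` {x}"
    and fin: "\<And>i. finite {t. walker_at \<tau> a ((final_rotors \<tau> a ^^ i) \<rho>) t = a}"
    and upper: "\<And>c. c > green a a \<Longrightarrow> eventually (\<lambda>k. real (\<Sum>i<k. visits \<tau> a ((final_rotors \<tau> a ^^ i) \<rho>)) \<le> c * real k) sequentially"
  shows "(\<lambda>n. real (escape_count \<tau> a \<rho> n) / real n) \<longlonglongrightarrow> escape_prob E a"
proof (rule order_tendstoI)
  let ?I = "escape_count \<tau> a \<rho>"
  let ?S = "\<lambda>k. \<Sum>i<k. visits \<tau> a ((final_rotors \<tau> a ^^ i) \<rho>)"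
  have IS: "?I (?S k) = k" for k by (rule escape_count_blocks[OF nbr fin])
  fix l assume l: "l < escape_prob E a"
  \<comment> \<open>Raising \<open>l\<close> to a positive number permits the divisions and
    inversions that follow.\<close>
  define l' where "l' = max l (escape_prob E a / 2)"
  have l': "l \<le> l'" "0 < l'" "l' < escape_prob E a"
    using l escape_pos[of a] by (auto simp: l'_def)
  obtain m where m: "l' < m" "m < escape_prob E a" using dense[OF l'(3)] by blast
  have "green a a < 1 / m" using m l' by (simp add: green_self divide_strict_left_mono)
  from upper[OF this] obtain K where K: "\<And>k. k \<ge> K \<Longrightarrow> real (?S k) \<le> 1 / m * real k"
    by (auto simp: eventually_sequentially)
  \<comment> \<open>This many blocks absorb the incomplete block in progress at particle
    \<open>n\<close>, that is, the 1 in \<open>Suc k\<close>.\<close>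
  obtain K' where K': "real K' > m / (m - l')" using reals_Archimedean2 by blast
  have "eventually (\<lambda>n. n \<ge> ?S (max K K') \<and> n > 0) sequentially"
    by (intro eventually_conj eventually_ge_at_top eventually_gt_at_top)
  then show "eventually (\<lambda>n. l < real (?I n) / real n) sequentially"
  proof eventually_elim
    case (elim n)
    define k where "k = ?I n"
    have k: "max K K' \<le> k" using escape_count_mono[of "?S (max K K')" n \<tau> a \<rho>] IS elim by (simp add: k_def)
    have "n < ?S (Suc k)"
    proof (rule ccontr)
      assume "\<not> n < ?S (Suc k)"
      then have "Suc k \<le> k" using escape_count_mono[of "?S (Suc k)" n \<tau> a \<rho>] unfolding IS k_def by simp
      then show False by simp
    qed
    then have "real n < real (?S (Suc k))" by (simp only: of_nat_less_iff)
    also have "\<dots> \<le> 1 / m * real (Suc k)" using k by (intro K) auto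
    finally have n: "m * real n < real k + 1" using m l' by (simp add: field_simps)
    have "real k \<ge> real K'" using k by simp
    then have "m / (m - l') < real k" using K' by linarith
    then have "m < real k * (m - l')" using m by (simp add: pos_divide_less_eq)
    then have "l' * (real k + 1) < m * real k" using m by (simp add: algebra_simps)
    have "l' * (m * real n) < l' * (real k + 1)" using n l' by (intro mult_strict_left_mono) auto
    also have "\<dots> < m * real k" by fact
    finally have "m * (l' * real n) < m * real k" by (simp add: algebra_simps)
    then have "l' * real n < real k" using m l' by (simp add: mult_less_cancel_left)
    then have "l' < real k / real n" using elim by (simp add: less_divide_eq)
    then show ?case using l' by (simp add: k_def)
  qed
next
  let ?I = "escape_count \<tau> a \<rho>"
  fix u assume u: "escape_prob E a < u"
  obtain \<beta> where \<beta>: "escape_prob E a < \<beta>" "\<beta> < u" using dense[OF u] by blast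
  obtain C where C: "C \<ge> 0" "\<And>m. real (?I m) \<le> \<beta> * real m + C"
    using escape_count_rate_upper[OF \<beta>(1)] nbr by blast
  obtain N :: nat where N: "C / (u - \<beta>) < real N" using reals_Archimedean2 by blast
  show "eventually (\<lambda>n. real (?I n) / real n < u) sequentially"
    using eventually_gt_at_top[of N]
  proof eventually_elim
    case (elim n)
    have "C < real n * (u - \<beta>)" using N elim \<beta> by (simp add: pos_divide_less_eq) (meson less_trans mult_strict_right_mono of_nat_less_iff diff_gt_0_iff_gt)
    then have "real (?I n) < u * real n" using C(2)[of n] by (simp add: algebra_simps)
    then show ?case using elim by (simp add: divide_less_eq)
  qed
qed

end

section \<open>Almost sure escape rate\<close>

context wsf_graph
begin

lemma AE_escape_rate:
  "AE \<rho> in \<mu>. (\<lambda>n. real (escape_count \<tau> a \<rho> n) / real n) \<longlonglongrightarrow> escape_prob E a"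
proof -
  let ?T = "final_rotors \<tau> a"
  interpret mpt \<mu> ?T
  proof
    have *: "?T \<in> measurable \<mu> cfg_space" using final_rotors_measurable by (simp cong: measurable_cong_sets)
    then show "?T \<in> measurable \<mu> \<mu>" by (simp cong: measurable_cong_sets)
    have "distr \<mu> \<mu> ?T = distr \<mu> cfg_space ?T" by (rule distr_cong) simp_all
    then show "distr \<mu> \<mu> ?T = \<mu>" by (simp add: final_rotors_stationary)
  qed
  \<comment> \<open>A measurable function, nonnegative everywhere as
    \<open>ergodic_upper_bound\<close> demands, that equals \<open>visits\<close> almost
    surely.\<close>
  define f where "f \<rho> = max 0 (lim (\<lambda>t. real (visits_before \<tau> a t \<rho>)))" for \<rho>
  have f_eq: "AE \<rho> in \<mu>. f \<rho> = real (visits \<tau> a \<rho>)"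
    using visits_integrable_le(3)[of a] by eventually_elim (simp add: f_def)
  have f_int: "integrable \<mu> f" unfolding f_def[abs_def] using visits_integrable_le(1) by simp
  have "(\<integral>\<rho>. f \<rho> \<partial>\<mu>) = (\<integral>\<rho>. lim (\<lambda>t. real (visits_before \<tau> a t \<rho>)) \<partial>\<mu>)"
    using f_int visits_integrable_le(1)[of a] visits_integrable_le(3)[of a]
    by (intro integral_cong_AE borel_measurable_integrable) (auto simp: f_def)
  then have f_mean: "(\<integral>\<rho>. f \<rho> \<partial>\<mu>) \<le> green a a" using visits_integrable_le(2)[of a] by simp
  have good: "AE \<rho> in \<mu>. \<forall>i. f ((?T ^^ i) \<rho>) = real (visits \<tau> a ((?T ^^ i) \<rho>))
      \<and> finite {t. walker_at \<tau> a ((?T ^^ i) \<rho>) t = a}"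
    unfolding AE_all_countable
    using AE_iterate[OF f_eq] AE_iterate[OF AE_finite_visits[of a]] by (intro allI AE_conjI)
  \<comment> \<open>The particles of the first \<open>k\<close> blocks contain exactly
    \<open>k\<close> escapes. Schramm's bound on these escapes, solved for the number of particles,
    bounds the total block length from below.\<close>
  have lower: "AE \<rho> in \<mu>. \<forall>r<green a a. eventually (\<lambda>k. r * real k \<le> (\<Sum>i<k. f ((?T ^^ i) \<rho>))) sequentially"
    using good AE_space
  proof eventually_elim
    case (elim \<rho>)
    let ?S = "\<lambda>k. \<Sum>i<k. visits \<tau> a ((?T ^^ i) \<rho>)"
    have nbr: "\<rho> x \<in> E `` {x}" for x using elim by (simp add: space_\<mu>)
    have IS: "escape_count \<tau> a \<rho> (?S k) = k" for k
      using elim(1) by (intro escape_count_blocks nbr) auto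
    have fS: "(\<Sum>i<k. f ((?T ^^ i) \<rho>)) = real (?S k)" for k using elim(1) by simp
    show ?case
    proof (intro allI impI)
      fix r assume r: "r < green a a"
      define r' where "r' = max r (green a a / 2)"
      have g: "green a a > 0" using escape_pos[of a] by (simp add: green_self)
      have r': "r \<le> r'" "0 < r'" "r' < green a a" using r g by (auto simp: r'_def)
      obtain q where q: "r' < q" "q < green a a" using dense[OF r'(3)] by blast
      have "escape_prob E a < 1 / q"
      proof -
        have "q * escape_prob E a < 1" using q(2) escape_pos[of a] by (simp add: green_self less_divide_eq)
        then show ?thesis using q r' by (simp add: less_divide_eq mult.commute)
      qed
      from escape_count_rate_upper[OF this] obtain C where C: "C \<ge> 0"
        "\<And>m. real (escape_count \<tau> a \<rho> m) \<le> 1 / q * real m + C" using nbr by blast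
      have q0: "q > 0" using q r' by linarith
      have Sk: "q * (real k - C) \<le> real (?S k)" for k
      proof -
        have "real k \<le> 1 / q * real (?S k) + C" using C(2)[of "?S k"] unfolding IS .
        then show ?thesis using q0 by (simp add: field_simps)
      qed
      obtain K :: nat where K: "q * C / (q - r') < real K" using reals_Archimedean2 by blast
      show "eventually (\<lambda>k. r * real k \<le> (\<Sum>i<k. f ((?T ^^ i) \<rho>))) sequentially"
        using eventually_ge_at_top[of K]
      proof eventually_elim
        case (elim k)
        have "q * C / (q - r') < real k" using K elim by (meson less_le_trans of_nat_mono)
        then have "q * C < real k * (q - r')" using q by (simp add: pos_divide_less_eq)
        then have "r' * real k \<le> q * (real k - C)" by (simp add: algebra_simps)
        moreover have "r * real k \<le> r' * real k" using r' by (intro mult_right_mono) auto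
        ultimately show ?case using Sk[of k] by (simp only: fS)
      qed
    qed
  qed
  have "AE \<rho> in \<mu>. eventually (\<lambda>k. (\<Sum>i<k. f ((?T ^^ i) \<rho>)) \<le> c * real k) sequentially" if "c > green a a" for c
    by (rule ergodic_upper_bound[OF f_int _ green_nonneg f_mean lower that]) (simp add: f_def)
  \<comment> \<open>The exceptional null set must not depend on \<open>c\<close>; a sequence
    decreasing to \<open>green a a\<close> suffices by monotonicity in \<open>c\<close>.\<close>
  then have "AE \<rho> in \<mu>. \<forall>j. eventually (\<lambda>k. (\<Sum>i<k. f ((?T ^^ i) \<rho>)) \<le> (green a a + 1 / real (Suc j)) * real k) sequentially"
    unfolding AE_all_countable by simp
  then show ?thesis using good AE_space
  proof eventually_elim
    case (elim \<rho>)
    show ?case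
    proof (rule escape_rate_limit)
      show "\<rho> x \<in> E `` {x}" for x using elim by (simp add: space_\<mu>)
      show "finite {t. walker_at \<tau> a ((?T ^^ i) \<rho>) t = a}" for i using elim by simp
      fix c assume c: "c > green a a"
      then obtain j where j: "1 / real (Suc j) < c - green a a" by (metis diff_gt_0_iff_gt nat_approx_posE)
      have "eventually (\<lambda>k. (\<Sum>i<k. f ((?T ^^ i) \<rho>)) \<le> (green a a + 1 / real (Suc j)) * real k) sequentially"
        using elim(1) by blast
      then show "eventually (\<lambda>k. real (\<Sum>i<k. visits \<tau> a ((?T ^^ i) \<rho>)) \<le> c * real k) sequentially"
      proof eventually_elim
        case (elim k)
        have "(green a a + 1 / real (Suc j)) * real k \<le> c * real k" using j by (intro mult_right_mono) auto
        moreover have "(\<Sum>i<k. f ((?T ^^ i) \<rho>)) = real (\<Sum>i<k. visits \<tau> a ((?T ^^ i) \<rho>))"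
          using \<open>\<forall>i. f ((?T ^^ i) \<rho>) = real (visits \<tau> a ((?T ^^ i) \<rho>)) \<and> finite {t. walker_at \<tau> a ((?T ^^ i) \<rho>) t = a}\<close> by simp
        ultimately show ?case using elim by linarith
      qed
    qed
  qed
qed

end

theorem theorem1p4:
  fixes E :: "('v \<times> 'v) set"
    and \<tau> :: "'v \<Rightarrow> 'v \<Rightarrow> 'v"
    and a :: 'v
    and W :: "('v \<times> 'v) set measure"
  assumes "simple_graph E"
    and "connected_graph E"
    and "locally_finite_graph E"
    and "transient_graph E"
    and "local_mechanism E \<tau>"
    and "is_WSF E W"
    and "AE F in W. all_trees_one_ended F"
  shows "AE F in W.
    (\<lambda>n. real (escape_count \<tau> a (rotor_config_of F) n) / real n) \<longlonglongrightarrow> escape_prob E a"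
proof -
  interpret wsf_graph E \<tau> W
    using assms by unfold_locales
  have "AE F in W. (\<lambda>n. real (escape_count \<tau> a (cfg_of F) n) / real n) \<longlonglongrightarrow> escape_prob E a"
    by (rule AE_distrD[OF cfg_of_measurable]) (rule AE_escape_rate[unfolded \<mu>_def])
  then show ?thesis using AE_cfg_of_eq by eventually_elim simp
qed

end
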